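(* For every $T>0$ there exist infinitely many non-trivial weak solutions $(\rho,v)$, with $\rho\in L^\infty(\mathbb{T}^2\times[0,T];\mathbb{R})$ and $v\in L^\infty(\mathbb{T}^2\times[0,T];\mathbb{R}^2)$, of the two-dimensional incompressible porous media system $$\partial_t\rho+\nabla\cdot(v\rho)=0,\qquad \nabla\cdot v=0,\qquad v=-\nabla p-(0,\rho)$$ on $\mathbb{T}^2\times[0,T]$ with initial datum $\rho(x,0)=0$.
   Context: $\mathbb{T}^2$ is the two-dimensional flat torus, and $\nabla$, $\nabla\cdot$ are taken with respect to the space variable $x=(x_1,x_2)\in\mathbb{T}^2$. A pair $(\rho,v)$ of bounded measurable functions on $\mathbb{T}^2\times[0,T]$ is a weak solution of the system with initial datum $\rho_0$ if there is a scalar function $p$ on $\mathbb{T}^2\times[0,T]$ (with integrable weak spatial gradient $\nabla p$) such that for all $\varphi,\chi,\lambda_1,\lambda_2\in C_c^\infty([0,T)\times\mathbb{T}^2)$, with $\lambda=(\lambda_1,\lambda_2)$, $$\int_0^T\!\!\int_{\mathbb{T}^2}\rho\,(\partial_t\varphi+v\cdot\nabla\varphi)\,dx\,dt+\int_{\mathbb{T}^2}\rho_0(x)\varphi(x,0)\,dx=0,$$ $$\int_0^T\!\!\int_{\mathbb{T}^2}v\cdot\nabla\chi\,dx\,dt=0,$$ $$\int_0^T\!\!\int_{\mathbb{T}^2}\bigl(v+\nabla p+(0,\rho)\bigr)\cdot\lambda\,dx\,dt=0.$$ The condition $\rho(x,0)=0$ means $\rho_0=0$ in the first identity. Non-trivial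 means that $(\rho,v)$ is not almost everywhere equal to $(0,0)$. Functions agreeing almost everywhere are identified. *)

theory Defs
  imports "HOL-Analysis.Analysis"
begin

text \<open>The flat torus is R^2/Z^2. A function on (torus x R) is a function of
  \<open>(x, t) :: (real^2) \<times> real\<close> that is 1-periodic in both components of \<open>x\<close>,
  and integrals over the torus are integrals over the unit cell. Time-dependent functions are
  total in \<open>t\<close>; only their values for \<open>t \<in> {0..T}\<close> matter.\<close>

type_synonym 'b spacetime_fun = "(real^2) \<times> real \<Rightarrow> 'b"

definition torus_periodic :: "'b spacetime_fun \<Rightarrow> bool" where
  "torus_periodic f \<longleftrightarrow> (\<forall>x t i. f (x + axis i 1, t) = f (x, t))"

abbreviation torus_measure :: "(real^2) measure" where
  "torus_measure \<equiv> lebesgue_on (cbox 0 1)"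

abbreviation spacetime_measure :: "real set \<Rightarrow> ((real^2) \<times> real) measure" where
  "spacetime_measure J \<equiv> lebesgue_on (cbox 0 1 \<times> J)"

definition L_infinity :: "real \<Rightarrow> ('b::euclidean_space) spacetime_fun \<Rightarrow> bool" where
  "L_infinity T f \<longleftrightarrow> torus_periodic f \<and>
     f \<in> borel_measurable (spacetime_measure {0..T}) \<and>
     (\<exists>C. AE z in spacetime_measure {0..T}. norm (f z) \<le> C)"

primrec C_k :: "nat \<Rightarrow> ('a::euclidean_space \<Rightarrow> real) \<Rightarrow> bool" where
  "C_k 0 f \<longleftrightarrow> continuous_on UNIV f"
| "C_k (Suc k) f \<longleftrightarrow> (\<forall>x. f differentiable (at x)) \<and>
     (\<forall>h. C_k k (\<lambda>x. frechet_derivative f (at x) h))"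

definition C_infinity :: "('a::euclidean_space \<Rightarrow> real) \<Rightarrow> bool" where
  "C_infinity f \<longleftrightarrow> (\<forall>k. C_k k f)"

text \<open>Test functions on (torus x J), for \<open>J = {0..<T}\<close> or \<open>J = {0<..<T}\<close>.
  Smoothness up to \<open>t = 0\<close> in the case \<open>J = {0..<T}\<close> means being the restriction of a smooth
  function on (torus x R), so \<open>\<phi>\<close> stands for such an extension, whose values at \<open>t < 0\<close> are
  irrelevant; beyond the compact time support it is extended by zero.\<close>

definition test_function :: "real set \<Rightarrow> real spacetime_fun \<Rightarrow> bool" where
  "test_function J \<phi> \<longleftrightarrow> torus_periodic \<phi> \<and> C_infinity \<phi> \<and>
     (\<exists>K. compact K \<and> K \<subseteq> J \<and> (\<forall>x t. 0 \<le> t \<and> t \<notin> K \<longrightarrow> \<phi> (x, t) = 0))"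

definition time_deriv :: "real spacetime_fun \<Rightarrow> real spacetime_fun" where
  "time_deriv \<phi> z = frechet_derivative \<phi> (at z) (0, 1)"

definition space_grad :: "real spacetime_fun \<Rightarrow> (real^2) spacetime_fun" where
  "space_grad \<phi> z = (\<chi> i. frechet_derivative \<phi> (at z) (axis i 1, 0))"

text \<open>\<open>g\<close> is an integrable weak spatial gradient of the locally integrable function \<open>p\<close>, in the
  sense of distributions on (torus x (0,T)).\<close>

definition weak_space_grad :: "real \<Rightarrow> real spacetime_fun \<Rightarrow> (real^2) spacetime_fun \<Rightarrow> bool" where
  "weak_space_grad T p g \<longleftrightarrow>
     torus_periodic p \<and> (\<forall>a b. 0 < a \<and> b < T \<longrightarrow> integrable (spacetime_measure {a..b}) p) \<and>
     torus_periodic g \<and> integrable (spacetime_measure {0..T}) g \<and>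
     (\<forall>\<psi>. test_function {0<..<T} \<psi> \<longrightarrow>
        (\<forall>i. (\<integral>z. p z * (space_grad \<psi> z $ i) \<partial>spacetime_measure {0..T}) =
             - (\<integral>z. (g z $ i) * \<psi> z \<partial>spacetime_measure {0..T})))"

definition ipm_weak_solution ::
  "real \<Rightarrow> (real^2 \<Rightarrow> real) \<Rightarrow> real spacetime_fun \<Rightarrow> (real^2) spacetime_fun \<Rightarrow> bool" where
  "ipm_weak_solution T \<rho>\<^sub>0 \<rho> v \<longleftrightarrow>
     L_infinity T \<rho> \<and> L_infinity T v \<and>
     (\<exists>p grad_p. weak_space_grad T p grad_p \<and>
       (\<forall>\<phi>. test_function {0..<T} \<phi> \<longrightarrow>
          (\<integral>z. \<rho> z * (time_deriv \<phi> z + v z \<bullet> space_grad \<phi> z) \<partial>spacetime_measure {0..T})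
          + (\<integral>x. \<rho>\<^sub>0 x * \<phi> (x, 0) \<partial>torus_measure) = 0) \<and>
       (\<forall>\<eta>. test_function {0..<T} \<eta> \<longrightarrow>
          (\<integral>z. v z \<bullet> space_grad \<eta> z \<partial>spacetime_measure {0..T}) = 0) \<and>
       (\<forall>l1 l2. test_function {0..<T} l1 \<and> test_function {0..<T} l2 \<longrightarrow>
          (\<integral>z. (v z + grad_p z + vector [0, \<rho> z]) \<bullet> vector [l1 z, l2 z]
             \<partial>spacetime_measure {0..T}) = 0))"

definition ae_equal ::
  "real \<Rightarrow> ((real spacetime_fun \<times> (real^2) spacetime_fun) \<times>
            (real spacetime_fun \<times> (real^2) spacetime_fun)) set" where
  "ae_equal T = {((\<rho>, v), (\<rho>', v')).
     AE z in spacetime_measure {0..T}. \<rho> z = \<rho>' z \<and> v z = v' z}"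

lemma equiv_ae_equal: "equiv UNIV (ae_equal T)"
proof (rule equivI)
  show "refl (ae_equal T)"
    by (auto simp: refl_on_def ae_equal_def)
  show "sym (ae_equal T)"
    by (auto simp: sym_def ae_equal_def eq_commute)
  show "trans (ae_equal T)"
    unfolding trans_def ae_equal_def by (auto elim: eventually_elim2)
qed auto

end

theory Submission
  imports Defs
begin

text \<open>
  Write \<open>m\<close> for the flux \<open>\<rho> v\<close>. The system consists of the linear equations
  \<open>\<partial>\<^sub>t \<rho> + div m = 0\<close>, \<open>div v = 0\<close>, \<open>v + (0, \<rho>) = - grad p\<close> and of the pointwise constraint \<open>m = \<rho> v\<close>.
  The proof is by convex integration: the linear equations are solved exactly all along, and the
  constraint is reached in the limit by adding faster and faster oscillations.

  The linear equations are solved by two scalar potentials,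
  \<open>\<rho> = - \<Delta>\<Phi>\<close>, \<open>v = (- \<Phi>\<^sub>1\<^sub>2, \<Phi>\<^sub>1\<^sub>1)\<close>, \<open>p = \<Phi>\<^sub>2\<close> and
  \<open>m = (0, - b) + grad \<Phi>\<^sub>t + (- \<Theta>\<^sub>2, \<Theta>\<^sub>1)\<close>. The constant \<open>(0, - b)\<close> is free of divergence, so
  \<open>\<Phi> = \<Theta> = 0\<close> is a solution of the linear part, with \<open>\<rho> = 0\<close> and \<open>v = 0\<close>. On the other hand the mean of
  \<open>m\<close> over the torus is \<open>(0, - b)\<close> for all potentials. Hence a solution obtained in the
  limit satisfies \<open>\<integral> \<rho> v\<^sub>2 = - b T\<close>: it is not trivial, and different \<open>b\<close> give different solutions.

  What makes the oscillations work is the choice of coordinates. For \<open>\<kappa> = 1, - 1\<close> let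
  \<open>\<sigma>\<^sub>\<kappa> = \<kappa> v\<^sub>1 - v\<^sub>2\<close> and \<open>\<mu>\<^sub>\<kappa> = \<kappa> m\<^sub>1 - m\<^sub>2\<close>, and call \<open>d\<^sub>\<kappa> = \<mu>\<^sub>\<kappa> - \<rho> \<sigma>\<^sub>\<kappa>\<close> the defect; the constraint says that
  both defects vanish. A plane wave of high frequency with phase \<open>x\<^sub>1 + \<kappa> x\<^sub>2 + w t\<close>, whose value in
  the density is \<open>s\<close>, adds \<open>s\<close> to \<open>\<rho>\<close> and to \<open>\<sigma>\<^sub>\<kappa>\<close> and does not change \<open>\<sigma>\<^sub>-\<^sub>\<kappa>\<close>, up to terms that are small
  with the wavelength. If \<open>\<Theta>\<close> is changed suitably and \<open>w\<close> equals \<open>\<kappa> \<sigma>\<^sub>-\<^sub>\<kappa>\<close>, then \<open>d\<^sub>-\<^sub>\<kappa>\<close> does not change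
  either, while \<open>d\<^sub>\<kappa>\<close> becomes \<open>d\<^sub>\<kappa> - 2 \<sigma>\<^sub>\<kappa> s - s\<^sup>2\<close>, so that \<open>\<sigma>\<^sub>\<kappa>\<^sup>2 + d\<^sub>\<kappa>\<close> is preserved.
  Therefore the pointwise inequalities \<open>d\<^sub>\<kappa> > 0\<close> and \<open>\<sigma>\<^sub>\<kappa>\<^sup>2 + d\<^sub>\<kappa> < 2\<close>, which
  define a subsolution, survive if \<open>s\<close> is at most \<open>d\<^sub>\<kappa> / 8\<close> in absolute value. They keep
  velocity and density bounded, and the mean of \<open>d\<^sub>\<kappa>\<close> drops by the mean of \<open>s\<^sup>2\<close>.

  The wave speed \<open>w\<close> has to be constant whereas \<open>\<sigma>\<^sub>-\<^sub>\<kappa>\<close> is not. So a packet of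
  waves is added whose amplitudes are concentrated, by polynomials in \<open>\<sigma>\<^sub>-\<^sub>\<kappa>\<close>, on the sets where \<open>\<sigma>\<^sub>-\<^sub>\<kappa>\<close> is
  nearly constant (\<open>localizing_polynomials\<close>). As the amplitudes are polynomials in the state, all
  potentials stay in an algebra of trigonometric polynomials that is closed under differentiation.
  The result is \<open>perturbation_step\<close>. A factor \<open>t\<close> in the amplitudes preserves the initial datum.

  Iterating, the defects tend to 0 in the mean. New waves are almost orthogonal to the finitely
  many states before them, so the bounded sequences \<open>\<rho>\<close> and \<open>\<sigma>\<^sub>\<kappa>\<close> have almost increasing norms
  and converge strongly in \<open>L\<^sup>2\<close> (\<open>L2_increments_Cauchy\<close>). Along a subsequence there is convergence almost
  everywhere; then \<open>\<mu>\<^sub>\<kappa> = d\<^sub>\<kappa> + \<rho> \<sigma>\<^sub>\<kappa>\<close> tends to \<open>\<rho> \<sigma>\<^sub>\<kappa>\<close>, and the linear equations pass to the limit by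
  dominated convergence.
\<close>

section \<open>Trigonometric polynomials and their derivatives\<close>

definition pd :: "(real^2) \<times> real \<Rightarrow> real spacetime_fun \<Rightarrow> real spacetime_fun" where
  "pd b f = (\<lambda>z. frechet_derivative f (at z) b)"

definition C1 :: "real spacetime_fun \<Rightarrow> bool" where
  "C1 f \<longleftrightarrow> (\<forall>z. f differentiable (at z)) \<and> (\<forall>b. continuous_on UNIV (pd b f))"

lemma C1_has_derivative: "C1 f \<Longrightarrow> (f has_derivative (\<lambda>b. pd b f z)) (at z)"
  unfolding C1_def pd_def using frechet_derivative_works[of f "at z"] by metis

lemma C1_I:
  assumes "\<And>z. (f has_derivative (\<lambda>b. f' b z)) (at z)" "\<And>b. continuous_on UNIV (f' b)"
  shows "C1 f" "pd b f = f' b"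
proof -
  have *: "pd b f = f' b" for b
    unfolding pd_def by (rule ext) (simp flip: frechet_derivative_at[OF assms(1)])
  then show "pd b f = f' b" .
  show "C1 f"
    unfolding C1_def using assms * by (auto intro: differentiableI)
qed

lemma C1_continuous: "C1 f \<Longrightarrow> continuous_on UNIV f"
  by (meson C1_has_derivative continuous_at_imp_continuous_on has_derivative_continuous)

lemma C1_continuous_pd: "C1 f \<Longrightarrow> continuous_on UNIV (pd b f)"
  unfolding C1_def by blast

lemma C1_const: "C1 (\<lambda>z. c)" and pd_const: "pd b (\<lambda>z. c) = (\<lambda>z. 0)"
proof -
  have 1: "((\<lambda>z. c) has_derivative (\<lambda>b. 0)) (at z)" for z :: "(real^2) \<times> real"
    by (rule has_derivative_const)
  show "C1 (\<lambda>z. c)" "pd b (\<lambda>z. c) = (\<lambda>z. 0)"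
    by (rule C1_I[OF 1 continuous_on_const])+
qed

lemma C1_snd: "C1 (\<lambda>z. snd z)" and pd_snd: "pd b (\<lambda>z. snd z) = (\<lambda>z. snd b)"
proof -
  have 1: "((\<lambda>z. snd z) has_derivative (\<lambda>b. snd b)) (at z)" for z :: "(real^2) \<times> real"
    by (intro bounded_linear_imp_has_derivative bounded_linear_snd)
  show "C1 (\<lambda>z. snd z)" "pd b (\<lambda>z. snd z) = (\<lambda>z. snd b)"
    by (rule C1_I[OF 1 continuous_on_const])+
qed

lemma
  assumes "C1 f" "C1 g"
  shows C1_add: "C1 (\<lambda>z. f z + g z)" and pd_add: "pd b (\<lambda>z. f z + g z) = (\<lambda>z. pd b f z + pd b g z)"
proof -
  have 1: "((\<lambda>z. f z + g z) has_derivative (\<lambda>b. pd b f z + pd b g z)) (at z)" for z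
    by (intro has_derivative_add C1_has_derivative assms)
  have 2: "continuous_on UNIV (\<lambda>z. pd b f z + pd b g z)" for b
    by (intro continuous_intros C1_continuous_pd assms)
  show "C1 (\<lambda>z. f z + g z)" "pd b (\<lambda>z. f z + g z) = (\<lambda>z. pd b f z + pd b g z)"
    by (rule C1_I[OF 1 2])+
qed

lemma
  assumes "C1 f" "C1 g"
  shows C1_mult: "C1 (\<lambda>z. f z * g z)"
    and pd_mult: "pd b (\<lambda>z. f z * g z) = (\<lambda>z. f z * pd b g z + pd b f z * g z)"
proof -
  have 1: "((\<lambda>z. f z * g z) has_derivative (\<lambda>b. f z * pd b g z + pd b f z * g z)) (at z)" for z
    by (intro has_derivative_mult C1_has_derivative assms)
  have 2: "continuous_on UNIV (\<lambda>z. f z * pd b g z + pd b f z * g z)" for b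
    by (intro continuous_intros C1_continuous C1_continuous_pd assms)
  show "C1 (\<lambda>z. f z * g z)" "pd b (\<lambda>z. f z * g z) = (\<lambda>z. f z * pd b g z + pd b f z * g z)"
    by (rule C1_I[OF 1 2])+
qed

text \<open>The spatial wave vector is integral, which makes \<open>cos\<close> and \<open>sin\<close> of the phase periodic. The frequency
  in time is an arbitrary real number, since nothing has to be periodic in time.\<close>

definition phase :: "int \<Rightarrow> int \<Rightarrow> real \<Rightarrow> real spacetime_fun" where
  "phase k l w z = 2 * pi * (of_int k * fst z $ 1 + of_int l * fst z $ 2) + w * snd z"

lemma phase_derivative: "(phase k l w has_derivative phase k l w) (at z)"
proof -
  have "bounded_linear (phase k l w)"
    unfolding phase_def
    by (intro bounded_linear_add bounded_linear_const_mult bounded_linear_snd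
        bounded_linear_compose[OF bounded_linear_vec_nth bounded_linear_fst])
  then show ?thesis by (rule bounded_linear_imp_has_derivative)
qed

lemma phase_continuous: "continuous_on S (phase k l w)"
  unfolding phase_def by (intro continuous_intros)

lemma C1_cos: "C1 (\<lambda>z. cos (phase k l w z))"
  and pd_cos: "pd b (\<lambda>z. cos (phase k l w z)) = (\<lambda>z. - phase k l w b * sin (phase k l w z))"
proof -
  have 1: "((\<lambda>z. cos (phase k l w z)) has_derivative (\<lambda>b. - phase k l w b * sin (phase k l w z))) (at z)" for z
    using has_derivative_cos[OF phase_derivative, of k l w z] by simp
  have 2: "continuous_on UNIV (\<lambda>z. - phase k l w b * sin (phase k l w z))" for b
    by (intro continuous_intros phase_continuous)
  show "C1 (\<lambda>z. cos (phase k l w z))"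
    "pd b (\<lambda>z. cos (phase k l w z)) = (\<lambda>z. - phase k l w b * sin (phase k l w z))"
    by (rule C1_I[OF 1 2])+
qed

lemma C1_sin: "C1 (\<lambda>z. sin (phase k l w z))"
  and pd_sin: "pd b (\<lambda>z. sin (phase k l w z)) = (\<lambda>z. phase k l w b * cos (phase k l w z))"
proof -
  have 1: "((\<lambda>z. sin (phase k l w z)) has_derivative (\<lambda>b. phase k l w b * cos (phase k l w z))) (at z)" for z
    using has_derivative_sin[OF phase_derivative, of k l w z] by simp
  have 2: "continuous_on UNIV (\<lambda>z. phase k l w b * cos (phase k l w z))" for b
    by (intro continuous_intros phase_continuous)
  show "C1 (\<lambda>z. sin (phase k l w z))"
    "pd b (\<lambda>z. sin (phase k l w z)) = (\<lambda>z. phase k l w b * cos (phase k l w z))"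
    by (rule C1_I[OF 1 2])+
qed

text \<open>All potentials live in this algebra. It is generated by the waves and the time variable, contains every
  polynomial in its members and is closed under differentiation, so that a member has derivatives of all orders and
  amplitudes may be built from derivatives of the potentials. The time variable serves to make functions vanish
  at time 0.\<close>

inductive_set trig :: "real spacetime_fun set" where
  trig_const: "(\<lambda>z. c) \<in> trig"
| trig_snd: "(\<lambda>z. snd z) \<in> trig"
| trig_cos: "(\<lambda>z. cos (phase k l w z)) \<in> trig"
| trig_sin: "(\<lambda>z. sin (phase k l w z)) \<in> trig"
| trig_add: "f \<in> trig \<Longrightarrow> g \<in> trig \<Longrightarrow> (\<lambda>z. f z + g z) \<in> trig"
| trig_mult: "f \<in> trig \<Longrightarrow> g \<in> trig \<Longrightarrow> (\<lambda>z. f z * g z) \<in> trig"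

lemma trig_C1: "f \<in> trig \<Longrightarrow> C1 f"
  by (induction rule: trig.induct) (auto intro: C1_const C1_snd C1_cos C1_sin C1_add C1_mult)

lemma trig_scale: "f \<in> trig \<Longrightarrow> (\<lambda>z. c * f z) \<in> trig"
  by (rule trig_mult[OF trig_const])

lemma trig_minus: "f \<in> trig \<Longrightarrow> (\<lambda>z. - f z) \<in> trig"
  using trig_scale[of f "-1"] by simp

lemma trig_pd: "f \<in> trig \<Longrightarrow> pd b f \<in> trig"
  by (induction rule: trig.induct)
     (auto simp: pd_const pd_snd pd_cos pd_sin pd_add pd_mult trig_C1
       intro!: trig.intros trig_scale trig_minus)

lemma trig_diff: "f \<in> trig \<Longrightarrow> g \<in> trig \<Longrightarrow> (\<lambda>z. f z - g z) \<in> trig"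
  using trig_add[OF _ trig_minus, of f g] by simp

lemma trig_sum: "(\<And>i. i \<in> I \<Longrightarrow> f i \<in> trig) \<Longrightarrow> (\<lambda>z. \<Sum>i\<in>I. f i z) \<in> trig"
  by (induction I rule: infinite_finite_induct) (auto intro: trig.intros)

lemma pd_scale: "C1 f \<Longrightarrow> pd b (\<lambda>z. c * f z) = (\<lambda>z. c * pd b f z)"
  by (simp add: pd_mult C1_const pd_const)

lemma
  assumes "C1 f"
  shows C1_minus: "C1 (\<lambda>z. - f z)" and pd_minus: "pd b (\<lambda>z. - f z) = (\<lambda>z. - pd b f z)"
  using C1_mult[OF C1_const assms, of "-1"] pd_scale[OF assms, of b "-1"] by simp_all

lemma
  assumes "C1 f" "C1 g"
  shows C1_diff: "C1 (\<lambda>z. f z - g z)" and pd_diff: "pd b (\<lambda>z. f z - g z) = (\<lambda>z. pd b f z - pd b g z)"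
  using C1_add[OF assms(1) C1_minus[OF assms(2)]] pd_add[OF assms(1) C1_minus[OF assms(2)], of b]
  by (simp_all add: pd_minus[OF assms(2)])

lemma C1_sum: "(\<And>i. i \<in> I \<Longrightarrow> C1 (f i)) \<Longrightarrow> C1 (\<lambda>z. \<Sum>i\<in>I. f i z)"
  by (induction I rule: infinite_finite_induct) (auto intro: C1_const C1_add)

lemma pd_sum: "(\<And>i. i \<in> I \<Longrightarrow> C1 (f i)) \<Longrightarrow> pd b (\<lambda>z. \<Sum>i\<in>I. f i z) = (\<lambda>z. \<Sum>i\<in>I. pd b (f i) z)"
proof (induction I rule: infinite_finite_induct)
  case (insert x F)
  then show ?case using pd_add[of "f x" "\<lambda>z. \<Sum>i\<in>F. f i z" b] by (simp add: C1_sum)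
qed (auto simp: pd_const)

lemma pd_commute: "f \<in> trig \<Longrightarrow> pd a (pd b f) = pd b (pd a f)"
proof (induction rule: trig.induct)
  case (trig_cos k l w)
  show ?case
    unfolding pd_cos pd_scale[OF C1_sin] pd_sin by (simp add: mult_ac)
next
  case (trig_sin k l w)
  show ?case
    unfolding pd_sin pd_scale[OF C1_cos] pd_cos by (simp add: mult_ac)
next
  case (trig_add f g)
  then show ?case by (simp add: pd_add trig_C1 trig_pd)
next
  case (trig_mult f g)
  then have *: "C1 f" "C1 g" "C1 (pd a f)" "C1 (pd a g)" "C1 (pd b f)" "C1 (pd b g)"
    by (auto intro: trig_C1 trig_pd)
  show ?case
    by (simp add: pd_mult[OF *(1,2)] pd_add[OF C1_mult C1_mult] pd_mult * trig_mult.IH add_ac mult_ac)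
qed (simp_all add: pd_const pd_snd)

lemma phase_periodic: "\<exists>n::int. phase k l w (x + axis i 1, t) = phase k l w (x, t) + 2 * pi * n"
proof (cases "i = 1")
  case True
  then show ?thesis by (intro exI[of _ k]) (simp add: phase_def axis_def algebra_simps)
next
  case False
  then have "i = 2" using exhaust_2 by blast
  then show ?thesis by (intro exI[of _ l]) (simp add: phase_def axis_def algebra_simps)
qed

lemma cos_sin_int_shift: "cos (x + 2 * pi * of_int n) = cos x" "sin (x + 2 * pi * of_int n) = sin x"
  using cos_int_2pin[of n] sin_int_2pin[of n] by (auto simp: cos_add sin_add mult.assoc)

lemma trig_periodic: "f \<in> trig \<Longrightarrow> torus_periodic f"
proof (induction rule: trig.induct)
  case (trig_cos k l w)
  show ?case unfolding torus_periodic_def using phase_periodic cos_sin_int_shift by metis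
next
  case (trig_sin k l w)
  show ?case unfolding torus_periodic_def using phase_periodic cos_sin_int_shift by metis
qed (auto simp: torus_periodic_def)

section \<open>Integration by parts on the torus\<close>

lemma cell_cbox: "cbox 0 1 \<times> {a..T} = cbox (0::real^2, a::real) (1, T)"
  by (simp add: cbox_Pair_eq)

lemma cont_integrable:
  fixes f :: "((real^2) \<times> real) \<Rightarrow> 'b::euclidean_space"
  assumes "continuous_on UNIV f"
  shows "integrable (spacetime_measure {0..T}) f"
  unfolding cell_cbox
  by (rule continuous_imp_integrable) (rule continuous_on_subset[OF assms subset_UNIV])

lemma cell_sets: "cbox 0 1 \<times> {0..T} \<in> sets (lebesgue :: ((real^2) \<times> real) measure)"
  unfolding cell_cbox by simp

lemma integral_HK:
  assumes "continuous_on UNIV (f::real spacetime_fun)"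
  shows "(\<integral>z. f z \<partial>spacetime_measure {0..T}) = integral (cbox (0, 0) (1, T)) f"
  using lebesgue_integral_eq_integral[OF cont_integrable[OF assms] cell_sets]
  by (simp only: cell_cbox)

lemma axis_Basis: "(axis i 1, 0) \<in> (Basis :: ((real^2) \<times> real) set)"
  by (simp add: Basis_prod_def axis_in_Basis_iff)

text \<open>The shifted unit cell is cut at the hyperplane where the coordinate equals 1; moving the part beyond it back by one
  period restores the cell.\<close>

lemma integral_shift_periodic:
  fixes F :: "real spacetime_fun"
  assumes "continuous_on UNIV F" "torus_periodic F" "0 \<le> h" "h \<le> 1"
  shows "integral (cbox (0, 0) (1, T)) (\<lambda>z. F (z + h *\<^sub>R (axis i 1, 0))) = integral (cbox (0, 0) (1, T)) F"
proof -
  define k :: "(real^2) \<times> real" where "k = (axis i 1, 0)"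
  let ?A = "(0,0) :: (real^2) \<times> real" and ?B = "(1,T) :: (real^2) \<times> real"
  have k: "k \<in> Basis" unfolding k_def by (rule axis_Basis)
  have int: "F integrable_on cbox a b" for a b
    by (rule integrable_continuous) (rule continuous_on_subset[OF assms(1)], simp)
  have per: "F (z + k) = F z" for z
    using assms(2) by (cases z) (simp add: torus_periodic_def k_def)
  have zk: "z \<bullet> k = fst z $ i" for z
    by (simp add: k_def inner_prod_def inner_axis)
  have mem: "z \<in> cbox (u, 0) (w, T) \<longleftrightarrow> u $ 1 \<le> fst z $ 1 \<and> fst z $ 1 \<le> w $ 1 \<and>
      u $ 2 \<le> fst z $ 2 \<and> fst z $ 2 \<le> w $ 2 \<and> 0 \<le> snd z \<and> snd z \<le> T" for z :: "(real^2) \<times> real" and u w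
    by (cases z) (auto simp: cbox_Pair_eq mem_box_cart forall_2)
  have shifted: "?A + c *\<^sub>R k = (c *\<^sub>R axis i 1, 0)" "?B + c *\<^sub>R k = (1 + c *\<^sub>R axis i 1, T)" for c
    by (simp_all add: k_def)
  have i: "i = 1 \<or> i = 2" using exhaust_2[of i] by blast
  have cell:
    "cbox (?A + h *\<^sub>R k) (?B + h *\<^sub>R k) \<inter> {z. z \<bullet> k \<le> 1} = cbox ?A ?B \<inter> {z. z \<bullet> k \<ge> h}"
    "cbox (?A + h *\<^sub>R k) (?B + h *\<^sub>R k) \<inter> {z. z \<bullet> k \<ge> 1} = cbox (?A + 1 *\<^sub>R k) (?B + h *\<^sub>R k)"
    "cbox ?A (?B + (h-1) *\<^sub>R k) = cbox ?A ?B \<inter> {z. z \<bullet> k \<le> h}"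
    unfolding shifted set_eq_iff Int_iff mem_Collect_eq mem zk using i assms(3,4)
    by (elim disjE; simp add: axis_def; smt (verit))+
  have "integral (cbox ?A ?B) (\<lambda>z. F (z + h *\<^sub>R k)) = integral (cbox (?A + h *\<^sub>R k) (?B + h *\<^sub>R k)) F"
    using integral_shift_cbox[of "?A + h *\<^sub>R k" "h *\<^sub>R k" "?B + h *\<^sub>R k" F] by simp
  also have "\<dots> = integral (cbox (?A + h *\<^sub>R k) (?B + h *\<^sub>R k) \<inter> {z. z \<bullet> k \<le> 1}) F
      + integral (cbox (?A + h *\<^sub>R k) (?B + h *\<^sub>R k) \<inter> {z. z \<bullet> k \<ge> 1}) F"
    by (rule integral_split[OF int k])
  also have "cbox (?A + h *\<^sub>R k) (?B + h *\<^sub>R k) \<inter> {z. z \<bullet> k \<le> 1} = cbox ?A ?B \<inter> {z. z \<bullet> k \<ge> h}"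
    by (rule cell)
  also have "cbox (?A + h *\<^sub>R k) (?B + h *\<^sub>R k) \<inter> {z. z \<bullet> k \<ge> 1} = cbox (?A + k) (?B + h *\<^sub>R k)"
    using cell(2) by simp
  also have "integral (cbox (?A + k) (?B + h *\<^sub>R k)) F = integral (cbox ?A (?B + (h-1) *\<^sub>R k)) (\<lambda>z. F (z + k))"
    using integral_shift_cbox[of "?A + k" k "?B + h *\<^sub>R k" F] by (simp add: algebra_simps)
  also have "(\<lambda>z. F (z + k)) = F" by (simp add: per)
  also have "cbox ?A (?B + (h-1) *\<^sub>R k) = cbox ?A ?B \<inter> {z. z \<bullet> k \<le> h}"
    by (rule cell)
  also have "integral (cbox ?A ?B \<inter> {z. z \<bullet> k \<ge> h}) F + integral (cbox ?A ?B \<inter> {z. z \<bullet> k \<le> h}) F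
    = integral (cbox ?A ?B) F"
    using integral_split[OF int[of ?A ?B] k, of h] by simp
  finally show ?thesis by (simp add: k_def)
qed

text \<open>The integral of the shifted function is constant in the shift by periodicity, so its derivative, which is the integral
  of the partial derivative, vanishes.\<close>

lemma integral_pd_space:
  assumes "C1 F" "torus_periodic F"
  shows "(\<integral>z. pd (axis i 1, 0) F z \<partial>spacetime_measure {0..T}) = 0"
proof -
  define k :: "(real^2) \<times> real" where "k = (axis i 1, 0)"
  let ?Q = "cbox (0,0) (1,T) :: ((real^2) \<times> real) set"
  define G where "G h = integral ?Q (\<lambda>z. F (z + h *\<^sub>R k))" for h
  have "(G has_field_derivative integral ?Q (\<lambda>z. pd k F (z + 0 *\<^sub>R k))) (at 0 within {0..1})"
    unfolding G_def
  proof (rule leibniz_rule_field_derivative[where f="\<lambda>h z. F (z + h *\<^sub>R k)" and fx="\<lambda>h z. pd k F (z + h *\<^sub>R k)"])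
    fix h z 
    have "((\<lambda>h. F (z + h *\<^sub>R k)) has_derivative (\<lambda>x. pd (x *\<^sub>R k) F (z + h *\<^sub>R k))) (at h within {0..1})"
      by (rule has_derivative_compose[OF _ C1_has_derivative[OF assms(1)]]) (auto intro!: derivative_eq_intros)
    moreover have "pd (x *\<^sub>R k) F w = x * pd k F w" for x w
      using linear_scale[OF has_derivative_linear[OF C1_has_derivative[OF assms(1), of w]], of x k]
      by simp
    ultimately show "((\<lambda>h. F (z + h *\<^sub>R k)) has_field_derivative pd k F (z + h *\<^sub>R k)) (at h within {0..1})"
      by (simp add: has_field_derivative_def mult_commute_abs)
  next
    fix h :: real
    show "(\<lambda>z. F (z + h *\<^sub>R k)) integrable_on ?Q"
      by (intro integrable_continuous continuous_on_compose2[OF C1_continuous[OF assms(1)]] continuous_intros) auto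
  next
    show "continuous_on ({0..1} \<times> ?Q) (\<lambda>(h, z). pd k F (z + h *\<^sub>R k))"
      unfolding split_beta
      by (intro continuous_on_compose2[OF C1_continuous_pd[OF assms(1)]] continuous_intros) auto
  qed auto
  moreover have "(G has_field_derivative 0) (at 0 within {0..1})"
  proof (rule has_field_derivative_transform_within[where d=1 and f="\<lambda>_. integral ?Q F"])
    fix h :: real assume "h \<in> {0..1}"
    then show "integral ?Q F = G h" unfolding G_def k_def
      by (intro integral_shift_periodic[symmetric] C1_continuous assms) auto
  qed auto
  ultimately have "integral ?Q (\<lambda>z. pd k F (z + 0 *\<^sub>R k)) = 0"
    by (rule has_field_derivative_unique) (simp add: trivial_limit_within islimpt_Icc)
  moreover have "(\<lambda>z. pd k F (z + 0 *\<^sub>R k)) = pd k F" by simp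
  ultimately show ?thesis 
    by (simp add: integral_HK[OF C1_continuous_pd[OF assms(1)]] k_def)
qed

lemma integral_pd_time:
  assumes "C1 F" "T \<ge> 0" "\<And>x. F (x, 0) = 0" "\<And>x. F (x, T) = 0"
  shows "(\<integral>z. pd (0, 1) F z \<partial>spacetime_measure {0..T}) = 0"
proof -
  have "integral (cbox (0,0) (1,T)) (pd (0, 1) F) 
     = integral (cbox 0 1) (\<lambda>x. integral (cbox 0 T) (\<lambda>t. pd (0, 1) F (x, t)))"
    by (intro integral_prod_continuous continuous_on_subset[OF C1_continuous_pd[OF assms(1)]]) auto
  also have "\<dots> = 0"
  proof -
    have "((\<lambda>t. pd (0, 1) F (x, t)) has_integral (F (x, T) - F (x, 0))) {0..T}" for x
    proof (rule fundamental_theorem_of_calculus[OF assms(2)])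
      fix t
      have "((\<lambda>t. F (x, t)) has_derivative (\<lambda>s. pd (0, s) F (x, t))) (at t within {0..T})"
        by (rule has_derivative_compose[OF _ C1_has_derivative[OF assms(1)]]) (auto intro!: derivative_eq_intros)
      moreover have "(\<lambda>s. pd (0, s) F (x, t)) = (\<lambda>s. s *\<^sub>R pd (0,1) F (x, t))"
      proof
        fix s show "pd (0, s) F (x, t) = s *\<^sub>R pd (0,1) F (x, t)"
          using linear_scale[OF has_derivative_linear[OF C1_has_derivative[OF assms(1), of "(x,t)"]], of s "(0,1)"]
          by simp
      qed
      ultimately show "((\<lambda>t. F (x, t)) has_vector_derivative pd (0, 1) F (x, t)) (at t within {0..T})"
        by (simp add: has_vector_derivative_def)
    qed
    then have "integral (cbox 0 T) (\<lambda>t. pd (0, 1) F (x, t)) = 0" for x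
      using assms(3,4) by (simp add: integral_unique)
    then show ?thesis by simp
  qed
  finally show ?thesis by (simp add: integral_HK[OF C1_continuous_pd[OF assms(1)]])
qed

section \<open>Localising polynomials\<close>

lemma trig_polynomial:
  assumes "real_polynomial_function (p :: real \<Rightarrow> real)" "f \<in> trig"
  shows "(\<lambda>z. p (f z)) \<in> trig"
  using assms(1)
proof (induction p rule: real_polynomial_function.induct)
  case (linear p)
  have "p x = p 1 * x" for x
    using linear_scale[OF bounded_linear.linear[OF linear], of x 1] by simp
  then have "(\<lambda>z. p (f z)) = (\<lambda>z. p 1 * f z)" by (rule ext)
  then show ?case using trig_scale[OF assms(2), of "p 1"] by metis
qed (auto intro: trig.intros)

text \<open>At every point exactly two consecutive tents on a grid of width \<open>h\<close> are relevant. Their values \<open>1 - f\<close> and \<open>f\<close> add up to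
  1, and the sum of their squares is at least one half.\<close>

lemma tent_partition:
  fixes h u :: real and n :: nat and y tent :: "nat \<Rightarrow> real"
  assumes h: "0 < h" and u: "-2 \<le> u" "u \<le> 2" and n: "n * h \<ge> 4 + 2 * h"
  defines "y \<equiv> \<lambda>j::nat. -2 + real j * h"
  defines "tent \<equiv> \<lambda>j::nat. max 0 (1 - \<bar>u - y j\<bar> / h)"
  shows "(\<Sum>j<n. tent j) = 1" "(\<Sum>j<n. (tent j)\<^sup>2) \<ge> 1/2" "\<And>j. tent j * \<bar>u - y j\<bar> \<le> tent j * h"
    "\<And>j. tent j \<le> 1"
proof -
  define k where "k = nat \<lfloor>(u + 2) / h\<rfloor>"
  \<comment> \<open>the relative position of \<open>u\<close> in its grid interval\<close>
  define f where "f = (u + 2) / h - real k"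
  have q: "(u + 2) / h \<ge> 0" using h u by simp
  have f: "0 \<le> f" "f < 1"
    using q unfolding f_def k_def by linarith+
  have uk: "u = -2 + (real k + f) * h" using h unfolding f_def by (simp add: field_simps)
  have diff: "(u - y j) / h = real k + f - real j" for j
    using h by (simp add: y_def uk field_simps)
  have tent: "tent j = max 0 (1 - \<bar>real k + f - real j\<bar>)" for j
  proof -
    have "\<bar>u - y j\<bar> / h = \<bar>(u - y j) / h\<bar>" using h by simp
    then show ?thesis by (simp only: tent_def diff)
  qed
  have k1: "Suc k < n"
  proof -
    have "real k * h \<le> 4" 
    proof -
      have "0 \<le> f * h" using f h by simp
      then show ?thesis using uk u(2) by (simp add: distrib_right)
    qed
    moreover have "(real k + 2) * h \<le> 4 + 2 * h" using calculation by (simp add: distrib_right)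
    ultimately have "(real k + 2) * h \<le> real n * h" using n by linarith
    then have "real k + 2 \<le> real n" using h by simp
    then show ?thesis by linarith
  qed
  have z: "tent j = 0" if "j \<noteq> k" "j \<noteq> Suc k" for j
  proof -
    have "j < k \<or> j > Suc k" using that by linarith
    then have "\<bar>real k + f - real j\<bar> \<ge> 1" using f by linarith
    then show ?thesis by (simp add: tent)
  qed
  have tk: "tent k = 1 - f" "tent (Suc k) = f" using f by (simp_all add: tent)
  have S: "(\<Sum>j<n. g (tent j)) = g (1 - f) + g f" if "g 0 = 0" for g :: "real \<Rightarrow> real"
  proof -
    have "(\<Sum>j<n. g (tent j)) = (\<Sum>j\<in>{k, Suc k}. g (tent j))"
      using k1 z that by (intro sum.mono_neutral_right) auto
    then show ?thesis by (simp add: tk)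
  qed
  show "(\<Sum>j<n. tent j) = 1" using S[of "\<lambda>x. x"] by simp
  have "(1 - f)\<^sup>2 + f\<^sup>2 = 1/2 + 2 * (f - 1/2)\<^sup>2" by (simp add: power2_eq_square algebra_simps)
  then show "(\<Sum>j<n. (tent j)\<^sup>2) \<ge> 1/2" using S[of "\<lambda>x. x\<^sup>2"] by simp
  show "tent j \<le> 1" for j using h by (simp add: tent_def)
  show "tent j * \<bar>u - y j\<bar> \<le> tent j * h" for j
  proof (cases "\<bar>u - y j\<bar> \<le> h")
    case True
    then show ?thesis by (intro mult_left_mono) (auto simp: tent_def)
  next
    case False
    then have "tent j = 0" using h by (simp add: tent_def field_simps)
    then show ?thesis by simp
  qed
qed

text \<open>Three quarters of the tents, approximated by the Weierstrass theorem. The loss of a quarter leaves room for the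
  approximation errors. The three bounds say that a packet with these relative amplitudes is not larger than a single
  wave, that its speeds \<open>y j\<close> differ from \<open>u\<close> by at most \<open>\<epsilon>\<close> in the weighted mean, and that its energy has a lower bound
  that does not depend on \<open>\<epsilon>\<close>. The last point is what makes the gain of an iteration step uniform.\<close>

lemma localizing_polynomials:
  assumes "\<epsilon> > (0::real)"
  shows "\<exists>(n::nat) (y::nat \<Rightarrow> real) (\<tau>::nat \<Rightarrow> real \<Rightarrow> real). (\<forall>j. real_polynomial_function (\<tau> j)) \<and>
    (\<forall>u. \<bar>u\<bar> \<le> 2 \<longrightarrow> (\<Sum>j<n. \<bar>\<tau> j u\<bar>) \<le> 1 \<and> (\<Sum>j<n. \<bar>\<tau> j u\<bar> * \<bar>u - y j\<bar>) \<le> \<epsilon> \<and>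
      (\<Sum>j<n. (\<tau> j u)\<^sup>2) \<ge> 1/8)"
proof -
  define h where "h = min 1 (\<epsilon> / 2)"
  have h: "0 < h" "h \<le> 1" "h \<le> \<epsilon> / 2" using assms by (auto simp: h_def)
  obtain n :: nat where n: "real n * h \<ge> 4 + 2 * h"
    using reals_Archimedean3[OF h(1)] by (meson less_imp_le)
  have n0: "n > 0" using n h by (cases n) auto
  define y where "y j = -2 + real j * h" for j :: nat
  define tent where "tent j u = max 0 (1 - \<bar>u - y j\<bar> / h)" for j u
  define M where "M = 4 + real n * h"
  have M: "M > 0" using h by (simp add: M_def add_pos_nonneg)
  \<comment> \<open>\<open>n\<close> errors of size \<open>\<delta>\<close> must fit into the three bounds; \<open>M\<close> bounds the distances to the grid points\<close>
  define \<delta> where "\<delta> = min (1/16) (\<epsilon> / (2 * M)) / real n"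
  have \<delta>: "\<delta> > 0" "real n * \<delta> \<le> 1/16" "real n * \<delta> * M \<le> \<epsilon> / 2" "\<delta> \<le> 1/16"
  proof -
    show "\<delta> > 0" using n0 assms M by (simp add: \<delta>_def)
    have e: "real n * \<delta> = min (1/16) (\<epsilon> / (2 * M))" using n0 by (simp add: \<delta>_def)
    then show a: "real n * \<delta> \<le> 1/16" by simp
    have "real n * \<delta> \<le> \<epsilon> / (2 * M)" using e by simp
    then have "real n * \<delta> * M \<le> \<epsilon> / (2 * M) * M" using M by (intro mult_right_mono) auto
    then show "real n * \<delta> * M \<le> \<epsilon> / 2" using M by simp
    have "1 * \<delta> \<le> real n * \<delta>" using n0 \<open>\<delta> > 0\<close> by (intro mult_right_mono) auto
    then show "\<delta> \<le> 1/16" using a by simp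
  qed
  have "\<exists>g. real_polynomial_function g \<and> (\<forall>u\<in>{-2..2}. \<bar>3/4 * tent j u - g u\<bar> < \<delta>)" for j
  proof -
    have c: "continuous_on {-2..2} (\<lambda>u. 3/4 * tent j u)"
      unfolding tent_def by (intro continuous_intros) (use h in auto)
    obtain g where "real_polynomial_function g" "\<And>u. u \<in> {-2..2} \<Longrightarrow> \<bar>3/4 * tent j u - g u\<bar> < \<delta>"
      by (rule Stone_Weierstrass_real_polynomial_function[OF compact_Icc c \<delta>(1)]) blast
    then show ?thesis by blast
  qed
  then obtain \<tau> where \<tau>: "\<And>j. real_polynomial_function (\<tau> j)"
    "\<And>j u. u \<in> {-2..2} \<Longrightarrow> \<bar>3/4 * tent j u - \<tau> j u\<bar> < \<delta>" by metis
  show ?thesis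
  proof (intro exI[of _ n] exI[of _ y] exI[of _ \<tau>] conjI allI impI)
    show "real_polynomial_function (\<tau> j)" for j by (rule \<tau>)
    fix u :: real assume "\<bar>u\<bar> \<le> 2"
    then have u: "-2 \<le> u" "u \<le> 2" by auto
    note tp = tent_partition[OF h(1) u n, folded y_def, folded tent_def]
    have t0: "0 \<le> tent j u" for j by (simp add: tent_def)
    have ap: "\<bar>\<tau> j u\<bar> \<le> 3/4 * tent j u + \<delta>" for j
      using \<tau>(2)[of u j] u t0[of j] by (auto simp: abs_le_iff)
    have "(\<Sum>j<n. \<bar>\<tau> j u\<bar>) \<le> (\<Sum>j<n. 3/4 * tent j u + \<delta>)" by (intro sum_mono ap)
    also have "\<dots> = 3/4 * (\<Sum>j<n. tent j u) + real n * \<delta>"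
      by (simp add: sum.distrib sum_distrib_left)
    finally show "(\<Sum>j<n. \<bar>\<tau> j u\<bar>) \<le> 1" using \<delta> tp(1) by simp
    have yM: "\<bar>u - y j\<bar> \<le> M" if "j < n" for j
    proof -
      have "0 \<le> real j * h" "real j * h \<le> real n * h" using that h by auto
      then show ?thesis using u unfolding y_def M_def by linarith
    qed
    have "(\<Sum>j<n. \<bar>\<tau> j u\<bar> * \<bar>u - y j\<bar>) \<le> (\<Sum>j<n. 3/4 * (tent j u * h) + \<delta> * M)"
    proof (rule sum_mono)
      fix j assume "j \<in> {..<n}"
      then have j: "j < n" by simp
      have "\<bar>\<tau> j u\<bar> * \<bar>u - y j\<bar> \<le> (3/4 * tent j u + \<delta>) * \<bar>u - y j\<bar>"
        by (intro mult_right_mono ap) auto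
      also have "\<dots> = 3/4 * (tent j u * \<bar>u - y j\<bar>) + \<delta> * \<bar>u - y j\<bar>" by (simp add: algebra_simps)
      also have "\<dots> \<le> 3/4 * (tent j u * h) + \<delta> * M"
        using tp(3)[of j] mult_left_mono[OF yM[OF j], of \<delta>] \<delta>(1) by linarith
      finally show "\<bar>\<tau> j u\<bar> * \<bar>u - y j\<bar> \<le> 3/4 * (tent j u * h) + \<delta> * M" .
    qed
    also have "\<dots> = 3/4 * (h * (\<Sum>j<n. tent j u)) + real n * \<delta> * M"
      by (simp add: sum.distrib sum_distrib_left algebra_simps)
    finally show "(\<Sum>j<n. \<bar>\<tau> j u\<bar> * \<bar>u - y j\<bar>) \<le> \<epsilon>" using tp(1) \<delta> h by simp
    have "(\<tau> j u)\<^sup>2 \<ge> 9/16 * (tent j u)\<^sup>2 - 3/2 * tent j u * \<delta>" for j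
    proof -
      define d where "d = \<tau> j u - 3/4 * tent j u"
      have d: "\<bar>d\<bar> \<le> \<delta>" using \<tau>(2)[of u j] u by (auto simp: d_def)
      have "(\<tau> j u)\<^sup>2 = 9/16 * (tent j u)\<^sup>2 + 3/2 * tent j u * d + d\<^sup>2"
        unfolding d_def by (simp add: power2_eq_square algebra_simps)
      moreover have "3/2 * tent j u * (-\<delta>) \<le> 3/2 * tent j u * d"
        using t0[of j] d by (intro mult_left_mono) auto
      moreover have "d\<^sup>2 \<ge> 0" by simp
      ultimately show ?thesis by linarith
    qed
    then have "(\<Sum>j<n. (\<tau> j u)\<^sup>2) \<ge> (\<Sum>j<n. 9/16 * (tent j u)\<^sup>2 - 3/2 * tent j u * \<delta>)"
      by (intro sum_mono) auto
    also have "(\<Sum>j<n. 9/16 * (tent j u)\<^sup>2 - 3/2 * tent j u * \<delta>)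
       = 9/16 * (\<Sum>j<n. (tent j u)\<^sup>2) - 3/2 * \<delta> * (\<Sum>j<n. tent j u)"
      by (simp add: sum_subtractf sum_distrib_left sum_divide_distrib mult_ac)
    finally show "(\<Sum>j<n. (\<tau> j u)\<^sup>2) \<ge> 1/8" using tp(1,2) \<delta>(4) by simp
  qed
qed

section \<open>Sequences of functions vanishing uniformly\<close>

definition vanishing :: "'a set \<Rightarrow> (nat \<Rightarrow> 'a \<Rightarrow> real) \<Rightarrow> bool" where
  "vanishing Q F \<longleftrightarrow> (\<forall>e>0. \<forall>\<^sub>F N in sequentially. \<forall>z\<in>Q. \<bar>F N z\<bar> \<le> e)"

definition unif_bounded :: "'a set \<Rightarrow> (nat \<Rightarrow> 'a \<Rightarrow> real) \<Rightarrow> bool" where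
  "unif_bounded Q F \<longleftrightarrow> (\<exists>B>0. \<forall>N. \<forall>z\<in>Q. \<bar>F N z\<bar> \<le> B)"

lemma unif_boundedI: "(\<And>N z. z \<in> Q \<Longrightarrow> \<bar>F N z\<bar> \<le> B) \<Longrightarrow> unif_bounded Q F"
  unfolding unif_bounded_def by (intro exI[of _ "max B 1"]) (simp add: le_max_iff_disj)

lemma unif_bounded_add: "unif_bounded Q F \<Longrightarrow> unif_bounded Q G \<Longrightarrow> unif_bounded Q (\<lambda>N z. F N z + G N z)"
  unfolding unif_bounded_def by (meson abs_triangle_ineq add_mono add_pos_pos order_trans)

lemma unif_bounded_mult: "unif_bounded Q F \<Longrightarrow> unif_bounded Q G \<Longrightarrow> unif_bounded Q (\<lambda>N z. F N z * G N z)"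
proof -
  assume "unif_bounded Q F" "unif_bounded Q G"
  then obtain A B where A: "A > 0" "\<And>N z. z \<in> Q \<Longrightarrow> \<bar>F N z\<bar> \<le> A"
    and B: "B > 0" "\<And>N z. z \<in> Q \<Longrightarrow> \<bar>G N z\<bar> \<le> B" unfolding unif_bounded_def by blast
  show ?thesis
    by (rule unif_boundedI[where B="A * B"]) (auto simp: abs_mult intro!: mult_mono A B less_imp_le[OF A(1)])
qed

lemma unif_bounded_const: "unif_bounded Q (\<lambda>N z. c)"
  by (rule unif_boundedI[where B="\<bar>c\<bar>"]) auto

lemma unif_bounded_minus: "unif_bounded Q F \<Longrightarrow> unif_bounded Q (\<lambda>N z. - F N z)"
  using unif_bounded_mult[OF unif_bounded_const[of Q "-1"], of F] by simp

lemma unif_bounded_diff: "unif_bounded Q F \<Longrightarrow> unif_bounded Q G \<Longrightarrow> unif_bounded Q (\<lambda>N z. F N z - G N z)"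
  using unif_bounded_add[OF _ unif_bounded_minus, of Q F G] by simp

lemma unif_bounded_sum: "(\<And>i. i \<in> I \<Longrightarrow> unif_bounded Q (F i)) \<Longrightarrow> unif_bounded Q (\<lambda>N z. \<Sum>i\<in>I. F i N z)"
  by (induction I rule: infinite_finite_induct) (auto intro: unif_bounded_add unif_bounded_const)

lemma vanishing_add: 
  assumes "vanishing Q F" "vanishing Q G" shows "vanishing Q (\<lambda>N z. F N z + G N z)"
  unfolding vanishing_def
proof (intro allI impI)
  fix e :: real assume "e > 0"
  then have "\<forall>\<^sub>F N in sequentially. \<forall>z\<in>Q. \<bar>F N z\<bar> \<le> e / 2" "\<forall>\<^sub>F N in sequentially. \<forall>z\<in>Q. \<bar>G N z\<bar> \<le> e / 2"
    using assms unfolding vanishing_def by (meson half_gt_zero)+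
  then show "\<forall>\<^sub>F N in sequentially. \<forall>z\<in>Q. \<bar>F N z + G N z\<bar> \<le> e"
    by eventually_elim (smt (verit) field_sum_of_halves)
qed

lemma vanishing_mult: 
  assumes "vanishing Q F" "unif_bounded Q G" shows "vanishing Q (\<lambda>N z. F N z * G N z)"
  unfolding vanishing_def
proof (intro allI impI)
  fix e :: real assume e: "e > 0"
  obtain B where B: "B > 0" "\<And>N z. z \<in> Q \<Longrightarrow> \<bar>G N z\<bar> \<le> B" using assms(2) unfolding unif_bounded_def by blast
  have "\<forall>\<^sub>F N in sequentially. \<forall>z\<in>Q. \<bar>F N z\<bar> \<le> e / B"
    using assms(1) e B unfolding vanishing_def by simp
  then show "\<forall>\<^sub>F N in sequentially. \<forall>z\<in>Q. \<bar>F N z * G N z\<bar> \<le> e"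
  proof eventually_elim
    case (elim N)
    have "\<bar>F N z * G N z\<bar> \<le> e / B * B" if "z \<in> Q" for z
      unfolding abs_mult using elim that B e by (intro mult_mono) auto
    then show ?case using B(1) by simp
  qed
qed

lemma vanishing_minus: "vanishing Q F \<Longrightarrow> vanishing Q (\<lambda>N z. - F N z)"
  by (simp add: vanishing_def)

lemma vanishing_diff: "vanishing Q F \<Longrightarrow> vanishing Q G \<Longrightarrow> vanishing Q (\<lambda>N z. F N z - G N z)"
  using vanishing_add[OF _ vanishing_minus, of Q F G] by simp

lemma vanishing_zero: "vanishing Q (\<lambda>N z. 0)" by (simp add: vanishing_def)

lemma vanishing_sum: "(\<And>i. i \<in> I \<Longrightarrow> vanishing Q (F i)) \<Longrightarrow> vanishing Q (\<lambda>N z. \<Sum>i\<in>I. F i N z)"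
  by (induction I rule: infinite_finite_induct) (auto intro: vanishing_add vanishing_zero)

lemma vanishing_scale: "vanishing Q F \<Longrightarrow> vanishing Q (\<lambda>N z. c * F N z)"
  using vanishing_mult[OF _ unif_bounded_const, of Q F c] by (simp add: mult.commute)

lemma vanishing_decay:
  assumes "unif_bounded Q G" shows "vanishing Q (\<lambda>N z. G N z / real (Suc N))"
proof -
  have "vanishing Q (\<lambda>N z. 1 / real (Suc N))"
    unfolding vanishing_def
  proof (intro allI impI)
    fix e :: real assume "e > 0"
    then have "\<forall>\<^sub>F N in sequentially. 1 / real (Suc N) < e"
      using order_tendstoD(2)[OF LIMSEQ_inverse_real_of_nat, of e] by (simp add: inverse_eq_divide)
    then show "\<forall>\<^sub>F N in sequentially. \<forall>z\<in>Q. \<bar>1 / real (Suc N)\<bar> \<le> e"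
      by eventually_elim auto
  qed
  from vanishing_mult[OF this assms] show ?thesis by simp
qed

lemma unif_bounded_continuous:
  assumes "compact Q" "continuous_on Q f" shows "unif_bounded Q (\<lambda>N z. f z)"
proof -
  obtain B where "\<And>z. z \<in> Q \<Longrightarrow> norm (f z) \<le> B"
    using compact_imp_bounded[OF compact_continuous_image[OF assms(2,1)]] 
    unfolding bounded_iff by auto
  then show ?thesis by (intro unif_boundedI[where B=B]) auto
qed

section \<open>Plane waves\<close>

definition ell :: "int \<Rightarrow> real \<Rightarrow> real spacetime_fun" where
  "ell \<kappa> w z = fst z $ 1 + of_int \<kappa> * fst z $ 2 + w * snd z"

definition wcos :: "nat \<Rightarrow> int \<Rightarrow> real \<Rightarrow> real spacetime_fun" where
  "wcos n \<kappa> w = (\<lambda>z. cos (2 * pi * n * ell \<kappa> w z))"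

definition wsin :: "nat \<Rightarrow> int \<Rightarrow> real \<Rightarrow> real spacetime_fun" where
  "wsin n \<kappa> w = (\<lambda>z. sin (2 * pi * n * ell \<kappa> w z))"

lemma phase_ell: "2 * pi * n * ell \<kappa> w z = phase (int n) (int n * \<kappa>) (2 * pi * n * w) z"
  by (simp add: ell_def phase_def algebra_simps)

lemma wcos_phase: "wcos n \<kappa> w = (\<lambda>z. cos (phase (int n) (int n * \<kappa>) (2 * pi * n * w) z))"
  and wsin_phase: "wsin n \<kappa> w = (\<lambda>z. sin (phase (int n) (int n * \<kappa>) (2 * pi * n * w) z))"
  by (simp_all add: wcos_def wsin_def phase_ell)

lemma wcos_trig: "wcos n \<kappa> w \<in> trig" and wsin_trig: "wsin n \<kappa> w \<in> trig"
  unfolding wcos_phase wsin_phase by (rule trig.intros)+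

lemma pd_wcos: "pd b (wcos n \<kappa> w) = (\<lambda>z. - (2 * pi * n * ell \<kappa> w b) * wsin n \<kappa> w z)"
  unfolding wcos_phase wsin_phase pd_cos phase_ell by simp

lemma pd_wsin: "pd b (wsin n \<kappa> w) = (\<lambda>z. 2 * pi * n * ell \<kappa> w b * wcos n \<kappa> w z)"
  unfolding wcos_phase wsin_phase pd_sin phase_ell by simp

lemma wcos_le: "\<bar>wcos n \<kappa> w z\<bar> \<le> 1" and wsin_le: "\<bar>wsin n \<kappa> w z\<bar> \<le> 1"
  by (simp_all add: wcos_def wsin_def)

lemma wcos_unif_bounded: "unif_bounded Q (\<lambda>N. wcos (f N) \<kappa> w)" and wsin_unif_bounded: "unif_bounded Q (\<lambda>N. wsin (f N) \<kappa> w)"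
  by (rule unif_boundedI[OF wcos_le], rule unif_boundedI[OF wsin_le])

abbreviation (input) cell :: "real \<Rightarrow> ((real^2) \<times> real) set" where
  "cell T \<equiv> cbox 0 1 \<times> {0..T}"

lemma cell_compact: "compact (cell T)"
  by (simp add: compact_Times)

lemma trig_continuous: "f \<in> trig \<Longrightarrow> continuous_on S f"
  using continuous_on_subset[OF C1_continuous[OF trig_C1]] by blast

lemma trig_unif_bounded: "f \<in> trig \<Longrightarrow> unif_bounded (cell T) (\<lambda>N z. f z)"
  by (rule unif_bounded_continuous[OF cell_compact trig_continuous])

lemma trig_integrable: "f \<in> trig \<Longrightarrow> integrable (spacetime_measure {0..T}) f"
  by (rule cont_integrable[OF trig_continuous])

lemma wave_first_derivative:
  assumes a: "a \<in> trig"
  shows "pd b (\<lambda>z. c * (a z * wcos n \<kappa> w z)) =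
    (\<lambda>z. c * (pd b a z * wcos n \<kappa> w z) - c * (2 * pi * n) * ell \<kappa> w b * (a z * wsin n \<kappa> w z))"
    "pd b (\<lambda>z. c * (a z * wsin n \<kappa> w z)) =
    (\<lambda>z. c * (pd b a z * wsin n \<kappa> w z) + c * (2 * pi * n) * ell \<kappa> w b * (a z * wcos n \<kappa> w z))"
  by (simp_all add: pd_scale pd_mult C1_mult trig_C1[OF a] trig_C1[OF wcos_trig] trig_C1[OF wsin_trig] pd_wcos pd_wsin
      fun_eq_iff algebra_simps)

lemma wave_second_derivative:
  assumes a: "a \<in> trig"
  shows "pd d (pd b (\<lambda>z. c * (a z * wcos n \<kappa> w z))) =
    (\<lambda>z. - c * (2 * pi * n)\<^sup>2 * ell \<kappa> w b * ell \<kappa> w d * (a z * wcos n \<kappa> w z)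
      - c * (2 * pi * n) * ((ell \<kappa> w d * pd b a z + ell \<kappa> w b * pd d a z) * wsin n \<kappa> w z)
      + c * (pd d (pd b a) z * wcos n \<kappa> w z))"
proof -
  have t: "(\<lambda>z. c * (pd b a z * wcos n \<kappa> w z)) \<in> trig" "(\<lambda>z. a z * wsin n \<kappa> w z) \<in> trig"
    "(\<lambda>z. - c * (2 * pi * n) * ell \<kappa> w b * (a z * wsin n \<kappa> w z)) \<in> trig"
    by (intro trig_mult trig_const trig_pd a wcos_trig wsin_trig)+
  have "pd d (\<lambda>z. c * (pd b a z * wcos n \<kappa> w z) + (- c * (2 * pi * n) * ell \<kappa> w b) * (a z * wsin n \<kappa> w z))
    = (\<lambda>z. (c * (pd d (pd b a) z * wcos n \<kappa> w z) - c * (2 * pi * n) * ell \<kappa> w d * (pd b a z * wsin n \<kappa> w z)) +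
       ((- c * (2 * pi * n) * ell \<kappa> w b) * (pd d a z * wsin n \<kappa> w z) + (- c * (2 * pi * n) * ell \<kappa> w b) * (2 * pi * n) * ell \<kappa> w d * (a z * wcos n \<kappa> w z)))"
    unfolding pd_add[OF trig_C1[OF t(1)] trig_C1[OF t(3)]] wave_first_derivative(1)[OF trig_pd[OF a]]
      wave_first_derivative(2)[OF a] ..
  then show ?thesis
    unfolding wave_first_derivative(1)[OF a] by (simp add: fun_eq_iff power2_eq_square algebra_simps)
qed

text \<open>With the factor \<open>1 / (2 \<lambda>\<^sup>2)\<close>, where \<open>\<lambda>\<close> is the frequency, second derivatives of a modulated wave are of order 1 when both
  derivatives fall on the cosine, and all other terms carry a factor \<open>1 / \<lambda>\<close>. The factor 2 is the squared length of
  the wave vector \<open>(1, \<kappa>)\<close>, so that minus the Laplacian gives back exactly the modulated wave.\<close>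

lemma wave_second_derivative_limit:
  assumes a: "a \<in> trig"
  shows "vanishing (cell T) (\<lambda>N z. pd d (pd b (\<lambda>z. 1 / (2 * (2 * pi * real (Suc k * Suc N))\<^sup>2) * (a z * wcos (Suc k * Suc N) \<kappa> w z))) z
     + 1/2 * ell \<kappa> w b * ell \<kappa> w d * (a z * wcos (Suc k * Suc N) \<kappa> w z))"
proof -
  define G where "G N z = - 1 / (4 * pi * real (Suc k)) * ((ell \<kappa> w d * pd b a z + ell \<kappa> w b * pd d a z) * wsin (Suc k * Suc N) \<kappa> w z)
      + 1 / (8 * pi\<^sup>2 * (real (Suc k))\<^sup>2) * (1 / real (Suc N)) * (pd d (pd b a) z * wcos (Suc k * Suc N) \<kappa> w z)" for N z
  have "unif_bounded (cell T) (\<lambda>N z. 1 / real (Suc N))"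
    by (rule unif_boundedI[where B=1]) auto
  then have "unif_bounded (cell T) G"
    unfolding G_def by (intro unif_bounded_add unif_bounded_mult unif_bounded_const trig_unif_bounded trig_pd a wcos_unif_bounded wsin_unif_bounded)
  then have "vanishing (cell T) (\<lambda>N z. G N z / real (Suc N))" by (rule vanishing_decay)
  moreover have "pd d (pd b (\<lambda>z. 1 / (2 * (2 * pi * real (Suc k * Suc N))\<^sup>2) * (a z * wcos (Suc k * Suc N) \<kappa> w z))) z
     + 1/2 * ell \<kappa> w b * ell \<kappa> w d * (a z * wcos (Suc k * Suc N) \<kappa> w z) = G N z / real (Suc N)" for N z
  proof -
    define K M :: real where "K = real (Suc k)" and "M = real (Suc N)"
    have "K > 0" "M > 0" by (auto simp: K_def M_def)
    then show ?thesis
      unfolding wave_second_derivative[OF a] G_def of_nat_mult K_def[symmetric] M_def[symmetric]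
      by (simp add: field_simps power2_eq_square)
  qed
  ultimately show ?thesis by simp
qed

lemma wave_first_derivative_limit:
  assumes a: "a \<in> trig"
  shows "vanishing (cell T) (\<lambda>N z. pd b (\<lambda>z. 1 / (2 * (2 * pi * real (Suc k * Suc N))\<^sup>2) * (a z * wcos (Suc k * Suc N) \<kappa> w z)) z)"
    "vanishing (cell T) (\<lambda>N z. pd b (\<lambda>z. 1 / (2 * pi * real (Suc k * Suc N)) * (a z * wsin (Suc k * Suc N) \<kappa> w z)) z
      - ell \<kappa> w b * (a z * wcos (Suc k * Suc N) \<kappa> w z))"
proof -
  have s: "unif_bounded (cell T) (\<lambda>N z. 1 / real (Suc N))"
    by (rule unif_boundedI[where B=1]) auto
  define G where "G N z = 1 / (8 * pi\<^sup>2 * (real (Suc k))\<^sup>2) * (1 / real (Suc N)) * (pd b a z * wcos (Suc k * Suc N) \<kappa> w z)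
      - 1 / (4 * pi * real (Suc k)) * ell \<kappa> w b * (a z * wsin (Suc k * Suc N) \<kappa> w z)" for N z
  have "unif_bounded (cell T) G"
    unfolding G_def by (intro unif_bounded_diff unif_bounded_mult unif_bounded_const trig_unif_bounded trig_pd a wcos_unif_bounded wsin_unif_bounded s)
  then have "vanishing (cell T) (\<lambda>N z. G N z / real (Suc N))" by (rule vanishing_decay)
  moreover have "pd b (\<lambda>z. 1 / (2 * (2 * pi * real (Suc k * Suc N))\<^sup>2) * (a z * wcos (Suc k * Suc N) \<kappa> w z)) z = G N z / real (Suc N)" for N z
  proof -
    define K M :: real where "K = real (Suc k)" and "M = real (Suc N)"
    have "K > 0" "M > 0" by (auto simp: K_def M_def)
    then show ?thesis
      unfolding wave_first_derivative[OF a] G_def of_nat_mult K_def[symmetric] M_def[symmetric]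
      by (simp add: field_simps power2_eq_square)
  qed
  ultimately show "vanishing (cell T) (\<lambda>N z. pd b (\<lambda>z. 1 / (2 * (2 * pi * real (Suc k * Suc N))\<^sup>2) * (a z * wcos (Suc k * Suc N) \<kappa> w z)) z)"
    by simp
  define H where "H N z = 1 / (2 * pi * real (Suc k)) * (pd b a z * wsin (Suc k * Suc N) \<kappa> w z)" for N z
  have "unif_bounded (cell T) H"
    unfolding H_def by (intro unif_bounded_mult unif_bounded_const trig_unif_bounded trig_pd a wcos_unif_bounded wsin_unif_bounded)
  then have "vanishing (cell T) (\<lambda>N z. H N z / real (Suc N))" by (rule vanishing_decay)
  moreover have "pd b (\<lambda>z. 1 / (2 * pi * real (Suc k * Suc N)) * (a z * wsin (Suc k * Suc N) \<kappa> w z)) z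
      - ell \<kappa> w b * (a z * wcos (Suc k * Suc N) \<kappa> w z) = H N z / real (Suc N)" for N z
  proof -
    define K M :: real where "K = real (Suc k)" and "M = real (Suc N)"
    have "K > 0" "M > 0" by (auto simp: K_def M_def)
    then show ?thesis
      unfolding wave_first_derivative[OF a] H_def of_nat_mult K_def[symmetric] M_def[symmetric]
      by (simp add: field_simps power2_eq_square)
  qed
  ultimately show "vanishing (cell T) (\<lambda>N z. pd b (\<lambda>z. 1 / (2 * pi * real (Suc k * Suc N)) * (a z * wsin (Suc k * Suc N) \<kappa> w z)) z
      - ell \<kappa> w b * (a z * wcos (Suc k * Suc N) \<kappa> w z))"
    by simp
qed

lemma measure_finite: "finite_measure (spacetime_measure {a..T})"
  by (rule finite_measure_lebesgue_on) (simp add: cell_cbox)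

lemma vanishing_integral:
  assumes "vanishing (cell T) F"
  shows "(\<lambda>N. \<integral>z. F N z \<partial>spacetime_measure {0..T}) \<longlonglongrightarrow> 0"
proof -
  define V where "V = measure (spacetime_measure {0..T}) (space (spacetime_measure {0..T}))"
  have V: "V \<ge> 0" by (simp add: V_def)
  show ?thesis
  proof (rule LIMSEQ_I)
    fix r :: real assume r: "r > 0"
    have "\<forall>\<^sub>F N in sequentially. \<forall>z\<in>cell T. \<bar>F N z\<bar> \<le> r / (2 * (V + 1))"
      using assms r V unfolding vanishing_def by simp
    then have "\<forall>\<^sub>F N in sequentially. norm ((\<integral>z. F N z \<partial>spacetime_measure {0..T}) - 0) < r"
    proof eventually_elim
      case (elim N)
      have "\<bar>\<integral>z. F N z \<partial>spacetime_measure {0..T}\<bar> \<le> r / (2 * (V + 1)) * V"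
      proof (cases "integrable (spacetime_measure {0..T}) (F N)")
        case True
        have "norm (\<integral>z. F N z \<partial>spacetime_measure {0..T}) \<le> (\<integral>z. norm (F N z) \<partial>spacetime_measure {0..T})"
          by (rule integral_norm_bound)
        also have "\<dots> \<le> (\<integral>z. r / (2 * (V + 1)) \<partial>spacetime_measure {0..T})"
          using True elim finite_measure.integrable_const[OF measure_finite]
          by (intro integral_mono) (auto simp: space_restrict_space)
        also have "\<dots> = r / (2 * (V + 1)) * V"
          by (simp add: V_def)
        finally show ?thesis by simp
      next
        case False
        then show ?thesis using r V by (simp add: not_integrable_integral_eq)
      qed
      also have "\<dots> < r" using r V by (simp add: field_simps add_nonneg_pos)
      finally show ?case by simp
    qed
    then show "\<exists>no. \<forall>N\<ge>no. norm ((\<integral>z. F N z \<partial>spacetime_measure {0..T}) - 0) < r"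
      by (simp add: eventually_sequentially)
  qed
qed

lemma ell_e1: "ell \<kappa> w (axis 1 1, 0) = 1" and ell_e2: "ell \<kappa> w (axis 2 1, 0) = of_int \<kappa>"
  and ell_et: "ell \<kappa> w (0, 1) = w"
  by (simp_all add: ell_def axis_def)

text \<open>Up to a uniformly vanishing term the oscillating function is an \<open>x\<^sub>1\<close>-derivative, and such derivatives have mean 0.\<close>

lemma riemann_lebesgue:
  assumes f: "f \<in> trig"
  shows "(\<lambda>N. \<integral>z. f z * wcos (Suc k * Suc N) \<kappa> w z \<partial>spacetime_measure {0..T}) \<longlonglongrightarrow> 0"
proof -
  let ?D = "\<lambda>N. pd (axis 1 1, 0) (\<lambda>z. 1 / (2 * pi * real (Suc k * Suc N)) * (f z * wsin (Suc k * Suc N) \<kappa> w z))"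
  have t: "(\<lambda>z. 1 / (2 * pi * real (Suc k * Suc N)) * (f z * wsin (Suc k * Suc N) \<kappa> w z)) \<in> trig" for N
    by (intro trig_mult trig_const f wsin_trig)
  have "(\<lambda>N. \<integral>z. ?D N z - 1 * (f z * wcos (Suc k * Suc N) \<kappa> w z) \<partial>spacetime_measure {0..T}) \<longlonglongrightarrow> 0"
    using vanishing_integral[OF wave_first_derivative_limit(2)[OF f, of T "(axis 1 1,0)" k \<kappa> w]]
    by (simp only: ell_e1)
  moreover have "(\<integral>z. ?D N z - 1 * (f z * wcos (Suc k * Suc N) \<kappa> w z) \<partial>spacetime_measure {0..T})
    = - (\<integral>z. f z * wcos (Suc k * Suc N) \<kappa> w z \<partial>spacetime_measure {0..T})" for N
  proof -
    have i: "integrable (spacetime_measure {0..T}) (?D N)"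
      "integrable (spacetime_measure {0..T}) (\<lambda>z. f z * wcos (Suc k * Suc N) \<kappa> w z)"
      by (intro trig_integrable trig_pd t trig_mult f wcos_trig)+
    show ?thesis
      using integral_pd_space[OF trig_C1[OF t[of N]] trig_periodic[OF t[of N]], where i=1 and T=T] 
        Bochner_Integration.integral_diff[OF i] by simp
  qed
  ultimately have "(\<lambda>N. - (\<integral>z. f z * wcos (Suc k * Suc N) \<kappa> w z \<partial>spacetime_measure {0..T})) \<longlonglongrightarrow> 0"
    by (simp only:)
  then show ?thesis using tendsto_minus by fastforce
qed

text \<open>The waves of a packet have the distinct frequencies \<open>(j + 1) M\<close> and are therefore orthogonal in the limit:
  a product of two of them is a combination of waves whose frequencies are again positive multiples of \<open>M\<close>. Only the speeds change.\<close>

lemma wcos_mult: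
  assumes "i > j"
  shows "wcos (Suc i * M) \<kappa> v z * wcos (Suc j * M) \<kappa> w z =
   1/2 * wcos (Suc (i - j - 1) * M) \<kappa> ((real (Suc i) * v - real (Suc j) * w) / (real i - real j)) z
   + 1/2 * wcos (Suc (Suc (i + j)) * M) \<kappa> ((real (Suc i) * v + real (Suc j) * w) / (real i + real j + 2)) z"
proof -
  have d: "real (Suc (i - j - 1)) = real i - real j" "real (Suc (Suc (i + j))) = real i + real j + 2"
    using assms by auto
  have nz: "real i - real j \<noteq> 0" "real i + real j + 2 \<noteq> 0" using assms by auto
  have 1: "2 * pi * real (Suc (i - j - 1) * M) * ell \<kappa> ((real (Suc i) * v - real (Suc j) * w) / (real i - real j)) z
    = 2 * pi * real (Suc i * M) * ell \<kappa> v z - 2 * pi * real (Suc j * M) * ell \<kappa> w z"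
    unfolding of_nat_mult d ell_def using nz(1) by (simp add: field_simps)
  have 2: "2 * pi * real (Suc (Suc (i + j)) * M) * ell \<kappa> ((real (Suc i) * v + real (Suc j) * w) / (real i + real j + 2)) z
    = 2 * pi * real (Suc i * M) * ell \<kappa> v z + 2 * pi * real (Suc j * M) * ell \<kappa> w z"
    unfolding of_nat_mult d ell_def using nz(2) by (simp add: field_simps)
  show ?thesis unfolding wcos_def 1 2 by (simp add: cos_times_cos)
qed

lemma wcos_square: "wcos (Suc i * M) \<kappa> v z * wcos (Suc i * M) \<kappa> v z = 1/2 + 1/2 * wcos (Suc (Suc (i + i)) * M) \<kappa> v z"
proof -
  have "2 * pi * real (Suc (Suc (i + i)) * M) * ell \<kappa> v z = 2 * (2 * pi * real (Suc i * M) * ell \<kappa> v z)"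
    by (simp add: algebra_simps)
  moreover have "cos x * cos x = 1/2 + 1/2 * cos (2 * x)" for x :: real
    using cos_double_cos[of x] unfolding power2_eq_square by linarith
  ultimately show ?thesis unfolding wcos_def by (simp only:)
qed

lemma vanishing_cong: "vanishing Q F \<Longrightarrow> (\<And>N z. F N z = G N z) \<Longrightarrow> vanishing Q G"
  unfolding vanishing_def by simp

lemma unif_bounded_vanishing_mult: "unif_bounded Q F \<Longrightarrow> vanishing Q G \<Longrightarrow> vanishing Q (\<lambda>N z. F N z * G N z)"
  using vanishing_mult[of Q G F] by (simp add: mult.commute)

lemma vanishing_mult_nul:
  assumes "vanishing Q F" "vanishing Q G" shows "vanishing Q (\<lambda>N z. F N z * G N z)"
  unfolding vanishing_def
proof (intro allI impI)
  fix e :: real assume e: "e > 0"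
  have "\<forall>\<^sub>F N in sequentially. \<forall>z\<in>Q. \<bar>F N z\<bar> \<le> e" "\<forall>\<^sub>F N in sequentially. \<forall>z\<in>Q. \<bar>G N z\<bar> \<le> 1"
    using assms e unfolding vanishing_def by simp_all
  then show "\<forall>\<^sub>F N in sequentially. \<forall>z\<in>Q. \<bar>F N z * G N z\<bar> \<le> e"
  proof eventually_elim
    case (elim N)
    have "\<bar>F N z * G N z\<bar> \<le> e * 1" if "z \<in> Q" for z
      unfolding abs_mult using elim that e by (intro mult_mono) auto
    then show ?case by simp
  qed
qed

lemma vanishing_product:
  assumes F: "vanishing Q (\<lambda>N z. F N z - F0 N z)" and G: "vanishing Q (\<lambda>N z. G N z - G0 N z)" 
    and b: "unif_bounded Q F0" "unif_bounded Q G0"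
  shows "vanishing Q (\<lambda>N z. F N z * G N z - F0 N z * G0 N z)"
  by (rule vanishing_cong[OF vanishing_add[OF vanishing_add[OF vanishing_mult_nul[OF F G] vanishing_mult[OF F b(2)]] unif_bounded_vanishing_mult[OF b(1) G]]])
     (simp add: algebra_simps)

lemma continuous_pos_lower_bound:
  assumes "compact S" "continuous_on S f" "\<And>z. z \<in> S \<Longrightarrow> f z > (0::real)"
  shows "\<exists>\<delta>>0. \<forall>z\<in>S. f z \<ge> \<delta>"
proof (cases "S = {}")
  case False
  then obtain x where "x \<in> S" "\<And>y. y \<in> S \<Longrightarrow> f x \<le> f y"
    using continuous_attains_inf[OF assms(1) _ assms(2)] by blast
  then show ?thesis using assms(3) by blast
qed (auto intro: exI[of _ 1])

section \<open>Subsolutions\<close>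

text \<open>The state in the coordinates of the introduction: \<open>rho\<close> is the density, \<open>sig \<kappa>\<close> is \<open>\<kappa> v\<^sub>1 - v\<^sub>2\<close> and \<open>mu b \<kappa>\<close> is
  \<open>\<kappa> m\<^sub>1 - m\<^sub>2\<close>, expressed by the potentials.\<close>

abbreviation e1 :: "(real^2) \<times> real" where "e1 \<equiv> (axis 1 1, 0)"
abbreviation e2 :: "(real^2) \<times> real" where "e2 \<equiv> (axis 2 1, 0)"
abbreviation et :: "(real^2) \<times> real" where "et \<equiv> (0, 1)"

definition rho :: "real spacetime_fun \<Rightarrow> real spacetime_fun" where
  "rho \<Phi> = (\<lambda>z. - pd e1 (pd e1 \<Phi>) z - pd e2 (pd e2 \<Phi>) z)"

definition sig :: "int \<Rightarrow> real spacetime_fun \<Rightarrow> real spacetime_fun" where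
  "sig \<kappa> \<Phi> = (\<lambda>z. - pd e1 (pd e1 \<Phi>) z - of_int \<kappa> * pd e1 (pd e2 \<Phi>) z)"

definition mu :: "real \<Rightarrow> int \<Rightarrow> real spacetime_fun \<Rightarrow> real spacetime_fun \<Rightarrow> real spacetime_fun" where
  "mu b \<kappa> \<Phi> \<Theta> = (\<lambda>z. b + of_int \<kappa> * pd e1 (pd et \<Phi>) z - pd e2 (pd et \<Phi>) z
     - pd e1 \<Theta> z - of_int \<kappa> * pd e2 \<Theta> z)"

definition defect :: "real \<Rightarrow> int \<Rightarrow> real spacetime_fun \<Rightarrow> real spacetime_fun \<Rightarrow> real spacetime_fun" where
  "defect b \<kappa> \<Phi> \<Theta> = (\<lambda>z. mu b \<kappa> \<Phi> \<Theta> z - rho \<Phi> z * sig \<kappa> \<Phi> z)"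

text \<open>The last inequality bounds the density. A wave of type \<open>\<kappa>\<close> adds the same amount to \<open>rho\<close> and to \<open>sig \<kappa>\<close>, so
  the difference in it changes only by error terms.\<close>

definition subsolution :: "real \<Rightarrow> real \<Rightarrow> real spacetime_fun \<Rightarrow> real spacetime_fun \<Rightarrow> bool" where
  "subsolution T b \<Phi> \<Theta> \<longleftrightarrow> \<Phi> \<in> trig \<and> \<Theta> \<in> trig \<and> (\<forall>x. \<Phi> (x, 0) = 0) \<and>
     (\<forall>z\<in>cell T. (\<forall>\<kappa>\<in>{1, -1}. defect b \<kappa> \<Phi> \<Theta> z > 0 \<and> (sig \<kappa> \<Phi> z)\<^sup>2 + defect b \<kappa> \<Phi> \<Theta> z < 2) \<and>
       \<bar>rho \<Phi> z - sig 1 \<Phi> z - sig (-1) \<Phi> z\<bar> < 1)"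

definition energy :: "real \<Rightarrow> real \<Rightarrow> real spacetime_fun \<Rightarrow> real spacetime_fun \<Rightarrow> real" where
  "energy T b \<Phi> \<Theta> = (\<integral>z. defect b 1 \<Phi> \<Theta> z + defect b (-1) \<Phi> \<Theta> z \<partial>spacetime_measure {0..T})"

lemma rho_trig: "\<Phi> \<in> trig \<Longrightarrow> rho \<Phi> \<in> trig"
  unfolding rho_def by (intro trig_diff trig_minus trig_pd)

lemma sig_trig: "\<Phi> \<in> trig \<Longrightarrow> sig \<kappa> \<Phi> \<in> trig"
  unfolding sig_def by (intro trig_diff trig_minus trig_pd trig_mult trig_const)

lemma mu_trig: "\<Phi> \<in> trig \<Longrightarrow> \<Theta> \<in> trig \<Longrightarrow> mu b \<kappa> \<Phi> \<Theta> \<in> trig"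
  unfolding mu_def by (intro trig_diff trig_add trig_minus trig_pd trig_mult trig_const)

lemma defect_trig: "\<Phi> \<in> trig \<Longrightarrow> \<Theta> \<in> trig \<Longrightarrow> defect b \<kappa> \<Phi> \<Theta> \<in> trig"
  unfolding defect_def by (intro trig_diff trig_mult mu_trig rho_trig sig_trig)

section \<open>Adding a wave packet\<close>

locale wave_packet =
  fixes T b :: real and \<kappa> :: int and \<Phi> \<Theta> :: "real spacetime_fun"
    and m :: nat and a :: "nat \<Rightarrow> real spacetime_fun" and y :: "nat \<Rightarrow> real"
  assumes \<kappa>: "\<kappa> = 1 \<or> \<kappa> = -1"
    and \<Phi>: "\<Phi> \<in> trig" and \<Theta>: "\<Theta> \<in> trig" and a: "\<And>j. a j \<in> trig"
begin

abbreviation "w j \<equiv> of_int \<kappa> * y j"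

text \<open>The correction of \<open>\<Theta>\<close> is \<open>q\<close> times the wave: this choice makes \<open>mu b \<kappa>\<close> change by \<open>- (sig \<kappa> - rho) s\<close>,
  hence the defect by \<open>- 2 sig \<kappa> s - s\<^sup>2\<close>, which is what keeps \<open>sig\<^sup>2 + defect\<close> constant.\<close>

definition q :: "real spacetime_fun" where "q = (\<lambda>z. 1/2 * (sig \<kappa> \<Phi> z - rho \<Phi> z))"

definition new\<Phi> :: "nat \<Rightarrow> real spacetime_fun" where
  "new\<Phi> N = (\<lambda>z. \<Phi> z + (\<Sum>j<m. 1 / (2 * (2 * pi * real (Suc j * Suc N))\<^sup>2) * (a j z * wcos (Suc j * Suc N) \<kappa> (w j) z)))"

definition new\<Theta> :: "nat \<Rightarrow> real spacetime_fun" where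
  "new\<Theta> N = (\<lambda>z. \<Theta> z + (\<Sum>j<m. 1 / (2 * pi * real (Suc j * Suc N)) * ((q z * a j z) * wsin (Suc j * Suc N) \<kappa> (w j) z)))"

text \<open>The oscillation \<open>s\<close> is the leading term of the change of the density, and \<open>r\<close>, weighted with the speeds, is that of the change of
  \<open>mu b (- \<kappa>)\<close>.\<close>

definition s :: "nat \<Rightarrow> real spacetime_fun" where
  "s N = (\<lambda>z. \<Sum>j<m. a j z * wcos (Suc j * Suc N) \<kappa> (w j) z)"

definition r :: "nat \<Rightarrow> real spacetime_fun" where
  "r N = (\<lambda>z. \<Sum>j<m. y j * (a j z * wcos (Suc j * Suc N) \<kappa> (w j) z))"

lemma \<kappa>2: "of_int \<kappa> * of_int \<kappa> = (1::real)" using \<kappa> by auto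

lemma q_trig: "q \<in> trig"
  unfolding q_def by (intro trig_mult trig_const trig_diff sig_trig rho_trig \<Phi>)

lemma packet_trig: "new\<Phi> N \<in> trig" "new\<Theta> N \<in> trig" "s N \<in> trig" "r N \<in> trig"
  unfolding new\<Phi>_def new\<Theta>_def s_def r_def
  by (intro trig_add trig_sum trig_mult trig_const \<Phi> \<Theta> a wcos_trig wsin_trig q_trig)+

lemma s_unif_bounded: "unif_bounded (cell T) s"
proof -
  have "unif_bounded (cell T) (\<lambda>N z. \<Sum>j<m. a j z * wcos (Suc j * Suc N) \<kappa> (w j) z)"
    by (intro unif_bounded_sum unif_bounded_mult trig_unif_bounded a wcos_unif_bounded)
  then show ?thesis by (simp add: s_def[abs_def])
qed

lemma second_derivative:
  "vanishing (cell T) (\<lambda>N z. pd d (pd c (new\<Phi> N)) z - pd d (pd c \<Phi>) z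
     + 1/2 * (\<Sum>j<m. ell \<kappa> (w j) c * ell \<kappa> (w j) d * (a j z * wcos (Suc j * Suc N) \<kappa> (w j) z)))"
proof -
  let ?W = "\<lambda>N j z. 1 / (2 * (2 * pi * real (Suc j * Suc N))\<^sup>2) * (a j z * wcos (Suc j * Suc N) \<kappa> (w j) z)"
  have W: "?W N j \<in> trig" for N j by (intro trig_mult trig_const a wcos_trig)
  have S: "(\<lambda>z. \<Sum>j<m. ?W N j z) \<in> trig" for N by (intro trig_sum W)
  have 1: "pd c (new\<Phi> N) = (\<lambda>z. pd c \<Phi> z + (\<Sum>j<m. pd c (?W N j) z))" for N
    unfolding new\<Phi>_def pd_add[OF trig_C1[OF \<Phi>] trig_C1[OF S]] by (subst pd_sum[OF trig_C1[OF W]]) (rule refl)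
  have S2: "(\<lambda>z. \<Sum>j<m. pd c (?W N j) z) \<in> trig" for N by (intro trig_sum trig_pd W)
  have 2: "pd d (pd c (new\<Phi> N)) = (\<lambda>z. pd d (pd c \<Phi>) z + (\<Sum>j<m. pd d (pd c (?W N j)) z))" for N
    unfolding 1 pd_add[OF trig_C1[OF trig_pd[OF \<Phi>]] trig_C1[OF S2]]
    by (subst pd_sum[OF trig_C1[OF trig_pd[OF W]]]) (rule refl)
  have "vanishing (cell T) (\<lambda>N z. \<Sum>j<m. pd d (pd c (?W N j)) z +
     1/2 * ell \<kappa> (w j) c * ell \<kappa> (w j) d * (a j z * wcos (Suc j * Suc N) \<kappa> (w j) z))"
    by (intro vanishing_sum wave_second_derivative_limit a)
  then show ?thesis
    by (rule vanishing_cong) (simp add: 2 sum.distrib sum_distrib_left mult_ac)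
qed

lemma first_derivative: "vanishing (cell T) (\<lambda>N z. pd c (new\<Phi> N) z - pd c \<Phi> z)"
  "vanishing (cell T) (\<lambda>N z. pd c (new\<Theta> N) z - pd c \<Theta> z
     - (\<Sum>j<m. ell \<kappa> (w j) c * ((q z * a j z) * wcos (Suc j * Suc N) \<kappa> (w j) z)))"
proof -
  let ?W = "\<lambda>N j z. 1 / (2 * (2 * pi * real (Suc j * Suc N))\<^sup>2) * (a j z * wcos (Suc j * Suc N) \<kappa> (w j) z)"
  have W: "?W N j \<in> trig" for N j by (intro trig_mult trig_const a wcos_trig)
  have S: "(\<lambda>z. \<Sum>j<m. ?W N j z) \<in> trig" for N by (intro trig_sum W)
  have 1: "pd c (new\<Phi> N) = (\<lambda>z. pd c \<Phi> z + (\<Sum>j<m. pd c (?W N j) z))" for N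
    unfolding new\<Phi>_def pd_add[OF trig_C1[OF \<Phi>] trig_C1[OF S]] by (subst pd_sum[OF trig_C1[OF W]]) (rule refl)
  have "vanishing (cell T) (\<lambda>N z. \<Sum>j<m. pd c (?W N j) z)"
    by (intro vanishing_sum wave_first_derivative_limit a)
  then show "vanishing (cell T) (\<lambda>N z. pd c (new\<Phi> N) z - pd c \<Phi> z)"
    by (rule vanishing_cong) (simp add: 1)
  let ?V = "\<lambda>N j z. 1 / (2 * pi * real (Suc j * Suc N)) * ((q z * a j z) * wsin (Suc j * Suc N) \<kappa> (w j) z)"
  have V: "?V N j \<in> trig" for N j by (intro trig_mult trig_const a wsin_trig q_trig)
  have S: "(\<lambda>z. \<Sum>j<m. ?V N j z) \<in> trig" for N by (intro trig_sum V)
  have 1: "pd c (new\<Theta> N) = (\<lambda>z. pd c \<Theta> z + (\<Sum>j<m. pd c (?V N j) z))" for N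
    unfolding new\<Theta>_def pd_add[OF trig_C1[OF \<Theta>] trig_C1[OF S]] by (subst pd_sum[OF trig_C1[OF V]]) (rule refl)
  have "vanishing (cell T) (\<lambda>N z. \<Sum>j<m. pd c (?V N j) z - ell \<kappa> (w j) c * ((q z * a j z) * wcos (Suc j * Suc N) \<kappa> (w j) z))"
    by (intro vanishing_sum wave_first_derivative_limit(2) trig_mult q_trig a)
  then show "vanishing (cell T) (\<lambda>N z. pd c (new\<Theta> N) z - pd c \<Theta> z
     - (\<Sum>j<m. ell \<kappa> (w j) c * ((q z * a j z) * wcos (Suc j * Suc N) \<kappa> (w j) z)))"
    by (rule vanishing_cong) (simp add: 1 sum_subtractf)
qed

lemma derivative_limits:
  "vanishing (cell T) (\<lambda>N z. pd e1 (pd e1 (new\<Phi> N)) z - pd e1 (pd e1 \<Phi>) z + 1/2 * s N z)"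
  "vanishing (cell T) (\<lambda>N z. pd e2 (pd e2 (new\<Phi> N)) z - pd e2 (pd e2 \<Phi>) z + 1/2 * s N z)"
  "vanishing (cell T) (\<lambda>N z. pd e1 (pd e2 (new\<Phi> N)) z - pd e1 (pd e2 \<Phi>) z + 1/2 * of_int \<kappa> * s N z)"
  "vanishing (cell T) (\<lambda>N z. pd e1 (pd et (new\<Phi> N)) z - pd e1 (pd et \<Phi>) z + 1/2 * of_int \<kappa> * r N z)"
  "vanishing (cell T) (\<lambda>N z. pd e2 (pd et (new\<Phi> N)) z - pd e2 (pd et \<Phi>) z + 1/2 * r N z)"
  "vanishing (cell T) (\<lambda>N z. pd e1 (new\<Theta> N) z - pd e1 \<Theta> z - q z * s N z)"
  "vanishing (cell T) (\<lambda>N z. pd e2 (new\<Theta> N) z - pd e2 \<Theta> z - of_int \<kappa> * q z * s N z)"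
proof -
  have k: "of_int \<kappa> * (of_int \<kappa> * x) = x" for x :: real using \<kappa>2 by (simp flip: mult.assoc)
  note l = ell_e1 ell_e2 ell_et
  show "vanishing (cell T) (\<lambda>N z. pd e1 (pd e1 (new\<Phi> N)) z - pd e1 (pd e1 \<Phi>) z + 1/2 * s N z)"
    using second_derivative[where c=e1 and d=e1] by (simp add: l s_def)
  show "vanishing (cell T) (\<lambda>N z. pd e2 (pd e2 (new\<Phi> N)) z - pd e2 (pd e2 \<Phi>) z + 1/2 * s N z)"
    using second_derivative[where c=e2 and d=e2] by (simp add: l s_def \<kappa>2)
  show "vanishing (cell T) (\<lambda>N z. pd e1 (pd e2 (new\<Phi> N)) z - pd e1 (pd e2 \<Phi>) z + 1/2 * of_int \<kappa> * s N z)"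
    by (rule vanishing_cong[OF second_derivative[where c=e2 and d=e1]]) (simp add: l s_def sum_distrib_left)
  show "vanishing (cell T) (\<lambda>N z. pd e1 (pd et (new\<Phi> N)) z - pd e1 (pd et \<Phi>) z + 1/2 * of_int \<kappa> * r N z)"
    by (rule vanishing_cong[OF second_derivative[where c=et and d=e1]]) (simp add: l r_def sum_distrib_left mult_ac)
  show "vanishing (cell T) (\<lambda>N z. pd e2 (pd et (new\<Phi> N)) z - pd e2 (pd et \<Phi>) z + 1/2 * r N z)"
    by (rule vanishing_cong[OF second_derivative[where c=et and d=e2]]) (simp add: l r_def sum_distrib_left mult_ac k)
  show "vanishing (cell T) (\<lambda>N z. pd e1 (new\<Theta> N) z - pd e1 \<Theta> z - q z * s N z)"
    by (rule vanishing_cong[OF first_derivative(2)[where c=e1]]) (simp add: l s_def sum_distrib_left mult_ac)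
  show "vanishing (cell T) (\<lambda>N z. pd e2 (new\<Theta> N) z - pd e2 \<Theta> z - of_int \<kappa> * q z * s N z)"
    by (rule vanishing_cong[OF first_derivative(2)[where c=e2]]) (simp add: l s_def sum_distrib_left mult_ac)
qed

lemma state_limits:
  "vanishing (cell T) (\<lambda>N z. rho (new\<Phi> N) z - (rho \<Phi> z + s N z))"
  "vanishing (cell T) (\<lambda>N z. sig \<kappa> (new\<Phi> N) z - (sig \<kappa> \<Phi> z + s N z))"
  "vanishing (cell T) (\<lambda>N z. sig (-\<kappa>) (new\<Phi> N) z - sig (-\<kappa>) \<Phi> z)"
  "vanishing (cell T) (\<lambda>N z. mu b \<kappa> (new\<Phi> N) (new\<Theta> N) z - (mu b \<kappa> \<Phi> \<Theta> z - (sig \<kappa> \<Phi> z - rho \<Phi> z) * s N z))"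
  "vanishing (cell T) (\<lambda>N z. mu b (-\<kappa>) (new\<Phi> N) (new\<Theta> N) z - (mu b (-\<kappa>) \<Phi> \<Theta> z + r N z))"
proof -
  note D = derivative_limits
  note k = vanishing_scale[where c="of_int \<kappa>"]
  show "vanishing (cell T) (\<lambda>N z. rho (new\<Phi> N) z - (rho \<Phi> z + s N z))"
    by (rule vanishing_cong[OF vanishing_diff[OF vanishing_minus[OF D(1)] D(2)]]) (simp add: rho_def)
  show "vanishing (cell T) (\<lambda>N z. sig \<kappa> (new\<Phi> N) z - (sig \<kappa> \<Phi> z + s N z))"
    by (rule vanishing_cong[OF vanishing_diff[OF vanishing_minus[OF D(1)] k[OF D(3)]]])
      (use \<kappa> in \<open>auto simp: sig_def\<close>)
  show "vanishing (cell T) (\<lambda>N z. sig (-\<kappa>) (new\<Phi> N) z - sig (-\<kappa>) \<Phi> z)"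
    by (rule vanishing_cong[OF vanishing_add[OF vanishing_minus[OF D(1)] k[OF D(3)]]])
      (use \<kappa> in \<open>auto simp: sig_def\<close>)
  show "vanishing (cell T) (\<lambda>N z. mu b \<kappa> (new\<Phi> N) (new\<Theta> N) z - (mu b \<kappa> \<Phi> \<Theta> z - (sig \<kappa> \<Phi> z - rho \<Phi> z) * s N z))"
    by (rule vanishing_cong[OF vanishing_diff[OF vanishing_diff[OF vanishing_diff[OF k[OF D(4)] D(5)] D(6)] k[OF D(7)]]])
      (use \<kappa> in \<open>auto simp: mu_def q_def field_simps\<close>)
  show "vanishing (cell T) (\<lambda>N z. mu b (-\<kappa>) (new\<Phi> N) (new\<Theta> N) z - (mu b (-\<kappa>) \<Phi> \<Theta> z + r N z))"
    by (rule vanishing_cong[OF vanishing_add[OF vanishing_diff[OF vanishing_diff[OF vanishing_minus[OF k[OF D(4)]] D(5)] D(6)] k[OF D(7)]]])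
      (use \<kappa> in \<open>auto simp: mu_def q_def field_simps\<close>)
qed

text \<open>The error caused by the constant speeds: it would vanish if every \<open>y j\<close> were equal to \<open>sig (- \<kappa>)\<close> where \<open>a j\<close> does not vanish.\<close>

definition drift :: "nat \<Rightarrow> real spacetime_fun" where
  "drift N = (\<lambda>z. \<Sum>j<m. ((sig (-\<kappa>) \<Phi> z - y j) * a j z) * wcos (Suc j * Suc N) \<kappa> (w j) z)"

lemma drift_eq: "drift N z = sig (-\<kappa>) \<Phi> z * s N z - r N z"
  by (simp add: drift_def s_def r_def sum_distrib_left algebra_simps sum_subtractf)

lemma state_unif_bounded: "unif_bounded (cell T) (\<lambda>N z. rho \<Phi> z + s N z)" "unif_bounded (cell T) (\<lambda>N z. sig \<kappa> \<Phi> z + s N z)"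
  "unif_bounded (cell T) (\<lambda>N. sig (-\<kappa>) \<Phi>)"
  by (intro unif_bounded_add s_unif_bounded trig_unif_bounded rho_trig sig_trig \<Phi>)+

text \<open>The product rule \<open>(\<rho> + s) (\<sigma> + s) = \<rho> \<sigma> + \<rho> s + \<sigma> s + s\<^sup>2\<close> against the change \<open>(\<rho> - \<sigma>) s\<close> of \<open>mu b \<kappa>\<close> leaves
  \<open>- 2 \<sigma> s - s\<^sup>2\<close>. The other defect feels only the mismatch between the speeds of the packet and \<open>sig (- \<kappa>)\<close>.\<close>

lemma defect_limits:
  "vanishing (cell T) (\<lambda>N z. defect b \<kappa> (new\<Phi> N) (new\<Theta> N) z - (defect b \<kappa> \<Phi> \<Theta> z - 2 * sig \<kappa> \<Phi> z * s N z - (s N z)\<^sup>2))"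
  "vanishing (cell T) (\<lambda>N z. defect b (-\<kappa>) (new\<Phi> N) (new\<Theta> N) z - (defect b (-\<kappa>) \<Phi> \<Theta> z - drift N z))"
proof -
  note S = state_limits
  show "vanishing (cell T) (\<lambda>N z. defect b \<kappa> (new\<Phi> N) (new\<Theta> N) z - (defect b \<kappa> \<Phi> \<Theta> z - 2 * sig \<kappa> \<Phi> z * s N z - (s N z)\<^sup>2))"
    by (rule vanishing_cong[OF vanishing_diff[OF S(4) vanishing_product[OF S(1,2) state_unif_bounded(1,2)]]])
       (simp add: defect_def power2_eq_square algebra_simps)
  show "vanishing (cell T) (\<lambda>N z. defect b (-\<kappa>) (new\<Phi> N) (new\<Theta> N) z - (defect b (-\<kappa>) \<Phi> \<Theta> z - drift N z))"
    by (rule vanishing_cong[OF vanishing_diff[OF S(5) vanishing_product[OF S(1,3) state_unif_bounded(1,3)]]])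
       (simp add: defect_def drift_eq power2_eq_square algebra_simps)
qed

lemma budget_limits:
  "vanishing (cell T) (\<lambda>N z. (sig \<kappa> (new\<Phi> N) z)\<^sup>2 + defect b \<kappa> (new\<Phi> N) (new\<Theta> N) z - ((sig \<kappa> \<Phi> z)\<^sup>2 + defect b \<kappa> \<Phi> \<Theta> z))"
  "vanishing (cell T) (\<lambda>N z. (sig (-\<kappa>) (new\<Phi> N) z)\<^sup>2 + defect b (-\<kappa>) (new\<Phi> N) (new\<Theta> N) z 
      - ((sig (-\<kappa>) \<Phi> z)\<^sup>2 + defect b (-\<kappa>) \<Phi> \<Theta> z - drift N z))"
  "vanishing (cell T) (\<lambda>N z. (rho (new\<Phi> N) z - sig 1 (new\<Phi> N) z - sig (-1) (new\<Phi> N) z) - (rho \<Phi> z - sig 1 \<Phi> z - sig (-1) \<Phi> z))"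
proof -
  note S = state_limits
  show "vanishing (cell T) (\<lambda>N z. (sig \<kappa> (new\<Phi> N) z)\<^sup>2 + defect b \<kappa> (new\<Phi> N) (new\<Theta> N) z - ((sig \<kappa> \<Phi> z)\<^sup>2 + defect b \<kappa> \<Phi> \<Theta> z))"
    by (rule vanishing_cong[OF vanishing_add[OF defect_limits(1) vanishing_product[OF S(2,2) state_unif_bounded(2,2)]]])
       (simp add: power2_eq_square algebra_simps)
  show "vanishing (cell T) (\<lambda>N z. (sig (-\<kappa>) (new\<Phi> N) z)\<^sup>2 + defect b (-\<kappa>) (new\<Phi> N) (new\<Theta> N) z 
      - ((sig (-\<kappa>) \<Phi> z)\<^sup>2 + defect b (-\<kappa>) \<Phi> \<Theta> z - drift N z))"
    by (rule vanishing_cong[OF vanishing_add[OF defect_limits(2) vanishing_product[OF S(3,3) state_unif_bounded(3,3)]]])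
       (simp add: power2_eq_square algebra_simps)
  show "vanishing (cell T) (\<lambda>N z. (rho (new\<Phi> N) z - sig 1 (new\<Phi> N) z - sig (-1) (new\<Phi> N) z) - (rho \<Phi> z - sig 1 \<Phi> z - sig (-1) \<Phi> z))"
    by (rule vanishing_cong[OF vanishing_diff[OF vanishing_diff[OF S(1,2)] S(3)]])
       (use \<kappa> in auto)
qed

lemma oscillation_limit:
  assumes "\<And>j. f j \<in> trig"
  shows "(\<lambda>N. \<integral>z. (\<Sum>j<m. f j z * wcos (Suc j * Suc N) \<kappa> (w j) z) \<partial>spacetime_measure {0..T}) \<longlonglongrightarrow> 0"
proof -
  have "(\<lambda>N. \<Sum>j<m. \<integral>z. f j z * wcos (Suc j * Suc N) \<kappa> (w j) z \<partial>spacetime_measure {0..T}) \<longlonglongrightarrow> (\<Sum>j<m. 0)"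
    by (intro tendsto_sum riemann_lebesgue assms)
  moreover have "(\<integral>z. (\<Sum>j<m. f j z * wcos (Suc j * Suc N) \<kappa> (w j) z) \<partial>spacetime_measure {0..T})
    = (\<Sum>j<m. \<integral>z. f j z * wcos (Suc j * Suc N) \<kappa> (w j) z \<partial>spacetime_measure {0..T})" for N
    by (intro Bochner_Integration.integral_sum trig_integrable trig_mult assms wcos_trig)
  ultimately show ?thesis by simp
qed

lemma s_weak_limit:
  assumes "g \<in> trig"
  shows "(\<lambda>N. \<integral>z. s N z * g z \<partial>spacetime_measure {0..T}) \<longlonglongrightarrow> 0"
proof -
  have "s N z * g z = (\<Sum>j<m. (g z * a j z) * wcos (Suc j * Suc N) \<kappa> (w j) z)" for N z
    unfolding s_def sum_distrib_right by (intro sum.cong refl) (simp only: mult_ac)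
  then show ?thesis
    using oscillation_limit[of "\<lambda>j z. g z * a j z", OF trig_mult[OF assms a]] by (simp only:)
qed

lemma drift_weak_limit: "(\<lambda>N. \<integral>z. drift N z \<partial>spacetime_measure {0..T}) \<longlonglongrightarrow> 0"
  unfolding drift_def
  by (intro oscillation_limit trig_mult trig_diff sig_trig \<Phi> a trig_const)

lemma s_square_limit:
  "(\<lambda>N. \<integral>z. (s N z)\<^sup>2 \<partial>spacetime_measure {0..T}) \<longlonglongrightarrow> 1/2 * (\<Sum>j<m. \<integral>z. (a j z)\<^sup>2 \<partial>spacetime_measure {0..T})"
proof -
  let ?M = "spacetime_measure {0..T}"
  let ?c = "\<lambda>N i. wcos (Suc i * Suc N) \<kappa> (w i)"
  define I where "I N i j = (\<integral>z. (a i z * a j z) * (?c N i z * ?c N j z) \<partial>?M)" for N i j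
  have aa: "(\<lambda>z. a i z * a j z) \<in> trig" for i j by (intro trig_mult a)
  have off: "(\<lambda>N. I N i j) \<longlonglongrightarrow> 0" if "j < i" for i j
  proof -
    let ?d = "\<lambda>N. wcos (Suc (i - j - 1) * Suc N) \<kappa> ((real (Suc i) * w i - real (Suc j) * w j) / (real i - real j))"
    let ?e = "\<lambda>N. wcos (Suc (Suc (i + j)) * Suc N) \<kappa> ((real (Suc i) * w i + real (Suc j) * w j) / (real i + real j + 2))"
    have "(\<lambda>N. 1/2 * (\<integral>z. (a i z * a j z) * ?d N z \<partial>?M) + 1/2 * (\<integral>z. (a i z * a j z) * ?e N z \<partial>?M)) \<longlonglongrightarrow> 1/2 * 0 + 1/2 * 0"
      by (intro tendsto_intros riemann_lebesgue aa)
    moreover have "I N i j = 1/2 * (\<integral>z. (a i z * a j z) * ?d N z \<partial>?M) + 1/2 * (\<integral>z. (a i z * a j z) * ?e N z \<partial>?M)" for N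
    proof -
      have "I N i j = (\<integral>z. 1/2 * ((a i z * a j z) * ?d N z) + 1/2 * ((a i z * a j z) * ?e N z) \<partial>?M)"
        unfolding I_def wcos_mult[OF that] by (simp add: algebra_simps)
      also have "\<dots> = (\<integral>z. 1/2 * ((a i z * a j z) * ?d N z) \<partial>?M) + (\<integral>z. 1/2 * ((a i z * a j z) * ?e N z) \<partial>?M)"
        by (intro Bochner_Integration.integral_add trig_integrable trig_mult aa wcos_trig trig_const a)
      finally show ?thesis by simp
    qed
    ultimately show ?thesis by simp
  qed
  have diag: "(\<lambda>N. I N i i) \<longlonglongrightarrow> 1/2 * (\<integral>z. (a i z)\<^sup>2 \<partial>?M)" for i
  proof -
    let ?d = "\<lambda>N. wcos (Suc (Suc (i + i)) * Suc N) \<kappa> (w i)"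
    have "(\<lambda>N. 1/2 * (\<integral>z. (a i z)\<^sup>2 \<partial>?M) + 1/2 * (\<integral>z. (a i z * a i z) * ?d N z \<partial>?M)) \<longlonglongrightarrow> 1/2 * (\<integral>z. (a i z)\<^sup>2 \<partial>?M) + 1/2 * 0"
      by (intro tendsto_intros riemann_lebesgue aa)
    moreover have "I N i i = 1/2 * (\<integral>z. (a i z)\<^sup>2 \<partial>?M) + 1/2 * (\<integral>z. (a i z * a i z) * ?d N z \<partial>?M)" for N
    proof -
      have "I N i i = (\<integral>z. 1/2 * (a i z * a i z) + 1/2 * ((a i z * a i z) * ?d N z) \<partial>?M)"
        unfolding I_def wcos_square by (simp add: algebra_simps)
      also have "\<dots> = (\<integral>z. 1/2 * (a i z * a i z) \<partial>?M) + (\<integral>z. 1/2 * ((a i z * a i z) * ?d N z) \<partial>?M)"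
        by (intro Bochner_Integration.integral_add trig_integrable trig_mult aa wcos_trig trig_const a)
      finally show ?thesis by (simp add: power2_eq_square)
    qed
    ultimately show ?thesis by simp
  qed
  have all: "(\<lambda>N. I N i j) \<longlonglongrightarrow> (if i = j then 1/2 * (\<integral>z. (a i z)\<^sup>2 \<partial>?M) else 0)" for i j
  proof -
    have "I N i j = I N j i" for N by (simp add: I_def mult_ac)
    then show ?thesis using off[of i j] off[of j i] diag[of i] by (cases i j rule: linorder_cases) auto
  qed
  have "(\<lambda>N. \<Sum>i<m. \<Sum>j<m. I N i j) \<longlonglongrightarrow> (\<Sum>i<m. \<Sum>j<m. if i = j then 1/2 * (\<integral>z. (a i z)\<^sup>2 \<partial>?M) else 0)"
    by (intro tendsto_sum all)
  moreover have "(\<Sum>i<m. \<Sum>j<m. if i = j then 1/2 * (\<integral>z. (a i z)\<^sup>2 \<partial>?M) else 0) = 1/2 * (\<Sum>j<m. \<integral>z. (a j z)\<^sup>2 \<partial>?M)"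
    by (simp add: sum_distrib_left)
  moreover have "(\<integral>z. (s N z)\<^sup>2 \<partial>?M) = (\<Sum>i<m. \<Sum>j<m. I N i j)" for N
  proof -
    have "(s N z)\<^sup>2 = (\<Sum>i<m. \<Sum>j<m. (a i z * a j z) * (?c N i z * ?c N j z))" for z
      unfolding s_def power2_eq_square sum_product by (simp add: mult_ac)
    then have "(\<integral>z. (s N z)\<^sup>2 \<partial>?M) = (\<integral>z. (\<Sum>i<m. \<Sum>j<m. (a i z * a j z) * (?c N i z * ?c N j z)) \<partial>?M)" by simp
    also have "\<dots> = (\<Sum>i<m. \<integral>z. (\<Sum>j<m. (a i z * a j z) * (?c N i z * ?c N j z)) \<partial>?M)"
      by (intro Bochner_Integration.integral_sum trig_integrable trig_sum trig_mult a wcos_trig)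
    also have "\<dots> = (\<Sum>i<m. \<Sum>j<m. I N i j)"
      unfolding I_def by (intro sum.cong refl Bochner_Integration.integral_sum trig_integrable trig_mult a wcos_trig)
    finally show ?thesis .
  qed
  ultimately show ?thesis by (simp only:)
qed

text \<open>The terms linear in the waves have vanishing mean, so only the mean of \<open>s\<^sup>2\<close> remains, and in it only the squares of the single waves.\<close>

lemma energy_limit:
  "(\<lambda>N. energy T b (new\<Phi> N) (new\<Theta> N)) \<longlonglongrightarrow> energy T b \<Phi> \<Theta> - 1/2 * (\<Sum>j<m. \<integral>z. (a j z)\<^sup>2 \<partial>spacetime_measure {0..T})"
proof -
  let ?M = "spacetime_measure {0..T}"
  define E where "E N z = (defect b \<kappa> (new\<Phi> N) (new\<Theta> N) z - (defect b \<kappa> \<Phi> \<Theta> z - 2 * sig \<kappa> \<Phi> z * s N z - (s N z)\<^sup>2))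
     + (defect b (-\<kappa>) (new\<Phi> N) (new\<Theta> N) z - (defect b (-\<kappa>) \<Phi> \<Theta> z - drift N z))" for N z
  have "vanishing (cell T) E" unfolding E_def by (intro vanishing_add defect_limits)
  note E = vanishing_integral[OF this]
  have e: "energy T b F G = (\<integral>z. defect b \<kappa> F G z + defect b (-\<kappa>) F G z \<partial>?M)" for F G
    unfolding energy_def using \<kappa> by (auto simp: add.commute)
  have d: "drift N \<in> trig" for N
    unfolding drift_def by (intro trig_sum trig_mult trig_diff sig_trig \<Phi> trig_const a wcos_trig)
  have s2: "(\<lambda>z. (s N z)\<^sup>2) \<in> trig" for N unfolding power2_eq_square by (intro trig_mult packet_trig)
  have eq: "energy T b (new\<Phi> N) (new\<Theta> N) = energy T b \<Phi> \<Theta> + ((\<integral>z. E N z \<partial>?M) - 2 * (\<integral>z. s N z * sig \<kappa> \<Phi> z \<partial>?M)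
     - (\<integral>z. (s N z)\<^sup>2 \<partial>?M) - (\<integral>z. drift N z \<partial>?M))" for N
  proof -
    have t: "E N \<in> trig" "(\<lambda>z. 2 * (s N z * sig \<kappa> \<Phi> z)) \<in> trig" 
       "(\<lambda>z. defect b \<kappa> \<Phi> \<Theta> z + defect b (-\<kappa>) \<Phi> \<Theta> z) \<in> trig"
      unfolding E_def power2_eq_square 
      by (intro trig_add trig_diff trig_mult trig_const defect_trig packet_trig d sig_trig \<Phi> \<Theta>)+
    have "energy T b (new\<Phi> N) (new\<Theta> N) = (\<integral>z. (defect b \<kappa> \<Phi> \<Theta> z + defect b (-\<kappa>) \<Phi> \<Theta> z) + 
        (E N z - 2 * (s N z * sig \<kappa> \<Phi> z) - (s N z)\<^sup>2 - drift N z) \<partial>?M)"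
      unfolding e by (rule Bochner_Integration.integral_cong[OF refl]) (simp add: E_def)
    also have "\<dots> = energy T b \<Phi> \<Theta> + (\<integral>z. E N z - 2 * (s N z * sig \<kappa> \<Phi> z) - (s N z)\<^sup>2 - drift N z \<partial>?M)"
      unfolding e by (intro Bochner_Integration.integral_add trig_integrable trig_diff t s2 d)
    also have "(\<integral>z. E N z - 2 * (s N z * sig \<kappa> \<Phi> z) - (s N z)\<^sup>2 - drift N z \<partial>?M)
      = (\<integral>z. E N z - 2 * (s N z * sig \<kappa> \<Phi> z) - (s N z)\<^sup>2 \<partial>?M) - (\<integral>z. drift N z \<partial>?M)"
      by (intro Bochner_Integration.integral_diff trig_integrable trig_diff t s2 d)
    also have "(\<integral>z. E N z - 2 * (s N z * sig \<kappa> \<Phi> z) - (s N z)\<^sup>2 \<partial>?M)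
       = (\<integral>z. E N z - 2 * (s N z * sig \<kappa> \<Phi> z) \<partial>?M) - (\<integral>z. (s N z)\<^sup>2 \<partial>?M)"
      by (intro Bochner_Integration.integral_diff trig_integrable trig_diff t s2 d)
    also have "(\<integral>z. E N z - 2 * (s N z * sig \<kappa> \<Phi> z) \<partial>?M) = (\<integral>z. E N z \<partial>?M) - (\<integral>z. 2 * (s N z * sig \<kappa> \<Phi> z) \<partial>?M)"
      by (intro Bochner_Integration.integral_diff trig_integrable trig_diff t s2 d)
    also have "(\<integral>z. 2 * (s N z * sig \<kappa> \<Phi> z) \<partial>?M) = 2 * (\<integral>z. s N z * sig \<kappa> \<Phi> z \<partial>?M)" by simp
    finally show ?thesis .
  qed
  have "(\<lambda>N. energy T b \<Phi> \<Theta> + ((\<integral>z. E N z \<partial>?M) - 2 * (\<integral>z. s N z * sig \<kappa> \<Phi> z \<partial>?M)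
     - (\<integral>z. (s N z)\<^sup>2 \<partial>?M) - (\<integral>z. drift N z \<partial>?M))) \<longlonglongrightarrow> 
     energy T b \<Phi> \<Theta> + (0 - 2 * 0 - 1/2 * (\<Sum>j<m. \<integral>z. (a j z)\<^sup>2 \<partial>?M) - 0)"
    by (intro tendsto_intros E s_weak_limit s_square_limit drift_weak_limit sig_trig \<Phi>)
  then show ?thesis unfolding eq by simp
qed

lemma increment_weak_limits:
  assumes g: "g \<in> trig"
  shows "(\<lambda>N. \<integral>z. (rho (new\<Phi> N) z - rho \<Phi> z) * g z \<partial>spacetime_measure {0..T}) \<longlonglongrightarrow> 0"
    "(\<lambda>N. \<integral>z. (sig \<kappa> (new\<Phi> N) z - sig \<kappa> \<Phi> z) * g z \<partial>spacetime_measure {0..T}) \<longlonglongrightarrow> 0"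
    "(\<lambda>N. \<integral>z. (sig (-\<kappa>) (new\<Phi> N) z - sig (-\<kappa>) \<Phi> z) * g z \<partial>spacetime_measure {0..T}) \<longlonglongrightarrow> 0"
proof -
  let ?M = "spacetime_measure {0..T}"
  have *: "(\<lambda>N. \<integral>z. (F N z - F0 z) * g z \<partial>?M) \<longlonglongrightarrow> 0"
    if F: "vanishing (cell T) (\<lambda>N z. F N z - (F0 z + s N z))" "\<And>N. F N \<in> trig" "F0 \<in> trig" for F F0
  proof -
    have "(\<lambda>N. (\<integral>z. (F N z - (F0 z + s N z)) * g z \<partial>?M) + (\<integral>z. s N z * g z \<partial>?M)) \<longlonglongrightarrow> 0 + 0"
      by (intro tendsto_intros vanishing_integral vanishing_mult F trig_unif_bounded g s_weak_limit)
    moreover have "(\<integral>z. (F N z - (F0 z + s N z)) * g z \<partial>?M) + (\<integral>z. s N z * g z \<partial>?M) = (\<integral>z. (F N z - F0 z) * g z \<partial>?M)" for N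
      by (subst Bochner_Integration.integral_add[symmetric])
         (auto intro!: trig_integrable trig_mult trig_diff trig_add F packet_trig g
            Bochner_Integration.integral_cong simp: algebra_simps)
    ultimately show ?thesis by simp
  qed
  show "(\<lambda>N. \<integral>z. (rho (new\<Phi> N) z - rho \<Phi> z) * g z \<partial>?M) \<longlonglongrightarrow> 0"
    by (intro * state_limits rho_trig packet_trig \<Phi>)
  show "(\<lambda>N. \<integral>z. (sig \<kappa> (new\<Phi> N) z - sig \<kappa> \<Phi> z) * g z \<partial>?M) \<longlonglongrightarrow> 0"
    by (intro * state_limits sig_trig packet_trig \<Phi>)
  show "(\<lambda>N. \<integral>z. (sig (-\<kappa>) (new\<Phi> N) z - sig (-\<kappa>) \<Phi> z) * g z \<partial>?M) \<longlonglongrightarrow> 0"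
    by (intro vanishing_integral vanishing_mult state_limits trig_unif_bounded g)
qed

end

section \<open>The perturbation step\<close>

lemma subsolution_margin:
  assumes "subsolution T b \<Phi> \<Theta>"
  obtains \<delta> where "\<delta> > 0" "\<And>z k. z \<in> cell T \<Longrightarrow> k = 1 \<or> k = -1 \<Longrightarrow> defect b k \<Phi> \<Theta> z \<ge> \<delta>"
    "\<And>z k. z \<in> cell T \<Longrightarrow> k = 1 \<or> k = -1 \<Longrightarrow> (sig k \<Phi> z)\<^sup>2 + defect b k \<Phi> \<Theta> z \<le> 2 - \<delta>"
    "\<And>z. z \<in> cell T \<Longrightarrow> \<bar>rho \<Phi> z - sig 1 \<Phi> z - sig (-1) \<Phi> z\<bar> \<le> 1 - \<delta>"
proof -
  have \<Phi>: "\<Phi> \<in> trig" "\<Theta> \<in> trig" using assms by (auto simp: subsolution_def)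
  note c = trig_continuous[OF defect_trig[OF \<Phi>]] trig_continuous[OF sig_trig[OF \<Phi>(1)]] trig_continuous[OF rho_trig[OF \<Phi>(1)]]
  define f where "f z = min (min (min (defect b 1 \<Phi> \<Theta> z) (defect b (-1) \<Phi> \<Theta> z))
     (min (2 - ((sig 1 \<Phi> z)\<^sup>2 + defect b 1 \<Phi> \<Theta> z)) (2 - ((sig (-1) \<Phi> z)\<^sup>2 + defect b (-1) \<Phi> \<Theta> z))))
     (1 - \<bar>rho \<Phi> z - sig 1 \<Phi> z - sig (-1) \<Phi> z\<bar>)" for z
  have "continuous_on (cell T) f" unfolding f_def by (intro continuous_intros c)
  moreover have "f z > 0" if "z \<in> cell T" for z
    using assms that unfolding f_def subsolution_def by fastforce
  ultimately obtain \<delta> where \<delta>: "\<delta> > 0" "\<And>z. z \<in> cell T \<Longrightarrow> f z \<ge> \<delta>"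
    using continuous_pos_lower_bound[OF cell_compact] by metis
  show thesis
  proof (rule that[OF \<delta>(1)])
    fix z and k :: int assume z: "z \<in> cell T" and k: "k = 1 \<or> k = -1"
    show "defect b k \<Phi> \<Theta> z \<ge> \<delta>" "(sig k \<Phi> z)\<^sup>2 + defect b k \<Phi> \<Theta> z \<le> 2 - \<delta>"
      using \<delta>(2)[OF z] k unfolding f_def by auto
  next
    fix z assume "z \<in> cell T" then show "\<bar>rho \<Phi> z - sig 1 \<Phi> z - sig (-1) \<Phi> z\<bar> \<le> 1 - \<delta>"
      using \<delta>(2)[of z] unfolding f_def by auto
  qed
qed

lemma sig_bound:
  fixes x d :: real
  assumes "x\<^sup>2 + d < 2" "d > 0" shows "\<bar>x\<bar> \<le> 3/2"
proof (rule power2_le_imp_le)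
  have "(3/2 :: real)\<^sup>2 = 9/4" by (simp add: power2_eq_square)
  then show "\<bar>x\<bar>\<^sup>2 \<le> (3/2)\<^sup>2" using assms by simp
qed simp

text \<open>The factor 1/8 in the amplitudes is chosen for this inequality: at most half of the defect is used up.\<close>

lemma defect_decrease:
  fixes x s d :: real
  assumes "\<bar>x\<bar> \<le> 3/2" "0 < d" "d < 2" "\<bar>s\<bar> \<le> d / 8"
  shows "d - 2 * x * s - s\<^sup>2 \<ge> d / 2"
proof -
  have "\<bar>x * s\<bar> \<le> 3/2 * (d / 8)" unfolding abs_mult using assms by (intro mult_mono) auto
  moreover have "\<bar>s * s\<bar> \<le> d / 8 * (1/4)" unfolding abs_mult using assms by (intro mult_mono) auto
  ultimately show ?thesis using assms(2) by (simp add: power2_eq_square abs_le_iff)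
qed

text \<open>The amplitudes are \<open>1/8 \<cdot> t/T \<cdot> defect\<close> times the localising polynomials, evaluated at \<open>sig (- \<kappa>)\<close>. The
  fineness of localisation is the margin \<open>\<delta>\<close> of the given subsolution, so the drift cannot destroy positivity of the other defect.
  The constant 1/1024 is \<open>1/2 \<cdot> (1/8)\<^sup>2 \<cdot> 1/8\<close>: mean of a squared cosine, squared amplitude, energy of the localising polynomials.\<close>

lemma perturbation_step:
  assumes T: "T > 0" and sub: "subsolution T b \<Phi> \<Theta>" and \<kappa>: "\<kappa> = 1 \<or> \<kappa> = -1" and \<epsilon>: "\<epsilon> > 0"
    and G: "finite G" "G \<subseteq> trig"
  shows "\<exists>\<Phi>' \<Theta>'. subsolution T b \<Phi>' \<Theta>' \<and>
     energy T b \<Phi>' \<Theta>' \<le> energy T b \<Phi> \<Theta> - 1/1024 * (\<integral>z. (snd z / T * defect b \<kappa> \<Phi> \<Theta> z)\<^sup>2 \<partial>spacetime_measure {0..T}) + \<epsilon> \<and>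
     (\<forall>g\<in>G. \<bar>\<integral>z. (rho \<Phi>' z - rho \<Phi> z) * g z \<partial>spacetime_measure {0..T}\<bar> \<le> \<epsilon> \<and>
       (\<forall>k\<in>{1,-1}. \<bar>\<integral>z. (sig k \<Phi>' z - sig k \<Phi> z) * g z \<partial>spacetime_measure {0..T}\<bar> \<le> \<epsilon>)) \<and>
     (\<forall>z\<in>cell T. \<bar>pd e2 \<Phi>' z - pd e2 \<Phi> z\<bar> \<le> \<epsilon>)"
proof -
  let ?M = "spacetime_measure {0..T}"
  have \<Phi>: "\<Phi> \<in> trig" "\<Theta> \<in> trig" and init: "\<And>x. \<Phi> (x, 0) = 0" using sub by (auto simp: subsolution_def)
  have \<kappa>': "-\<kappa> = 1 \<or> -\<kappa> = -1" using \<kappa> by auto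
  obtain \<delta> where \<delta>: "\<delta> > 0" "\<And>z k. z \<in> cell T \<Longrightarrow> k = 1 \<or> k = -1 \<Longrightarrow> defect b k \<Phi> \<Theta> z \<ge> \<delta>"
    "\<And>z k. z \<in> cell T \<Longrightarrow> k = 1 \<or> k = -1 \<Longrightarrow> (sig k \<Phi> z)\<^sup>2 + defect b k \<Phi> \<Theta> z \<le> 2 - \<delta>"
    "\<And>z. z \<in> cell T \<Longrightarrow> \<bar>rho \<Phi> z - sig 1 \<Phi> z - sig (-1) \<Phi> z\<bar> \<le> 1 - \<delta>"
    by (rule subsolution_margin[OF sub]) blast
  obtain m :: nat and y :: "nat \<Rightarrow> real" and \<tau> :: "nat \<Rightarrow> real \<Rightarrow> real" where *: "(\<forall>j. real_polynomial_function (\<tau> j)) \<and>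
    (\<forall>u. \<bar>u\<bar> \<le> 2 \<longrightarrow> (\<Sum>j<m. \<bar>\<tau> j u\<bar>) \<le> 1 \<and> (\<Sum>j<m. \<bar>\<tau> j u\<bar> * \<bar>u - y j\<bar>) \<le> \<delta> \<and>
      (\<Sum>j<m. (\<tau> j u)\<^sup>2) \<ge> 1/8)"
    using localizing_polynomials[OF \<delta>(1)] by blast
  then have \<tau>: "\<And>j. real_polynomial_function (\<tau> j)"
    "\<And>u. \<bar>u\<bar> \<le> 2 \<Longrightarrow> (\<Sum>j<m. \<bar>\<tau> j u\<bar>) \<le> 1"
    "\<And>u. \<bar>u\<bar> \<le> 2 \<Longrightarrow> (\<Sum>j<m. \<bar>\<tau> j u\<bar> * \<bar>u - y j\<bar>) \<le> \<delta>"
    "\<And>u. \<bar>u\<bar> \<le> 2 \<Longrightarrow> (\<Sum>j<m. (\<tau> j u)\<^sup>2) \<ge> 1/8"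
    by simp_all
  \<comment> \<open>the envelope of the packet, which vanishes at time 0\<close>
  define A where "A z = snd z / T * defect b \<kappa> \<Phi> \<Theta> z" for z
  define a where "a j = (\<lambda>z. 1/8 * (A z * \<tau> j (sig (-\<kappa>) \<Phi> z)))" for j
  have A_trig: "A \<in> trig"
    using trig_mult[OF trig_scale[OF trig_snd, of "1/T"] defect_trig[OF \<Phi>, of b \<kappa>]] by (simp add: A_def[abs_def])
  have a_trig: "a j \<in> trig" for j
    unfolding a_def by (intro trig_scale trig_mult A_trig trig_polynomial[OF \<tau>(1)] sig_trig \<Phi>)
  interpret wave_packet T b \<kappa> \<Phi> \<Theta> m a y
    by unfold_locales (use \<kappa> \<Phi> a_trig in auto)
  have sigb: "\<bar>sig k \<Phi> z\<bar> \<le> 3/2" if "z \<in> cell T" "k = 1 \<or> k = -1" for z k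
    using sub that by (intro sig_bound[of _ "defect b k \<Phi> \<Theta> z"]) (auto simp: subsolution_def)
  have d2: "0 < defect b k \<Phi> \<Theta> z" "defect b k \<Phi> \<Theta> z < 2" if "z \<in> cell T" "k = 1 \<or> k = -1" for z k
    using \<delta>(1) \<delta>(2,3)[OF that] zero_le_power2[of "sig k \<Phi> z"] by linarith+
  have A: "0 \<le> A z" "A z \<le> defect b \<kappa> \<Phi> \<Theta> z" if z: "z \<in> cell T" for z
  proof -
    have "0 \<le> snd z / T" "snd z / T \<le> 1" using z T by auto
    then show "0 \<le> A z" "A z \<le> defect b \<kappa> \<Phi> \<Theta> z"
      using d2(1)[OF z \<kappa>] mult_nonneg_nonneg[of "snd z / T" "defect b \<kappa> \<Phi> \<Theta> z"]
        mult_right_mono[of "snd z / T" 1 "defect b \<kappa> \<Phi> \<Theta> z"]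
      unfolding A_def by linarith+
  qed
  have s_le: "\<bar>s N z\<bar> \<le> defect b \<kappa> \<Phi> \<Theta> z / 8" if z: "z \<in> cell T" for N z
  proof -
    have "\<bar>s N z\<bar> \<le> (\<Sum>j<m. \<bar>a j z * wcos (Suc j * Suc N) \<kappa> (w j) z\<bar>)"
      unfolding s_def by (rule sum_abs)
    also have "\<dots> \<le> (\<Sum>j<m. 1/8 * A z * \<bar>\<tau> j (sig (-\<kappa>) \<Phi> z)\<bar>)"
    proof (rule sum_mono)
      fix j
      have "\<bar>a j z * wcos (Suc j * Suc N) \<kappa> (w j) z\<bar> \<le> \<bar>a j z\<bar> * 1"
        unfolding abs_mult by (intro mult_left_mono wcos_le) auto
      then show "\<bar>a j z * wcos (Suc j * Suc N) \<kappa> (w j) z\<bar> \<le> 1/8 * A z * \<bar>\<tau> j (sig (-\<kappa>) \<Phi> z)\<bar>"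
        using A(1)[OF z] by (simp add: a_def abs_mult)
    qed
    also have "\<dots> = 1/8 * A z * (\<Sum>j<m. \<bar>\<tau> j (sig (-\<kappa>) \<Phi> z)\<bar>)" by (simp only: sum_distrib_left)
    also have "\<dots> \<le> 1/8 * A z * 1"
      using A(1)[OF z] sigb[OF z \<kappa>'] by (intro mult_left_mono \<tau>(2)) auto
    finally show ?thesis using A(2)[OF z] by simp
  qed
  have drift_le: "\<bar>drift N z\<bar> \<le> \<delta> / 4" if z: "z \<in> cell T" for N z
  proof -
    let ?u = "sig (-\<kappa>) \<Phi> z"
    have "\<bar>drift N z\<bar> \<le> (\<Sum>j<m. \<bar>((?u - y j) * a j z) * wcos (Suc j * Suc N) \<kappa> (w j) z\<bar>)"
      unfolding drift_def by (rule sum_abs)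
    also have "\<dots> \<le> (\<Sum>j<m. 1/8 * A z * (\<bar>\<tau> j ?u\<bar> * \<bar>?u - y j\<bar>))"
    proof (rule sum_mono)
      fix j
      have "\<bar>((?u - y j) * a j z) * wcos (Suc j * Suc N) \<kappa> (w j) z\<bar> \<le> \<bar>(?u - y j) * a j z\<bar> * 1"
        unfolding abs_mult[of _ "wcos _ _ _ _"] by (intro mult_left_mono wcos_le) auto
      then show "\<bar>((?u - y j) * a j z) * wcos (Suc j * Suc N) \<kappa> (w j) z\<bar> \<le> 1/8 * A z * (\<bar>\<tau> j ?u\<bar> * \<bar>?u - y j\<bar>)"
        using A(1)[OF z] by (simp add: a_def abs_mult mult_ac)
    qed
    also have "\<dots> = 1/8 * A z * (\<Sum>j<m. \<bar>\<tau> j ?u\<bar> * \<bar>?u - y j\<bar>)" by (simp only: sum_distrib_left)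
    also have "\<dots> \<le> 1/8 * A z * \<delta>"
      using A(1)[OF z] sigb[OF z \<kappa>'] by (intro mult_left_mono \<tau>(3)) auto
    also have "\<dots> \<le> 1/4 * \<delta>"
      using A(2)[OF z] d2(2)[OF z \<kappa>] \<delta>(1) by (intro mult_right_mono) auto
    finally show ?thesis by simp
  qed
  have pos: "\<delta> / 8 > 0" using \<delta>(1) by simp
  note small = vanishing_def[THEN iffD1, rule_format, OF _ pos, of "cell T"]
  have "\<forall>\<^sub>F N in sequentially. subsolution T b (new\<Phi> N) (new\<Theta> N)"
    using small[OF defect_limits(1)] small[OF defect_limits(2)] small[OF budget_limits(1)]
      small[OF budget_limits(2)] small[OF budget_limits(3)]
  proof eventually_elim
    case (elim N)
    have "new\<Phi> N (x, 0) = 0" for x by (simp add: new\<Phi>_def init a_def A_def)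
    moreover have "(\<forall>k\<in>{1, -1}. defect b k (new\<Phi> N) (new\<Theta> N) z > 0 \<and> (sig k (new\<Phi> N) z)\<^sup>2 + defect b k (new\<Phi> N) (new\<Theta> N) z < 2) \<and>
       \<bar>rho (new\<Phi> N) z - sig 1 (new\<Phi> N) z - sig (-1) (new\<Phi> N) z\<bar> < 1" if z: "z \<in> cell T" for z
    proof -
      have dd: "defect b \<kappa> \<Phi> \<Theta> z - 2 * sig \<kappa> \<Phi> z * s N z - (s N z)\<^sup>2 \<ge> defect b \<kappa> \<Phi> \<Theta> z / 2"
        by (rule defect_decrease[OF sigb[OF z \<kappa>] d2[OF z \<kappa>] s_le[OF z]])
      have "defect b \<kappa> (new\<Phi> N) (new\<Theta> N) z > 0" 
        using elim(1)[rule_format, OF z] dd \<delta>(2)[OF z \<kappa>] \<delta>(1) by linarith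
      moreover have "defect b (-\<kappa>) (new\<Phi> N) (new\<Theta> N) z > 0"
        using elim(2)[rule_format, OF z] drift_le[OF z, of N] \<delta>(2)[OF z \<kappa>'] \<delta>(1) by linarith
      moreover have "(sig \<kappa> (new\<Phi> N) z)\<^sup>2 + defect b \<kappa> (new\<Phi> N) (new\<Theta> N) z < 2"
        using elim(3)[rule_format, OF z] \<delta>(3)[OF z \<kappa>] \<delta>(1) by linarith
      moreover have "(sig (-\<kappa>) (new\<Phi> N) z)\<^sup>2 + defect b (-\<kappa>) (new\<Phi> N) (new\<Theta> N) z < 2"
        using elim(4)[rule_format, OF z] drift_le[OF z, of N] \<delta>(3)[OF z \<kappa>'] \<delta>(1) by linarith
      moreover have "\<bar>rho (new\<Phi> N) z - sig 1 (new\<Phi> N) z - sig (-1) (new\<Phi> N) z\<bar> < 1"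
        using elim(5)[rule_format, OF z] \<delta>(4)[OF z] \<delta>(1) by linarith
      ultimately show ?thesis using \<kappa> by auto
    qed
    ultimately show ?case unfolding subsolution_def using packet_trig by blast
  qed
  moreover have "\<forall>\<^sub>F N in sequentially. energy T b (new\<Phi> N) (new\<Theta> N) 
     \<le> energy T b \<Phi> \<Theta> - 1/1024 * (\<integral>z. (A z)\<^sup>2 \<partial>?M) + \<epsilon>"
  proof -
    have A2: "integrable ?M (\<lambda>z. (A z)\<^sup>2)" and a2: "integrable ?M (\<lambda>z. (a j z)\<^sup>2)" for j
      unfolding power2_eq_square by (intro trig_integrable trig_mult A_trig a_trig)+
    have "1/512 * (\<integral>z. (A z)\<^sup>2 \<partial>?M) = (\<integral>z. 1/512 * (A z)\<^sup>2 \<partial>?M)" by simp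
    also have "\<dots> \<le> (\<integral>z. (\<Sum>j<m. (a j z)\<^sup>2) \<partial>?M)"
    proof (rule integral_mono)
      show "integrable ?M (\<lambda>z. 1/512 * (A z)\<^sup>2)" using A2 by simp
      show "integrable ?M (\<lambda>z. \<Sum>j<m. (a j z)\<^sup>2)" by (intro Bochner_Integration.integrable_sum a2)
      fix z assume "z \<in> space ?M"
      then have z: "z \<in> cell T" by (simp add: space_restrict_space)
      have "1/64 * (A z)\<^sup>2 * (1/8) \<le> 1/64 * (A z)\<^sup>2 * (\<Sum>j<m. (\<tau> j (sig (-\<kappa>) \<Phi> z))\<^sup>2)"
        using sigb[OF z \<kappa>'] by (intro mult_left_mono \<tau>(4)) auto
      also have "\<dots> = (\<Sum>j<m. (a j z)\<^sup>2)"
        unfolding sum_distrib_left by (intro sum.cong refl) (simp add: a_def power2_eq_square)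
      finally show "1/512 * (A z)\<^sup>2 \<le> (\<Sum>j<m. (a j z)\<^sup>2)" by simp
    qed
    also have "\<dots> = (\<Sum>j<m. \<integral>z. (a j z)\<^sup>2 \<partial>?M)"
      by (intro Bochner_Integration.integral_sum a2)
    finally have "energy T b \<Phi> \<Theta> - 1/2 * (\<Sum>j<m. \<integral>z. (a j z)\<^sup>2 \<partial>?M) 
       < energy T b \<Phi> \<Theta> - 1/1024 * (\<integral>z. (A z)\<^sup>2 \<partial>?M) + \<epsilon>" using \<epsilon> by linarith
    from order_tendstoD(2)[OF energy_limit this] show ?thesis
      by eventually_elim simp
  qed
  moreover have "\<forall>\<^sub>F N in sequentially. \<forall>g\<in>G. \<bar>\<integral>z. (rho (new\<Phi> N) z - rho \<Phi> z) * g z \<partial>?M\<bar> \<le> \<epsilon> \<and>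
       (\<forall>k\<in>{1,-1}. \<bar>\<integral>z. (sig k (new\<Phi> N) z - sig k \<Phi> z) * g z \<partial>?M\<bar> \<le> \<epsilon>)"
  proof (intro eventually_ball_finite[OF G(1)] ballI)
    fix g assume "g \<in> G"
    then have g: "g \<in> trig" using G by blast
    have ev: "\<forall>\<^sub>F N in sequentially. \<bar>f N\<bar> \<le> \<epsilon>" if "f \<longlonglongrightarrow> 0" for f :: "nat \<Rightarrow> real"
    proof -
      have "\<forall>\<^sub>F N in sequentially. \<bar>f N\<bar> < \<epsilon>" using order_tendstoD(2)[OF tendsto_rabs[OF that]] \<epsilon> by simp
      then show ?thesis by eventually_elim simp
    qed
    show "\<forall>\<^sub>F N in sequentially. \<bar>\<integral>z. (rho (new\<Phi> N) z - rho \<Phi> z) * g z \<partial>?M\<bar> \<le> \<epsilon> \<and>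
       (\<forall>k\<in>{1,-1}. \<bar>\<integral>z. (sig k (new\<Phi> N) z - sig k \<Phi> z) * g z \<partial>?M\<bar> \<le> \<epsilon>)"
      using ev[OF increment_weak_limits(1)[OF g]] ev[OF increment_weak_limits(2)[OF g]] ev[OF increment_weak_limits(3)[OF g]]
    proof eventually_elim
      case (elim N)
      then show ?case using \<kappa> by auto
    qed
  qed
  moreover have "\<forall>\<^sub>F N in sequentially. \<forall>z\<in>cell T. \<bar>pd e2 (new\<Phi> N) z - pd e2 \<Phi> z\<bar> \<le> \<epsilon>"
    using first_derivative(1)[where c=e2] \<epsilon> unfolding vanishing_def by blast
  ultimately have "\<forall>\<^sub>F N in sequentially. subsolution T b (new\<Phi> N) (new\<Theta> N) \<and>
     energy T b (new\<Phi> N) (new\<Theta> N) \<le> energy T b \<Phi> \<Theta> - 1/1024 * (\<integral>z. (A z)\<^sup>2 \<partial>?M) + \<epsilon> \<and>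
     (\<forall>g\<in>G. \<bar>\<integral>z. (rho (new\<Phi> N) z - rho \<Phi> z) * g z \<partial>?M\<bar> \<le> \<epsilon> \<and>
       (\<forall>k\<in>{1,-1}. \<bar>\<integral>z. (sig k (new\<Phi> N) z - sig k \<Phi> z) * g z \<partial>?M\<bar> \<le> \<epsilon>)) \<and>
     (\<forall>z\<in>cell T. \<bar>pd e2 (new\<Phi> N) z - pd e2 \<Phi> z\<bar> \<le> \<epsilon>)"
    by eventually_elim blast
  then obtain N where "subsolution T b (new\<Phi> N) (new\<Theta> N) \<and>
     energy T b (new\<Phi> N) (new\<Theta> N) \<le> energy T b \<Phi> \<Theta> - 1/1024 * (\<integral>z. (A z)\<^sup>2 \<partial>?M) + \<epsilon> \<and>
     (\<forall>g\<in>G. \<bar>\<integral>z. (rho (new\<Phi> N) z - rho \<Phi> z) * g z \<partial>?M\<bar> \<le> \<epsilon> \<and>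
       (\<forall>k\<in>{1,-1}. \<bar>\<integral>z. (sig k (new\<Phi> N) z - sig k \<Phi> z) * g z \<partial>?M\<bar> \<le> \<epsilon>)) \<and>
     (\<forall>z\<in>cell T. \<bar>pd e2 (new\<Phi> N) z - pd e2 \<Phi> z\<bar> \<le> \<epsilon>)"
    using eventually_happens'[OF sequentially_bot] by blast
  then show ?thesis unfolding A_def by blast
qed

definition total_gain :: "real \<Rightarrow> real \<Rightarrow> real spacetime_fun \<Rightarrow> real spacetime_fun \<Rightarrow> real" where
  "total_gain T b \<Phi> \<Theta> = (\<integral>z. (snd z / T * defect b 1 \<Phi> \<Theta> z)\<^sup>2 \<partial>spacetime_measure {0..T})
     + (\<integral>z. (snd z / T * defect b (-1) \<Phi> \<Theta> z)\<^sup>2 \<partial>spacetime_measure {0..T})"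

text \<open>Only the type \<open>\<kappa>\<close> with the larger gain is used; it yields at least half of the sum of both gains.\<close>

lemma greedy_step:
  assumes T: "T > 0" and sub: "subsolution T b \<Phi> \<Theta>" and \<epsilon>: "\<epsilon> > 0"
    and G: "finite G" "G \<subseteq> trig"
  shows "\<exists>\<Phi>' \<Theta>'. subsolution T b \<Phi>' \<Theta>' \<and>
     energy T b \<Phi>' \<Theta>' \<le> energy T b \<Phi> \<Theta> - 1/2048 * total_gain T b \<Phi> \<Theta> + \<epsilon> \<and>
     (\<forall>g\<in>G. \<bar>\<integral>z. (rho \<Phi>' z - rho \<Phi> z) * g z \<partial>spacetime_measure {0..T}\<bar> \<le> \<epsilon> \<and>
       (\<forall>k\<in>{1,-1}. \<bar>\<integral>z. (sig k \<Phi>' z - sig k \<Phi> z) * g z \<partial>spacetime_measure {0..T}\<bar> \<le> \<epsilon>)) \<and>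
     (\<forall>z\<in>cell T. \<bar>pd e2 \<Phi>' z - pd e2 \<Phi> z\<bar> \<le> \<epsilon>)"
proof -
  let ?g = "\<lambda>k. \<integral>z. (snd z / T * defect b k \<Phi> \<Theta> z)\<^sup>2 \<partial>spacetime_measure {0..T}"
  obtain \<kappa> :: int where \<kappa>: "\<kappa> = 1 \<or> \<kappa> = -1" "?g \<kappa> \<ge> 1/2 * total_gain T b \<Phi> \<Theta>"
  proof (cases "?g 1 \<ge> ?g (-1)")
    case True then show ?thesis by (intro that[of 1]) (auto simp: total_gain_def)
  next
    case False then show ?thesis by (intro that[of "-1"]) (auto simp: total_gain_def)
  qed
  have le: "energy T b \<Phi> \<Theta> - 1/1024 * ?g \<kappa> + \<epsilon> \<le> energy T b \<Phi> \<Theta> - 1/2048 * total_gain T b \<Phi> \<Theta> + \<epsilon>"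
    using \<kappa>(2) by linarith
  show ?thesis
    using perturbation_step[OF T sub \<kappa>(1) \<epsilon> G] order_trans[OF _ le] by meson
qed

lemma subsolution_trig: "subsolution T b \<Phi> \<Theta> \<Longrightarrow> \<Phi> \<in> trig" "subsolution T b \<Phi> \<Theta> \<Longrightarrow> \<Theta> \<in> trig"
  by (simp_all add: subsolution_def)

lemma subsolution_bounds:
  assumes sub: "subsolution T b \<Phi> \<Theta>" and z: "z \<in> cell T"
  shows "\<kappa> = 1 \<or> \<kappa> = -1 \<Longrightarrow> 0 < defect b \<kappa> \<Phi> \<Theta> z" "\<kappa> = 1 \<or> \<kappa> = -1 \<Longrightarrow> defect b \<kappa> \<Phi> \<Theta> z < 2"
    "\<kappa> = 1 \<or> \<kappa> = -1 \<Longrightarrow> \<bar>sig \<kappa> \<Phi> z\<bar> \<le> 3/2" "\<bar>rho \<Phi> z\<bar> \<le> 4"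
proof -
  have *: "0 < defect b \<kappa> \<Phi> \<Theta> z \<and> (sig \<kappa> \<Phi> z)\<^sup>2 + defect b \<kappa> \<Phi> \<Theta> z < 2" if "\<kappa> = 1 \<or> \<kappa> = -1" for \<kappa>
    using sub z that unfolding subsolution_def by blast
  then show "\<kappa> = 1 \<or> \<kappa> = -1 \<Longrightarrow> 0 < defect b \<kappa> \<Phi> \<Theta> z" for \<kappa> by blast
  show "defect b \<kappa> \<Phi> \<Theta> z < 2" if "\<kappa> = 1 \<or> \<kappa> = -1" for \<kappa>
    using *[OF that] zero_le_power2[of "sig \<kappa> \<Phi> z"] by linarith
  show s: "\<bar>sig \<kappa> \<Phi> z\<bar> \<le> 3/2" if "\<kappa> = 1 \<or> \<kappa> = -1" for \<kappa>
    using *[OF that] by (intro sig_bound) auto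
  have "\<bar>rho \<Phi> z - sig 1 \<Phi> z - sig (-1) \<Phi> z\<bar> < 1" using sub z unfolding subsolution_def by blast
  moreover have "\<bar>sig 1 \<Phi> z\<bar> \<le> 3/2" "\<bar>sig (-1) \<Phi> z\<bar> \<le> 3/2" by (rule s, simp)+
  ultimately show "\<bar>rho \<Phi> z\<bar> \<le> 4" by linarith
qed

lemma space_cell: "space (spacetime_measure {0..T}) = cell T"
  by (simp add: space_restrict_space)

section \<open>Convergence of the iteration\<close>

definition L1_Cauchy :: "'a measure \<Rightarrow> (nat \<Rightarrow> 'a \<Rightarrow> 'b::{banach, second_countable_topology}) \<Rightarrow> bool" where
  "L1_Cauchy M f \<longleftrightarrow> (\<forall>e>0. \<exists>N. \<forall>i\<ge>N. \<forall>j\<ge>N. (\<integral>z. norm (f i z - f j z) \<partial>M) < e)"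

text \<open>Young's inequality \<open>2 \<eta> \<bar>g\<bar> \<le> g\<^sup>2 + \<eta>\<^sup>2\<close>.\<close>

lemma L1_le_L2:
  assumes g: "g \<in> trig" and \<eta>: "\<eta> > 0"
  shows "(\<integral>z. \<bar>g z\<bar> \<partial>spacetime_measure {0..T}) \<le> 1 / (2 * \<eta>) * (\<integral>z. (g z)\<^sup>2 \<partial>spacetime_measure {0..T})
    + \<eta> / 2 * measure (spacetime_measure {0..T}) (cell T)"
proof -
  let ?M = "spacetime_measure {0..T}"
  have ci: "integrable ?M (\<lambda>z. c)" for c :: real by (rule finite_measure.integrable_const[OF measure_finite])
  have i2: "integrable ?M (\<lambda>z. (g z)\<^sup>2)"
    unfolding power2_eq_square by (intro trig_integrable trig_mult g)
  have "(\<integral>z. \<bar>g z\<bar> \<partial>?M) \<le> (\<integral>z. 1 / (2 * \<eta>) * (g z)\<^sup>2 + \<eta> / 2 \<partial>?M)"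
  proof (rule integral_mono)
    show "integrable ?M (\<lambda>z. \<bar>g z\<bar>)" by (intro integrable_abs trig_integrable g)
    show "integrable ?M (\<lambda>z. 1 / (2 * \<eta>) * (g z)\<^sup>2 + \<eta> / 2)" using i2 ci by simp
    fix z
    have "0 \<le> (\<bar>g z\<bar> - \<eta>)\<^sup>2" by simp
    then have "2 * \<eta> * \<bar>g z\<bar> \<le> (g z)\<^sup>2 + \<eta> * \<eta>"
      by (simp add: power2_diff power2_eq_square algebra_simps)
    then show "\<bar>g z\<bar> \<le> 1 / (2 * \<eta>) * (g z)\<^sup>2 + \<eta> / 2"
      using \<eta> by (simp add: field_simps)
  qed
  also have "\<dots> = 1 / (2 * \<eta>) * (\<integral>z. (g z)\<^sup>2 \<partial>?M) + \<eta> / 2 * measure ?M (cell T)"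
    using i2 ci by (simp add: space_cell)
  finally show ?thesis .
qed

text \<open>Since every increment is almost orthogonal to all earlier members, the squared norms increase up to a summable error. They
  are bounded, hence converge, and the squared distance of two members is, again by
  orthogonality, nearly the difference of their squared norms.\<close>

lemma L2_increments_Cauchy:
  fixes f :: "nat \<Rightarrow> real spacetime_fun"
  assumes f: "\<And>n. f n \<in> trig" and B: "\<And>n z. z \<in> cell T \<Longrightarrow> \<bar>f n z\<bar> \<le> B"
    and orth: "\<And>n k. k \<le> n \<Longrightarrow> \<bar>\<integral>z. (f (Suc n) z - f n z) * f k z \<partial>spacetime_measure {0..T}\<bar> \<le> (1/2)^n"
  shows "L1_Cauchy (spacetime_measure {0..T}) f"
proof -
  let ?M = "spacetime_measure {0..T}"
  define V where "V = measure ?M (space ?M)"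
  have V: "V \<ge> 0" by (simp add: V_def)
  have ci: "integrable ?M (\<lambda>z. c)" for c :: real by (rule finite_measure.integrable_const[OF measure_finite])
  define ip where "ip g h = (\<integral>z. g z * h z \<partial>?M)" for g h :: "real spacetime_fun"
  define S where "S n = ip (f n) (f n)" for n
  have ti: "integrable ?M (\<lambda>z. f i z * f j z)" for i j by (intro trig_integrable trig_mult f)
  have sq: "(\<integral>z. (f i z - f j z)\<^sup>2 \<partial>?M) = S i - S j - 2 * (\<integral>z. (f i z - f j z) * f j z \<partial>?M)" for i j
  proof -
    have "(\<integral>z. (f i z - f j z)\<^sup>2 \<partial>?M) = (\<integral>z. f i z * f i z - f j z * f j z - 2 * (f i z * f j z - f j z * f j z) \<partial>?M)"
      by (rule Bochner_Integration.integral_cong) (auto simp: power2_eq_square algebra_simps)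
    also have "\<dots> = S i - S j - 2 * ((\<integral>z. f i z * f j z - f j z * f j z \<partial>?M))"
      unfolding S_def ip_def using ti by simp
    finally show ?thesis by (simp add: algebra_simps)
  qed
  have tel: "\<bar>\<integral>z. (f (k + d) z - f k z) * f k z \<partial>?M\<bar> \<le> 2 * (1/2)^k - 2 * (1/2)^(k + d)" for k d
  proof (induction d)
    case (Suc d)
    have "(\<integral>z. (f (k + Suc d) z - f k z) * f k z \<partial>?M) = 
       (\<integral>z. (f (Suc (k + d)) z - f (k + d) z) * f k z \<partial>?M) + (\<integral>z. (f (k + d) z - f k z) * f k z \<partial>?M)"
      by (subst Bochner_Integration.integral_add[symmetric])
         (auto intro!: trig_integrable trig_mult trig_diff f Bochner_Integration.integral_cong simp: algebra_simps)
    then show ?case using Suc orth[of k "k + d"] by simp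
  qed simp
  have tel': "\<bar>\<integral>z. (f l z - f k z) * f k z \<partial>?M\<bar> \<le> 2 * (1/2)^k" if "k \<le> l" for k l
  proof -
    have "\<bar>\<integral>z. (f l z - f k z) * f k z \<partial>?M\<bar> \<le> 2 * (1/2)^k - 2 * (1/2)^l"
      using tel[of k "l - k"] that by simp
    moreover have "0 \<le> (1/2::real)^l" by simp
    ultimately show ?thesis by linarith
  qed
  \<comment> \<open>the correction grows by \<open>2 (1/2)\<^sup>n\<close> in step \<open>n\<close> and so absorbs the orthogonality error\<close>
  have mono: "incseq (\<lambda>n. S n - 4 * (1/2)^n)"
  proof (rule incseq_SucI)
    fix n
    have "0 \<le> (\<integral>z. (f (Suc n) z - f n z)\<^sup>2 \<partial>?M)" by (rule integral_nonneg_AE) auto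
    then show "S n - 4 * (1/2)^n \<le> S (Suc n) - 4 * (1/2)^Suc n"
      using orth[of n n] unfolding sq by (simp add: abs_le_iff)
  qed
  have SB: "S n \<le> B\<^sup>2 * V" for n
  proof -
    have "S n \<le> (\<integral>z. B\<^sup>2 \<partial>?M)"
      unfolding S_def ip_def
    proof (rule integral_mono[OF ti ci])
      fix z assume "z \<in> space ?M"
      then have "\<bar>f n z\<bar> \<le> \<bar>B\<bar>" using B[of z n] by (simp add: space_cell)
      then show "f n z * f n z \<le> B\<^sup>2" using abs_le_square_iff[of "f n z" B] by (simp add: power2_eq_square)
    qed
    then show ?thesis by (simp add: V_def mult.commute)
  qed
  have "S n - 4 * (1/2)^n \<le> B\<^sup>2 * V" for n
    using SB[of n] zero_le_power[of "1/2::real" n] by linarith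
  then obtain L where L: "(\<lambda>n. S n - 4 * (1/2)^n) \<longlonglongrightarrow> L"
    using incseq_convergent[OF mono] by blast
  have h0: "(\<lambda>n. 4 * (1/2)^n) \<longlonglongrightarrow> (0::real)"
    using tendsto_mult[OF tendsto_const[of 4] LIMSEQ_realpow_zero[of "1/2::real"]] by simp
  have "(\<lambda>n. S n) \<longlonglongrightarrow> L" using tendsto_add[OF L h0] by simp
  then have SC: "Cauchy S" by (simp add: LIMSEQ_imp_Cauchy)
  show ?thesis
    unfolding L1_Cauchy_def
  proof (intro allI impI)
    fix e :: real assume e: "e > 0"
    \<comment> \<open>the weight in Young's inequality that leaves at most \<open>e / 2\<close> for the constant term\<close>
    define \<eta> where "\<eta> = e / (V + 1)"
    have \<eta>: "\<eta> > 0" using e V by (simp add: \<eta>_def)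
    have eta: "\<eta> * V < e" using e V by (simp add: \<eta>_def field_simps)
    have "e * \<eta> / 2 > 0" using e \<eta> by simp
    then obtain N1 where N1: "\<And>i j. i \<ge> N1 \<Longrightarrow> j \<ge> N1 \<Longrightarrow> \<bar>S i - S j\<bar> < e * \<eta> / 2"
      using metric_CauchyD[OF SC] unfolding dist_real_def by metis
    obtain N2 where N2: "\<And>n. n \<ge> N2 \<Longrightarrow> 4 * (1/2)^n < e * \<eta> / 2"
      using order_tendstoD(2)[OF h0 \<open>e * \<eta> / 2 > 0\<close>] unfolding eventually_sequentially by blast
    have main: "(\<integral>z. \<bar>f l z - f k z\<bar> \<partial>?M) < e" if kl: "k \<le> l" and k: "max N1 N2 \<le> k" for k l
    proof -
      have sq2: "(\<integral>z. (f l z - f k z)\<^sup>2 \<partial>?M) < e * \<eta>"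
      proof -
        have "\<bar>S l - S k\<bar> < e * \<eta> / 2" "4 * (1/2)^k < e * \<eta> / 2" using N1[of l k] N2[of k] kl k by auto
        then show ?thesis using tel'[OF kl] unfolding sq by linarith
      qed
      have "(\<integral>z. \<bar>f l z - f k z\<bar> \<partial>?M) \<le> 1 / (2 * \<eta>) * (\<integral>z. (f l z - f k z)\<^sup>2 \<partial>?M) + \<eta> / 2 * V"
        using L1_le_L2[OF trig_diff[OF f f] \<eta>] by (simp add: V_def space_cell)
      also have "\<dots> < 1 / (2 * \<eta>) * (e * \<eta>) + \<eta> / 2 * V"
        using sq2 \<eta> by (intro add_strict_right_mono mult_strict_left_mono) auto
      also have "\<dots> \<le> e" using eta \<eta> by simp
      finally show ?thesis .
    qed
    show "\<exists>N. \<forall>i\<ge>N. \<forall>j\<ge>N. (\<integral>z. norm (f i z - f j z) \<partial>?M) < e"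
    proof (intro exI[of _ "max N1 N2"] allI impI)
      fix i j assume "max N1 N2 \<le> i" "max N1 N2 \<le> j"
      then show "(\<integral>z. norm (f i z - f j z) \<partial>?M) < e"
        using main[of i j] main[of j i] by (cases "i \<le> j") (simp_all add: abs_minus_commute)
    qed
  qed
qed

lemma integrable_Pair:
  fixes f :: "'a \<Rightarrow> 'b::euclidean_space" and g :: "'a \<Rightarrow> 'c::euclidean_space"
  assumes "integrable M f" "integrable M g"
  shows "integrable M (\<lambda>z. (f z, g z))"
proof -
  have "integrable M (\<lambda>z. (f z, 0::'c) + (0::'b, g z))"
    by (intro Bochner_Integration.integrable_add
        integrable_bounded_linear[OF bounded_linear_Pair[OF bounded_linear_zero bounded_linear_ident]]
        integrable_bounded_linear[OF bounded_linear_Pair[OF bounded_linear_ident bounded_linear_zero]] assms)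
  then show ?thesis by simp
qed

lemma L1_Cauchy_Pair:
  fixes f :: "nat \<Rightarrow> 'a \<Rightarrow> 'b::euclidean_space" and g :: "nat \<Rightarrow> 'a \<Rightarrow> 'c::euclidean_space"
  assumes i: "\<And>n. integrable M (f n)" "\<And>n. integrable M (g n)"
    and f: "L1_Cauchy M f" and g: "L1_Cauchy M g"
  shows "L1_Cauchy M (\<lambda>n z. (f n z, g n z))"
  unfolding L1_Cauchy_def
proof (intro allI impI)
  fix e :: real assume e: "e > 0"
  obtain N1 where N1: "\<And>i j. i \<ge> N1 \<Longrightarrow> j \<ge> N1 \<Longrightarrow> (\<integral>z. norm (f i z - f j z) \<partial>M) < e / 2"
    using f e unfolding L1_Cauchy_def by (meson half_gt_zero)
  obtain N2 where N2: "\<And>i j. i \<ge> N2 \<Longrightarrow> j \<ge> N2 \<Longrightarrow> (\<integral>z. norm (g i z - g j z) \<partial>M) < e / 2"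
    using g e unfolding L1_Cauchy_def by (meson half_gt_zero)
  show "\<exists>N. \<forall>i\<ge>N. \<forall>j\<ge>N. (\<integral>z. norm ((f i z, g i z) - (f j z, g j z)) \<partial>M) < e"
  proof (intro exI[of _ "max N1 N2"] allI impI)
    fix i j assume ij: "max N1 N2 \<le> i" "max N1 N2 \<le> j"
    have "(\<integral>z. norm ((f i z, g i z) - (f j z, g j z)) \<partial>M) \<le> (\<integral>z. norm (f i z - f j z) + norm (g i z - g j z) \<partial>M)"
    proof (rule integral_mono)
      show "integrable M (\<lambda>z. norm ((f i z, g i z) - (f j z, g j z)))"
        by (intro integrable_norm Bochner_Integration.integrable_diff integrable_Pair i)
      show "integrable M (\<lambda>z. norm (f i z - f j z) + norm (g i z - g j z))"
        by (intro Bochner_Integration.integrable_add integrable_norm Bochner_Integration.integrable_diff i)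
      show "norm ((f i z, g i z) - (f j z, g j z)) \<le> norm (f i z - f j z) + norm (g i z - g j z)" for z
        using norm_Pair_le[of "f i z - f j z" "g i z - g j z"] by simp
    qed
    also have "\<dots> = (\<integral>z. norm (f i z - f j z) \<partial>M) + (\<integral>z. norm (g i z - g j z) \<partial>M)"
      by (intro Bochner_Integration.integral_add integrable_norm Bochner_Integration.integrable_diff i)
    also have "\<dots> < e" using N1[of i j] N2[of i j] ij by simp
    finally show "(\<integral>z. norm ((f i z, g i z) - (f j z, g j z)) \<partial>M) < e" .
  qed
qed

lemma AE_time_positive:
  "AE z in spacetime_measure {0..T}. snd z > 0"
proof -
  have "negligible {z :: (real^2) \<times> real. z \<bullet> (0, 1) = 0}"
    by (rule negligible_standard_hyperplane) (auto simp: Basis_prod_def)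
  then have "AE z in (lebesgue :: ((real^2) \<times> real) measure). \<not> z \<bullet> (0, 1) = 0"
    by (simp add: negligible_iff_null_sets AE_iff_null_sets)
  then have "AE z in lebesgue. z \<in> cell T \<longrightarrow> snd z > 0"
    by (rule AE_mp) (auto simp: inner_prod_def intro!: AE_I2)
  then show ?thesis
    by (subst AE_restrict_space_iff) (use cell_sets in auto)
qed

text \<open>Besides the potentials, the recursion carries a finite set \<open>G\<close> that collects the states reached so far; the increments are
  made almost orthogonal to its members.\<close>

lemma convex_integration_sequence:
  assumes T: "T > 0" and b: "0 < b" "b < 1"
  obtains \<Phi> \<Theta> where "\<And>n. subsolution T b (\<Phi> n) (\<Theta> n)"
    "\<And>n. energy T b (\<Phi> (Suc n)) (\<Theta> (Suc n)) \<le> energy T b (\<Phi> n) (\<Theta> n) - 1/2048 * total_gain T b (\<Phi> n) (\<Theta> n) + (1/2)^n"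
    "\<And>n k. k \<le> n \<Longrightarrow> \<bar>\<integral>z. (rho (\<Phi> (Suc n)) z - rho (\<Phi> n) z) * rho (\<Phi> k) z \<partial>spacetime_measure {0..T}\<bar> \<le> (1/2)^n"
    "\<And>n k \<kappa>. k \<le> n \<Longrightarrow> \<kappa> \<in> {1, -1} \<Longrightarrow> \<bar>\<integral>z. (sig \<kappa> (\<Phi> (Suc n)) z - sig \<kappa> (\<Phi> n) z) * sig \<kappa> (\<Phi> k) z \<partial>spacetime_measure {0..T}\<bar> \<le> (1/2)^n"
    "\<And>n z. z \<in> cell T \<Longrightarrow> \<bar>pd e2 (\<Phi> (Suc n)) z - pd e2 (\<Phi> n) z\<bar> \<le> (1/2)^n"
proof -
  let ?M = "spacetime_measure {0..T}"
  define I where "I n x \<longleftrightarrow> (case x of (\<Phi>, \<Theta>, G) \<Rightarrow> subsolution T b \<Phi> \<Theta> \<and> finite G \<and> G \<subseteq> trig \<and>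
     rho \<Phi> \<in> G \<and> sig 1 \<Phi> \<in> G \<and> sig (-1) \<Phi> \<in> G)" for n :: nat and x
  define J where "J n x x' \<longleftrightarrow> (case x of (\<Phi>, \<Theta>, G) \<Rightarrow> case x' of (\<Phi>', \<Theta>', G') \<Rightarrow> G \<subseteq> G' \<and>
     energy T b \<Phi>' \<Theta>' \<le> energy T b \<Phi> \<Theta> - 1/2048 * total_gain T b \<Phi> \<Theta> + (1/2)^n \<and>
     (\<forall>g\<in>G. \<bar>\<integral>z. (rho \<Phi>' z - rho \<Phi> z) * g z \<partial>?M\<bar> \<le> (1/2)^n \<and>
       (\<forall>k\<in>{1,-1}. \<bar>\<integral>z. (sig k \<Phi>' z - sig k \<Phi> z) * g z \<partial>?M\<bar> \<le> (1/2)^n)) \<and>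
     (\<forall>z\<in>cell T. \<bar>pd e2 \<Phi>' z - pd e2 \<Phi> z\<bar> \<le> (1/2)^n))" for n :: nat and x x'
  define o0 :: "real spacetime_fun" where "o0 = (\<lambda>z. 0)"
  have o0: "o0 \<in> trig" "pd c o0 = o0" for c unfolding o0_def by (rule trig_const, rule pd_const)
  have z0: "rho o0 = o0" "sig k o0 = o0" "mu b k o0 o0 = (\<lambda>z. b)" "defect b k o0 o0 = (\<lambda>z. b)" for k
    unfolding rho_def sig_def mu_def defect_def o0(2) by (simp_all add: o0_def)
  have "subsolution T b o0 o0"
    unfolding subsolution_def z0 using b o0(1) by (simp add: o0_def)
  then have start: "\<exists>x. I 0 x"
    by (intro exI[of _ "(o0, o0, {o0})"]) (simp add: I_def z0 o0)
  have step: "\<exists>x'. I (Suc n) x' \<and> J n x x'" if x: "I n x" for n x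
  proof -
    obtain \<Phi> \<Theta> G where xe: "x = (\<Phi>, \<Theta>, G)" by (cases x)
    have h: "subsolution T b \<Phi> \<Theta>" "finite G" "G \<subseteq> trig" using x by (auto simp: I_def xe)
    obtain \<Phi>' \<Theta>' where n: "subsolution T b \<Phi>' \<Theta>' \<and>
     energy T b \<Phi>' \<Theta>' \<le> energy T b \<Phi> \<Theta> - 1/2048 * total_gain T b \<Phi> \<Theta> + (1/2)^n \<and>
     (\<forall>g\<in>G. \<bar>\<integral>z. (rho \<Phi>' z - rho \<Phi> z) * g z \<partial>?M\<bar> \<le> (1/2)^n \<and>
       (\<forall>k\<in>{1,-1}. \<bar>\<integral>z. (sig k \<Phi>' z - sig k \<Phi> z) * g z \<partial>?M\<bar> \<le> (1/2)^n)) \<and>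
     (\<forall>z\<in>cell T. \<bar>pd e2 \<Phi>' z - pd e2 \<Phi> z\<bar> \<le> (1/2)^n)"
      using greedy_step[OF T h(1) _ h(2,3), of "(1/2)^n"] by fastforce
    have "\<Phi>' \<in> trig" using n by (simp add: subsolution_def)
    then have "I (Suc n) (\<Phi>', \<Theta>', G \<union> {rho \<Phi>', sig 1 \<Phi>', sig (-1) \<Phi>'})"
      using n h by (simp add: I_def rho_trig sig_trig)
    moreover have "J n x (\<Phi>', \<Theta>', G \<union> {rho \<Phi>', sig 1 \<Phi>', sig (-1) \<Phi>'})"
      unfolding J_def xe split using n by (intro conjI) blast+
    ultimately show ?thesis by blast
  qed
  obtain X where X: "\<And>n. I n (X n)" "\<And>n. J n (X n) (X (Suc n))"
    using dependent_nat_choice[of I J, OF start step] by blast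
  define \<Phi> \<Theta> G where "\<Phi> n = fst (X n)" and "\<Theta> n = fst (snd (X n))" and "G n = snd (snd (X n))" for n
  have XX: "X n = (\<Phi> n, \<Theta> n, G n)" for n by (simp add: \<Phi>_def \<Theta>_def G_def)
  note In = X(1)[unfolded XX I_def split] and Jn = X(2)[unfolded XX J_def split]
  have G: "G k \<subseteq> G n" if "k \<le> n" for k n
    using that by (rule lift_Suc_mono_le[of G, rotated]) (use Jn in blast)
  show thesis
  proof (rule that[of \<Phi> \<Theta>])
    show "subsolution T b (\<Phi> n) (\<Theta> n)" for n using In[of n] by blast
    show "energy T b (\<Phi> (Suc n)) (\<Theta> (Suc n)) \<le> energy T b (\<Phi> n) (\<Theta> n) - 1/2048 * total_gain T b (\<Phi> n) (\<Theta> n) + (1/2)^n" for n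
      using Jn[of n] by blast
    show "\<bar>pd e2 (\<Phi> (Suc n)) z - pd e2 (\<Phi> n) z\<bar> \<le> (1/2)^n" if "z \<in> cell T" for n z
      using Jn[of n] that by blast
    fix n k :: nat assume "k \<le> n"
    then have "rho (\<Phi> k) \<in> G n" "sig 1 (\<Phi> k) \<in> G n" "sig (-1) (\<Phi> k) \<in> G n"
      using G[of k n] In[of k] by blast+
    then show "\<bar>\<integral>z. (rho (\<Phi> (Suc n)) z - rho (\<Phi> n) z) * rho (\<Phi> k) z \<partial>?M\<bar> \<le> (1/2)^n"
      "\<kappa> \<in> {1, -1} \<Longrightarrow> \<bar>\<integral>z. (sig \<kappa> (\<Phi> (Suc n)) z - sig \<kappa> (\<Phi> n) z) * sig \<kappa> (\<Phi> k) z \<partial>?M\<bar> \<le> (1/2)^n" for \<kappa>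
      using Jn[of n] by blast+
  qed
qed

text \<open>The energy stays nonnegative and loses a fixed fraction of the gain in every step, up to a summable error, so the gains are summable.\<close>

lemma total_gain_tendsto_0:
  assumes sub: "\<And>n. subsolution T b (\<Phi> n) (\<Theta> n)"
    and dec: "\<And>n. energy T b (\<Phi> (Suc n)) (\<Theta> (Suc n)) \<le> energy T b (\<Phi> n) (\<Theta> n) - 1/2048 * total_gain T b (\<Phi> n) (\<Theta> n) + (1/2)^n"
  shows "(\<lambda>n. total_gain T b (\<Phi> n) (\<Theta> n)) \<longlonglongrightarrow> 0"
proof -
  let ?E = "\<lambda>n. energy T b (\<Phi> n) (\<Theta> n)" and ?g = "\<lambda>n. total_gain T b (\<Phi> n) (\<Theta> n)"
  have E0: "?E n \<ge> 0" for n
    unfolding energy_def using sub[of n]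
    by (intro integral_nonneg_AE AE_I2 add_nonneg_nonneg less_imp_le subsolution_bounds) (auto simp: space_cell)
  have g0: "?g n \<ge> 0" for n
    unfolding total_gain_def by (intro add_nonneg_nonneg integral_nonneg_AE) auto
  have "(\<Sum>i<n. ?g i) \<le> 2048 * (?E 0 + 2 - ?E n - 2 * (1/2)^n)" for n
  proof (induction n)
    case (Suc n)
    then show ?case using dec[of n] by (simp add: field_simps)
  qed simp
  moreover have "2048 * (?E 0 + 2 - ?E n - 2 * (1/2)^n) \<le> 2048 * (?E 0 + 2)" for n
    using E0[of n] zero_le_power[of "1/2::real" n] by (simp only: mult_le_cancel_left) linarith
  ultimately have "(\<Sum>i<n. ?g i) \<le> 2048 * (?E 0 + 2)" for n by (meson order_trans)
  then have "summable ?g" by (intro summableI_nonneg_bounded g0)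
  then show ?thesis by (rule summable_LIMSEQ_zero)
qed

section \<open>The limit is a weak solution\<close>

lemma test_function_C1:
  assumes "test_function J \<phi>"
  shows "C1 \<phi>" "torus_periodic \<phi>"
proof -
  have "C_k (Suc 0) \<phi>" "torus_periodic \<phi>" using assms by (auto simp: test_function_def C_infinity_def)
  then show "C1 \<phi>" "torus_periodic \<phi>" unfolding C1_def pd_def by simp_all
qed

lemma test_function_zero:
  assumes "test_function J \<phi>" "0 \<le> t" "t \<notin> J"
  shows "\<phi> (x, t) = 0"
  using assms unfolding test_function_def by blast

lemma time_deriv_pd: "time_deriv \<phi> = pd et \<phi>"
  by (simp add: fun_eq_iff time_deriv_def pd_def)

lemma space_grad_pd: "space_grad \<phi> z $ i = pd (axis i 1, 0) \<phi> z"
  by (simp add: space_grad_def pd_def)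

lemma periodic_mult: "torus_periodic f \<Longrightarrow> torus_periodic g \<Longrightarrow> torus_periodic (\<lambda>z. f z * g z :: real)"
  by (simp add: torus_periodic_def)

lemma integral_by_parts:
  assumes f: "C1 f" "torus_periodic f" and g: "C1 g" "torus_periodic g"
  shows "(\<integral>z. f z * pd (axis i 1, 0) g z \<partial>spacetime_measure {0..T}) =
    - (\<integral>z. pd (axis i 1, 0) f z * g z \<partial>spacetime_measure {0..T})"
proof -
  have i: "integrable (spacetime_measure {0..T}) (\<lambda>z. f z * pd (axis i 1, 0) g z)"
    "integrable (spacetime_measure {0..T}) (\<lambda>z. pd (axis i 1, 0) f z * g z)"
    by (intro cont_integrable continuous_intros C1_continuous C1_continuous_pd f g)+
  show ?thesis
    using integral_pd_space[OF C1_mult[OF f(1) g(1)] periodic_mult[OF f(2) g(2)], where i=i and T=T]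
    unfolding pd_mult[OF f(1) g(1)] Bochner_Integration.integral_add[OF i] by simp
qed

lemma integral_by_parts_time:
  assumes f: "C1 f" "\<And>x. f (x, 0) = 0" and g: "C1 g" "\<And>x. g (x, T) = 0" and T: "T \<ge> 0"
  shows "(\<integral>z. f z * pd et g z \<partial>spacetime_measure {0..T}) =
    - (\<integral>z. pd et f z * g z \<partial>spacetime_measure {0..T})"
proof -
  have i: "integrable (spacetime_measure {0..T}) (\<lambda>z. f z * pd et g z)"
    "integrable (spacetime_measure {0..T}) (\<lambda>z. pd et f z * g z)"
    by (intro cont_integrable continuous_intros C1_continuous C1_continuous_pd f g)+
  show ?thesis
    using integral_pd_time[OF C1_mult[OF f(1) g(1)] T] f(2) g(2)
    unfolding pd_mult[OF f(1) g(1)] Bochner_Integration.integral_add[OF i] by simp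
qed

lemma pd_space_zero_trace:
  assumes "C1 f" "\<And>x. f (x, 0) = 0"
  shows "pd (u, 0) f (x, 0) = 0"
proof -
  have "((\<lambda>h. f ((x, 0) + h *\<^sub>R (u, 0))) has_derivative (\<lambda>h. pd (h *\<^sub>R (u, 0)) f ((x, 0) + 0 *\<^sub>R (u, 0)))) (at 0)"
    by (rule has_derivative_compose[OF _ C1_has_derivative[OF assms(1)]]) (auto intro!: derivative_eq_intros)
  moreover have "((\<lambda>h. f ((x, 0) + h *\<^sub>R (u, 0))) has_derivative (\<lambda>h. 0)) (at 0)"
    using assms(2) by simp
  ultimately have "(\<lambda>h. pd (h *\<^sub>R (u, 0)) f ((x, 0) + 0 *\<^sub>R (u, 0))) = (\<lambda>h. 0)"
    by (rule has_derivative_unique)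
  from fun_cong[OF this, of 1] show ?thesis by simp
qed

lemma rho_initial:
  assumes "\<Phi> \<in> trig" "\<And>x. \<Phi> (x, 0) = 0"
  shows "rho \<Phi> (x, 0) = 0"
  using assms by (simp add: rho_def pd_space_zero_trace trig_C1 trig_pd)

text \<open>The expression is the weak form of \<open>\<partial>\<^sub>t \<rho> + div m = 0\<close>, where \<open>m\<^sub>1\<close> and \<open>m\<^sub>2\<close> are half the difference and minus half the
  sum of \<open>mu b 1\<close> and \<open>mu b (- 1)\<close>. The potentials make the pointwise divergence vanish.\<close>

lemma transport_identity:
  assumes \<Phi>: "\<Phi> \<in> trig" "\<And>x. \<Phi> (x, 0) = 0" and \<Theta>: "\<Theta> \<in> trig" and T: "T \<ge> 0"
    and \<phi>: "C1 \<phi>" "torus_periodic \<phi>" "\<And>x. \<phi> (x, T) = 0"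
  shows "(\<integral>z. rho \<Phi> z * pd et \<phi> z \<partial>spacetime_measure {0..T})
    + 1/2 * ((\<integral>z. mu b 1 \<Phi> \<Theta> z * pd e1 \<phi> z \<partial>spacetime_measure {0..T}) - (\<integral>z. mu b (-1) \<Phi> \<Theta> z * pd e1 \<phi> z \<partial>spacetime_measure {0..T}))
    - 1/2 * ((\<integral>z. mu b 1 \<Phi> \<Theta> z * pd e2 \<phi> z \<partial>spacetime_measure {0..T}) + (\<integral>z. mu b (-1) \<Phi> \<Theta> z * pd e2 \<phi> z \<partial>spacetime_measure {0..T})) = 0"
proof -
  let ?M = "spacetime_measure {0..T}"
  note C = trig_C1[OF mu_trig[OF \<Phi>(1) \<Theta>, of b]] trig_periodic[OF mu_trig[OF \<Phi>(1) \<Theta>, of b]]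
  note R = trig_C1[OF rho_trig[OF \<Phi>(1)]]
  have i: "integrable ?M (\<lambda>z. pd c f z * \<phi> z)" if "f \<in> trig" for c f
    by (intro cont_integrable continuous_intros C1_continuous C1_continuous_pd trig_C1 that \<phi>)
  have "pd et (rho \<Phi>) z + 1/2 * (pd e1 (mu b 1 \<Phi> \<Theta>) z - pd e1 (mu b (-1) \<Phi> \<Theta>) z)
    - 1/2 * (pd e2 (mu b 1 \<Phi> \<Theta>) z + pd e2 (mu b (-1) \<Phi> \<Theta>) z) = 0" for z
  proof -
    have c: "pd et (pd e1 (pd e1 \<Phi>)) = pd e1 (pd e1 (pd et \<Phi>))" "pd et (pd e2 (pd e2 \<Phi>)) = pd e2 (pd e2 (pd et \<Phi>))"
      using pd_commute[OF trig_pd[OF \<Phi>(1)], of et] pd_commute[OF \<Phi>(1), of et] by metis+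
    have C: "C1 (pd c (pd d \<Phi>))" "C1 (pd c \<Theta>)" for c d
      by (intro trig_C1 trig_pd \<Phi> \<Theta>)+
    have r: "pd et (rho \<Phi>) z = - pd e1 (pd e1 (pd et \<Phi>)) z - pd e2 (pd e2 (pd et \<Phi>)) z"
      unfolding rho_def pd_diff[OF C1_minus[OF C(1)] C(1)] pd_minus[OF C(1)] c ..
    have m: "pd c (mu b \<kappa> \<Phi> \<Theta>) z = of_int \<kappa> * pd c (pd e1 (pd et \<Phi>)) z - pd c (pd e2 (pd et \<Phi>)) z
       - pd c (pd e1 \<Theta>) z - of_int \<kappa> * pd c (pd e2 \<Theta>) z" for c \<kappa>
      unfolding mu_def
      by (simp add: pd_add pd_diff pd_scale pd_const C C1_const C1_add C1_diff C1_mult)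
    show ?thesis unfolding r m using pd_commute[OF \<Theta>, of e1 e2] pd_commute[OF trig_pd[OF \<Phi>(1), of et], of e1 e2]
      by (simp add: field_simps)
  qed
  note div = this
  have t: "rho \<Phi> \<in> trig" "mu b \<kappa> \<Phi> \<Theta> \<in> trig" for \<kappa> by (intro rho_trig mu_trig \<Phi> \<Theta>)+
  have "0 = (\<integral>z. (pd et (rho \<Phi>) z + 1/2 * (pd e1 (mu b 1 \<Phi> \<Theta>) z - pd e1 (mu b (-1) \<Phi> \<Theta>) z)
    - 1/2 * (pd e2 (mu b 1 \<Phi> \<Theta>) z + pd e2 (mu b (-1) \<Phi> \<Theta>) z)) * \<phi> z \<partial>?M)"
    unfolding div by simp
  also have "\<dots> = (\<integral>z. pd et (rho \<Phi>) z * \<phi> z + 1/2 * (pd e1 (mu b 1 \<Phi> \<Theta>) z * \<phi> z - pd e1 (mu b (-1) \<Phi> \<Theta>) z * \<phi> z)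
    - 1/2 * (pd e2 (mu b 1 \<Phi> \<Theta>) z * \<phi> z + pd e2 (mu b (-1) \<Phi> \<Theta>) z * \<phi> z) \<partial>?M)"
    by (rule Bochner_Integration.integral_cong) (auto simp: algebra_simps)
  also have "\<dots> = (\<integral>z. pd et (rho \<Phi>) z * \<phi> z \<partial>?M)
    + 1/2 * ((\<integral>z. pd e1 (mu b 1 \<Phi> \<Theta>) z * \<phi> z \<partial>?M) - (\<integral>z. pd e1 (mu b (-1) \<Phi> \<Theta>) z * \<phi> z \<partial>?M))
    - 1/2 * ((\<integral>z. pd e2 (mu b 1 \<Phi> \<Theta>) z * \<phi> z \<partial>?M) + (\<integral>z. pd e2 (mu b (-1) \<Phi> \<Theta>) z * \<phi> z \<partial>?M))"
    using i t by simp
  finally have 0: "0 = (\<integral>z. pd et (rho \<Phi>) z * \<phi> z \<partial>?M)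
    + 1/2 * ((\<integral>z. pd e1 (mu b 1 \<Phi> \<Theta>) z * \<phi> z \<partial>?M) - (\<integral>z. pd e1 (mu b (-1) \<Phi> \<Theta>) z * \<phi> z \<partial>?M))
    - 1/2 * ((\<integral>z. pd e2 (mu b 1 \<Phi> \<Theta>) z * \<phi> z \<partial>?M) + (\<integral>z. pd e2 (mu b (-1) \<Phi> \<Theta>) z * \<phi> z \<partial>?M))" .
  have neg: "0 = A + 1/2 * (B - C) - 1/2 * (D + E) \<Longrightarrow> - A + 1/2 * (- B - - C) - 1/2 * (- D + - E) = 0"
    for A B C D E :: real by (simp add: field_simps)
  show ?thesis
    unfolding integral_by_parts_time[OF R rho_initial[OF \<Phi>] \<phi>(1,3) T] integral_by_parts[OF C \<phi>(1,2)]
    by (rule neg[OF 0])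
qed

text \<open>The weak forms of \<open>div v = 0\<close> and of \<open>v + (0, \<rho>) = - grad p\<close> with the pressure \<open>p = pd e2 \<Phi>\<close>.\<close>

lemma velocity_identities:
  assumes \<Phi>: "\<Phi> \<in> trig" and \<phi>: "C1 \<phi>" "torus_periodic \<phi>"
  shows "1/2 * ((\<integral>z. sig 1 \<Phi> z * pd e1 \<phi> z \<partial>spacetime_measure {0..T}) - (\<integral>z. sig (-1) \<Phi> z * pd e1 \<phi> z \<partial>spacetime_measure {0..T}))
    - 1/2 * ((\<integral>z. sig 1 \<Phi> z * pd e2 \<phi> z \<partial>spacetime_measure {0..T}) + (\<integral>z. sig (-1) \<Phi> z * pd e2 \<phi> z \<partial>spacetime_measure {0..T})) = 0"
    (is ?div)
    "(\<integral>z. pd e2 \<Phi> z * pd e1 \<phi> z \<partial>spacetime_measure {0..T}) =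
     1/2 * ((\<integral>z. sig 1 \<Phi> z * \<phi> z \<partial>spacetime_measure {0..T}) - (\<integral>z. sig (-1) \<Phi> z * \<phi> z \<partial>spacetime_measure {0..T}))"
    (is ?p1)
    "(\<integral>z. pd e2 \<Phi> z * pd e2 \<phi> z \<partial>spacetime_measure {0..T}) =
     (\<integral>z. rho \<Phi> z * \<phi> z \<partial>spacetime_measure {0..T})
      - 1/2 * ((\<integral>z. sig 1 \<Phi> z * \<phi> z \<partial>spacetime_measure {0..T}) + (\<integral>z. sig (-1) \<Phi> z * \<phi> z \<partial>spacetime_measure {0..T}))"
    (is ?p2)
proof -
  let ?M = "spacetime_measure {0..T}"
  have i: "integrable ?M (\<lambda>z. f z * g z)" if "f \<in> trig" "continuous_on UNIV g" for f g
    by (intro cont_integrable continuous_intros trig_continuous that)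
  have c: "continuous_on UNIV \<phi>" "continuous_on UNIV (pd c \<phi>)" for c
    by (intro C1_continuous C1_continuous_pd \<phi>)+
  note S = sig_trig[OF \<Phi>, of 1] sig_trig[OF \<Phi>, of "-1"]
  have p: "C1 (pd c \<Phi>)" "torus_periodic (pd c \<Phi>)" for c
    by (intro trig_C1 trig_periodic trig_pd \<Phi>)+
  have d: "1/2 * ((\<integral>z. sig 1 \<Phi> z * g z \<partial>?M) - (\<integral>z. sig (-1) \<Phi> z * g z \<partial>?M)) = - (\<integral>z. pd e1 (pd e2 \<Phi>) z * g z \<partial>?M)"
    if g: "continuous_on UNIV g" for g
  proof -
    have "(\<integral>z. sig 1 \<Phi> z * g z \<partial>?M) - (\<integral>z. sig (-1) \<Phi> z * g z \<partial>?M) = (\<integral>z. sig 1 \<Phi> z * g z - sig (-1) \<Phi> z * g z \<partial>?M)"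
      using i[OF S(1) g] i[OF S(2) g] by simp
    also have "\<dots> = (\<integral>z. (-2) * (pd e1 (pd e2 \<Phi>) z * g z) \<partial>?M)"
      by (rule Bochner_Integration.integral_cong) (auto simp: sig_def algebra_simps)
    also have "\<dots> = (-2) * (\<integral>z. pd e1 (pd e2 \<Phi>) z * g z \<partial>?M)" by (rule integral_mult_right_zero)
    finally show ?thesis by simp
  qed
  have a: "1/2 * ((\<integral>z. sig 1 \<Phi> z * g z \<partial>?M) + (\<integral>z. sig (-1) \<Phi> z * g z \<partial>?M)) = - (\<integral>z. pd e1 (pd e1 \<Phi>) z * g z \<partial>?M)"
    if g: "continuous_on UNIV g" for g
  proof -
    have "(\<integral>z. sig 1 \<Phi> z * g z \<partial>?M) + (\<integral>z. sig (-1) \<Phi> z * g z \<partial>?M) = (\<integral>z. sig 1 \<Phi> z * g z + sig (-1) \<Phi> z * g z \<partial>?M)"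
      using i[OF S(1) g] i[OF S(2) g] by simp
    also have "\<dots> = (\<integral>z. (-2) * (pd e1 (pd e1 \<Phi>) z * g z) \<partial>?M)"
      by (rule Bochner_Integration.integral_cong) (auto simp: sig_def algebra_simps)
    also have "\<dots> = (-2) * (\<integral>z. pd e1 (pd e1 \<Phi>) z * g z \<partial>?M)" by (rule integral_mult_right_zero)
    finally show ?thesis by simp
  qed
  have r: "(\<integral>z. rho \<Phi> z * \<phi> z \<partial>?M) = - (\<integral>z. pd e1 (pd e1 \<Phi>) z * \<phi> z \<partial>?M) - (\<integral>z. pd e2 (pd e2 \<Phi>) z * \<phi> z \<partial>?M)"
  proof -
    have "(\<integral>z. rho \<Phi> z * \<phi> z \<partial>?M) = (\<integral>z. - (pd e1 (pd e1 \<Phi>) z * \<phi> z) - pd e2 (pd e2 \<Phi>) z * \<phi> z \<partial>?M)"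
      by (rule Bochner_Integration.integral_cong) (auto simp: rho_def algebra_simps)
    then show ?thesis using i[OF trig_pd[OF trig_pd[OF \<Phi>]] c(1)] by simp
  qed
  have pp: "C1 (pd c (pd d \<Phi>))" "torus_periodic (pd c (pd d \<Phi>))" for c d
    by (intro trig_C1 trig_periodic trig_pd \<Phi>)+
  have "pd e1 (pd e1 (pd e2 \<Phi>)) = pd e2 (pd e1 (pd e1 \<Phi>))"
    using pd_commute[OF trig_pd[OF \<Phi>, of e1], of e1 e2] pd_commute[OF \<Phi>, of e1 e2] by simp
  then show ?div unfolding d[OF c(2)] a[OF c(2)] integral_by_parts[OF pp \<phi>] by simp
  show ?p1 unfolding d[OF c(1)] by (rule integral_by_parts[OF p \<phi>])
  show ?p2 unfolding a[OF c(1)] r using integral_by_parts[OF p[of e2] \<phi>, where i=2 and T=T] by simp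
qed

text \<open>The conserved mean of the flux, which keeps the limit away from the trivial solution and distinguishes different \<open>b\<close>.\<close>

lemma mu_mean:
  assumes \<Phi>: "\<Phi> \<in> trig" and \<Theta>: "\<Theta> \<in> trig"
  shows "(\<integral>z. mu b \<kappa> \<Phi> \<Theta> z \<partial>spacetime_measure {0..T}) = b * measure (spacetime_measure {0..T}) (cell T)"
proof -
  let ?M = "spacetime_measure {0..T}"
  have 0: "(\<integral>z. pd (axis i 1, 0) f z \<partial>?M) = 0" if "f \<in> trig" for i f
    by (rule integral_pd_space[OF trig_C1[OF that] trig_periodic[OF that]])
  have i: "integrable ?M (pd c f)" if "f \<in> trig" for c f
    by (rule trig_integrable[OF trig_pd[OF that]])
  have "(\<integral>z. mu b \<kappa> \<Phi> \<Theta> z \<partial>?M) = (\<integral>z. b \<partial>?M) + of_int \<kappa> * (\<integral>z. pd e1 (pd et \<Phi>) z \<partial>?M) - (\<integral>z. pd e2 (pd et \<Phi>) z \<partial>?M)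
     - (\<integral>z. pd e1 \<Theta> z \<partial>?M) - of_int \<kappa> * (\<integral>z. pd e2 \<Theta> z \<partial>?M)"
    unfolding mu_def using i[OF trig_pd[OF \<Phi>]] i[OF \<Theta>] finite_measure.integrable_const[OF measure_finite[of 0 T], of b] by simp
  also have "\<dots> = (\<integral>z. b \<partial>?M)"
    unfolding 0[OF trig_pd[OF \<Phi>]] 0[OF \<Theta>] by simp
  also have "\<dots> = b * measure ?M (cell T)" by (simp add: space_cell)
  finally show ?thesis .
qed

lemma cell_measure_pos: "T > 0 \<Longrightarrow> measure (spacetime_measure {0..T}) (cell T) > 0"
proof -
  assume T: "T > 0"
  have "measure (spacetime_measure {0..T}) (cell T) = measure lebesgue (cell T)"
    using cell_sets by (simp add: measure_restrict_space)
  also have "\<dots> = measure lborel (cbox (0::real^2, 0::real) (1, T))" by (simp add: cell_cbox)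
  also have "\<dots> > 0"
    using T by (subst content_pos_lt_eq) (auto simp: Basis_prod_def Basis_vec_def inner_axis)
  finally show ?thesis .
qed

lemma trig_limit_integral:
  fixes H :: "real spacetime_fun"
  assumes h: "\<And>n. h n \<in> trig" "\<And>n z. z \<in> cell T \<Longrightarrow> \<bar>h n z\<bar> \<le> C"
    and lim: "AE z in spacetime_measure {0..T}. (\<lambda>n. h n z) \<longlonglongrightarrow> H z"
    and H: "H \<in> borel_measurable (spacetime_measure {0..T})" and g: "continuous_on UNIV g"
  shows "(\<lambda>n. \<integral>z. h n z * g z \<partial>spacetime_measure {0..T}) \<longlonglongrightarrow> (\<integral>z. H z * g z \<partial>spacetime_measure {0..T})"
    "integrable (spacetime_measure {0..T}) (\<lambda>z. H z * g z)"
proof -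
  let ?M = "spacetime_measure {0..T}"
  have gi: "integrable ?M g" by (rule cont_integrable[OF g])
  have m: "(\<lambda>z. H z * g z) \<in> borel_measurable ?M" "\<And>n. (\<lambda>z. h n z * g z) \<in> borel_measurable ?M"
    using H gi trig_integrable[OF h(1)] by (auto intro!: borel_measurable_times)
  have w: "integrable ?M (\<lambda>z. C * \<bar>g z\<bar>)" using gi by simp
  have l: "AE z in ?M. (\<lambda>n. h n z * g z) \<longlonglongrightarrow> H z * g z"
    using lim by eventually_elim (intro tendsto_intros)
  have bd: "AE z in ?M. norm (h n z * g z) \<le> C * \<bar>g z\<bar>" for n
    using h(2) by (intro AE_I2) (auto simp: space_cell abs_mult intro!: mult_right_mono)
  show "(\<lambda>n. \<integral>z. h n z * g z \<partial>?M) \<longlonglongrightarrow> (\<integral>z. H z * g z \<partial>?M)"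
    "integrable ?M (\<lambda>z. H z * g z)"
    by (rule integral_dominated_convergence[OF m w l bd] integrable_dominated_convergence[OF m w l bd])+
qed

lemma periodic_lim:
  assumes "\<And>n. torus_periodic (f n)" shows "torus_periodic (\<lambda>z. lim (\<lambda>n. f n z :: real))"
  using assms by (simp add: torus_periodic_def)

lemma trig_measurable: "f \<in> trig \<Longrightarrow> f \<in> borel_measurable (spacetime_measure J)"
proof -
  assume "f \<in> trig"
  then have "f \<in> borel_measurable borel"
    by (rule borel_measurable_continuous_onI[OF trig_continuous])
  then show ?thesis
    by (intro measurable_restrict_space1 measurable_completion) simp
qed

text \<open>The gain controls the defects with the weight \<open>t / T\<close>. They tend to 0 almost everywhere along a subsequence all the same, because
  the set where the weight vanishes is a null set. The limits are defined by \<open>lim\<close> everywhere, which makes them exactly periodic.\<close>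

lemma convex_integration_limit:
  assumes T: "T > 0" and b: "0 < b" "b < 1"
  obtains \<rho> \<sigma> p \<Phi> \<Theta> where
    "\<And>n. subsolution T b (\<Phi> n) (\<Theta> n)"
    "AE z in spacetime_measure {0..T}. (\<lambda>n. rho (\<Phi> n) z) \<longlonglongrightarrow> \<rho> z"
    "\<And>\<kappa>. \<kappa> = 1 \<or> \<kappa> = -1 \<Longrightarrow> AE z in spacetime_measure {0..T}. (\<lambda>n. sig \<kappa> (\<Phi> n) z) \<longlonglongrightarrow> \<sigma> \<kappa> z"
    "\<And>\<kappa>. \<kappa> = 1 \<or> \<kappa> = -1 \<Longrightarrow> AE z in spacetime_measure {0..T}. (\<lambda>n. mu b \<kappa> (\<Phi> n) (\<Theta> n) z) \<longlonglongrightarrow> \<rho> z * \<sigma> \<kappa> z"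
    "\<And>z. z \<in> cell T \<Longrightarrow> (\<lambda>n. pd e2 (\<Phi> n) z) \<longlonglongrightarrow> p z"
    "\<exists>C. \<forall>n. \<forall>z\<in>cell T. \<bar>pd e2 (\<Phi> n) z\<bar> \<le> C"
    "torus_periodic \<rho>" "\<And>\<kappa>. torus_periodic (\<sigma> \<kappa>)" "torus_periodic p"
    "\<rho> \<in> borel_measurable (spacetime_measure {0..T})" "\<And>\<kappa>. \<sigma> \<kappa> \<in> borel_measurable (spacetime_measure {0..T})"
    "\<And>J. p \<in> borel_measurable (spacetime_measure J)"
proof -
  let ?M = "spacetime_measure {0..T}"
  obtain \<Phi> \<Theta> where sub: "\<And>n. subsolution T b (\<Phi> n) (\<Theta> n)"
    and dec: "\<And>n. energy T b (\<Phi> (Suc n)) (\<Theta> (Suc n)) \<le> energy T b (\<Phi> n) (\<Theta> n) - 1/2048 * total_gain T b (\<Phi> n) (\<Theta> n) + (1/2)^n"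
    and orth: "\<And>n k. k \<le> n \<Longrightarrow> \<bar>\<integral>z. (rho (\<Phi> (Suc n)) z - rho (\<Phi> n) z) * rho (\<Phi> k) z \<partial>?M\<bar> \<le> (1/2)^n"
    "\<And>n k \<kappa>. k \<le> n \<Longrightarrow> \<kappa> \<in> {1, -1} \<Longrightarrow> \<bar>\<integral>z. (sig \<kappa> (\<Phi> (Suc n)) z - sig \<kappa> (\<Phi> n) z) * sig \<kappa> (\<Phi> k) z \<partial>?M\<bar> \<le> (1/2)^n"
    and pstep: "\<And>n z. z \<in> cell T \<Longrightarrow> \<bar>pd e2 (\<Phi> (Suc n)) z - pd e2 (\<Phi> n) z\<bar> \<le> (1/2)^n"
    by (rule convex_integration_sequence[OF T b]) blast
  have tr: "\<Phi> n \<in> trig" "\<Theta> n \<in> trig" for n using subsolution_trig[OF sub] by auto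
  define d where "d \<kappa> n z = snd z / T * defect b \<kappa> (\<Phi> n) (\<Theta> n) z" for \<kappa> n z
  have d_trig: "d \<kappa> n \<in> trig" for \<kappa> n
    using trig_mult[OF trig_scale[OF trig_snd, of "1/T"] defect_trig[OF tr, of b \<kappa>]] by (simp add: d_def[abs_def])
  define u where "u n z = d 1 n z + d (-1) n z" for n z
  have dd: "(\<lambda>n. \<integral>z. \<bar>d \<kappa> n z\<bar> \<partial>?M) \<longlonglongrightarrow> 0" if \<kappa>: "\<kappa> = 1 \<or> \<kappa> = -1" for \<kappa>
  proof (rule LIMSEQ_I)
    fix e :: real assume e: "e > 0"
    define V where "V = measure ?M (cell T)"
    define \<eta> where "\<eta> = e / (V + 1)"
    have V: "V \<ge> 0" by (simp add: V_def)
    have \<eta>: "\<eta> > 0" "\<eta> / 2 * V \<le> e / 2" using e V by (auto simp: \<eta>_def field_simps)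
    have "\<forall>\<^sub>F n in sequentially. total_gain T b (\<Phi> n) (\<Theta> n) < e * \<eta>"
      using order_tendstoD(2)[OF total_gain_tendsto_0[OF sub dec]] e \<eta> by simp
    then obtain N where N: "\<And>n. n \<ge> N \<Longrightarrow> total_gain T b (\<Phi> n) (\<Theta> n) < e * \<eta>"
      unfolding eventually_sequentially by blast
    show "\<exists>N. \<forall>n\<ge>N. norm ((\<integral>z. \<bar>d \<kappa> n z\<bar> \<partial>?M) - 0) < e"
    proof (intro exI[of _ N] allI impI)
      fix n assume n: "N \<le> n"
      have "0 \<le> (\<integral>z. (d k n z)\<^sup>2 \<partial>?M)" for k by (rule integral_nonneg_AE) auto
      from this[of 1] this[of "-1"] have "(\<integral>z. (d \<kappa> n z)\<^sup>2 \<partial>?M) \<le> total_gain T b (\<Phi> n) (\<Theta> n)"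
        using \<kappa> by (auto simp: total_gain_def d_def)
      then have "(\<integral>z. (d \<kappa> n z)\<^sup>2 \<partial>?M) < e * \<eta>" using N[OF n] by linarith
      then have "1 / (2 * \<eta>) * (\<integral>z. (d \<kappa> n z)\<^sup>2 \<partial>?M) < 1 / (2 * \<eta>) * (e * \<eta>)"
        using \<eta> by (intro mult_strict_left_mono) auto
      also have "\<dots> = e / 2" using \<eta> by simp
      finally have "(\<integral>z. \<bar>d \<kappa> n z\<bar> \<partial>?M) < e"
        using L1_le_L2[OF d_trig[of \<kappa> n] \<eta>(1), of T] \<eta>(2) unfolding V_def by linarith
      moreover have "0 \<le> (\<integral>z. \<bar>d \<kappa> n z\<bar> \<partial>?M)" by (rule integral_nonneg_AE) auto
      ultimately show "norm ((\<integral>z. \<bar>d \<kappa> n z\<bar> \<partial>?M) - 0) < e" by simp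
    qed
  qed
  have d_nonneg: "0 \<le> d \<kappa> n z" if "z \<in> cell T" "\<kappa> = 1 \<or> \<kappa> = -1" for \<kappa> n z
  proof -
    have "0 \<le> snd z / T" using T that(1) by auto
    then show ?thesis
      unfolding d_def using subsolution_bounds(1)[OF sub that] by (intro mult_nonneg_nonneg less_imp_le[of 0 "defect _ _ _ _ _"])
  qed
  have ui: "integrable ?M (u n)" for n
    unfolding u_def by (intro trig_integrable trig_add d_trig)
  have "(\<lambda>n. (\<integral>z. \<bar>d 1 n z\<bar> \<partial>?M) + (\<integral>z. \<bar>d (-1) n z\<bar> \<partial>?M)) \<longlonglongrightarrow> 0 + 0"
    by (intro tendsto_add dd) auto
  moreover have "(\<integral>z. norm (u n z) \<partial>?M) = (\<integral>z. \<bar>d 1 n z\<bar> \<partial>?M) + (\<integral>z. \<bar>d (-1) n z\<bar> \<partial>?M)" for n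
  proof -
    have "(\<integral>z. norm (u n z) \<partial>?M) = (\<integral>z. \<bar>d 1 n z\<bar> + \<bar>d (-1) n z\<bar> \<partial>?M)"
      using d_nonneg by (intro Bochner_Integration.integral_cong) (auto simp: u_def space_cell)
    also have "\<dots> = (\<integral>z. \<bar>d 1 n z\<bar> \<partial>?M) + (\<integral>z. \<bar>d (-1) n z\<bar> \<partial>?M)"
      by (intro Bochner_Integration.integral_add integrable_abs trig_integrable d_trig)
    finally show ?thesis .
  qed
  ultimately have u0: "(\<lambda>n. \<integral>z. norm (u n z) \<partial>?M) \<longlonglongrightarrow> 0" by simp
  let ?t = "\<lambda>n z. (rho (\<Phi> n) z, sig 1 (\<Phi> n) z, sig (-1) (\<Phi> n) z)"
  have cR: "L1_Cauchy ?M (\<lambda>n. rho (\<Phi> n))"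
    by (rule L2_increments_Cauchy[where B=4]) (use subsolution_bounds(4)[OF sub] orth(1) rho_trig tr in auto)
  have cS: "L1_Cauchy ?M (\<lambda>n. sig \<kappa> (\<Phi> n))" if "\<kappa> = 1 \<or> \<kappa> = -1" for \<kappa>
    by (rule L2_increments_Cauchy[where B="3/2"]) (use subsolution_bounds(3)[OF sub] orth(2) sig_trig tr that in auto)
  note si = trig_integrable[OF sig_trig[OF tr(1)]] and ri = trig_integrable[OF rho_trig[OF tr(1)]]
  have "L1_Cauchy ?M ?t" "\<And>n. integrable ?M (?t n)"
    by (intro L1_Cauchy_Pair integrable_Pair cR cS si ri; simp)+
  then obtain r1 where r1: "strict_mono r1" "AE z in ?M. Cauchy (\<lambda>i. ?t (r1 i) z)"
    using cauchy_L1_AE_cauchy_subseq[of ?M ?t] unfolding L1_Cauchy_def by blast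
  have "(\<lambda>n. \<integral>z. norm (u (r1 n) z) \<partial>?M) \<longlonglongrightarrow> 0"
    using LIMSEQ_subseq_LIMSEQ[OF u0 r1(1)] by (simp add: o_def)
  then obtain r2 where r2: "strict_mono r2" "AE z in ?M. (\<lambda>n. u (r1 (r2 n)) z) \<longlonglongrightarrow> 0"
    using tendsto_L1_AE_subseq[of ?M "\<lambda>n. u (r1 n)"] ui by blast
  define k where "k n = r1 (r2 n)" for n
  have k: "strict_mono k" unfolding k_def using r1(1) r2(1) by (simp add: strict_mono_def)
  define \<rho> where "\<rho> z = lim (\<lambda>n. rho (\<Phi> (k n)) z)" for z
  define \<sigma> where "\<sigma> \<kappa> z = lim (\<lambda>n. sig \<kappa> (\<Phi> (k n)) z)" for \<kappa> z
  define p where "p z = lim (\<lambda>n. pd e2 (\<Phi> (k n)) z)" for z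
  have conv: "AE z in ?M. convergent (\<lambda>n. ?t (k n) z)"
    using r1(2)
  proof eventually_elim
    case (elim z)
    then have "convergent (\<lambda>i. ?t (r1 i) z)" by (simp add: Cauchy_convergent_iff)
    from convergent_subseq_convergent[OF this r2(1)] show ?case by (simp add: k_def o_def)
  qed
  have rl: "AE z in ?M. (\<lambda>n. rho (\<Phi> (k n)) z) \<longlonglongrightarrow> \<rho> z"
    using conv
  proof eventually_elim
    case (elim z)
    then obtain l where "(\<lambda>n. ?t (k n) z) \<longlonglongrightarrow> l" by (auto simp: convergent_def)
    from tendsto_fst[OF this] show ?case by (auto simp: \<rho>_def convergent_LIMSEQ_iff[symmetric] convergent_def)
  qed
  have sl: "AE z in ?M. (\<lambda>n. sig \<kappa> (\<Phi> (k n)) z) \<longlonglongrightarrow> \<sigma> \<kappa> z" if "\<kappa> = 1 \<or> \<kappa> = -1" for \<kappa>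
    using conv
  proof eventually_elim
    case (elim z)
    then obtain l where "(\<lambda>n. ?t (k n) z) \<longlonglongrightarrow> l" by (auto simp: convergent_def)
    from tendsto_fst[OF tendsto_snd[OF this]] tendsto_snd[OF tendsto_snd[OF this]]
    show ?case using that by (auto simp: \<sigma>_def convergent_LIMSEQ_iff[symmetric] convergent_def)
  qed
  have ml: "AE z in ?M. (\<lambda>n. mu b \<kappa> (\<Phi> (k n)) (\<Theta> (k n)) z) \<longlonglongrightarrow> \<rho> z * \<sigma> \<kappa> z" if \<kappa>: "\<kappa> = 1 \<or> \<kappa> = -1" for \<kappa>
    using rl sl[OF \<kappa>] r2(2) AE_time_positive AE_space
  proof eventually_elim
    case (elim z)
    have z: "z \<in> cell T" using elim(5) by (simp add: space_cell)
    have "(\<lambda>n. d \<kappa> (k n) z) \<longlonglongrightarrow> 0"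
    proof (rule tendsto_sandwich[OF _ _ tendsto_const])
      show "(\<lambda>n. u (k n) z) \<longlonglongrightarrow> 0" using elim(3) by (simp add: k_def)
      show "\<forall>\<^sub>F n in sequentially. 0 \<le> d \<kappa> (k n) z" using d_nonneg[OF z \<kappa>] by simp
      show "\<forall>\<^sub>F n in sequentially. d \<kappa> (k n) z \<le> u (k n) z"
        using d_nonneg[OF z] \<kappa> by (auto simp: u_def)
    qed
    then have "(\<lambda>n. T / snd z * d \<kappa> (k n) z + rho (\<Phi> (k n)) z * sig \<kappa> (\<Phi> (k n)) z) \<longlonglongrightarrow> T / snd z * 0 + \<rho> z * \<sigma> \<kappa> z"
      by (intro tendsto_intros elim)
    then show ?case using elim(4) T by (simp add: d_def defect_def)
  qed
  have pC: "\<bar>pd e2 (\<Phi> (i + j)) z - pd e2 (\<Phi> i) z\<bar> \<le> 2 * (1/2)^i" if z: "z \<in> cell T" for i j z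
  proof -
    have "\<bar>pd e2 (\<Phi> (i + j)) z - pd e2 (\<Phi> i) z\<bar> \<le> 2 * (1/2)^i - 2 * (1/2)^(i + j)"
    proof (induction j)
      case (Suc j)
      then show ?case using pstep[OF z, of "i + j"] by simp
    qed simp
    moreover have "0 \<le> (1/2::real)^(i + j)" by simp
    ultimately show ?thesis by linarith
  qed
  have pl: "(\<lambda>n. pd e2 (\<Phi> (k n)) z) \<longlonglongrightarrow> p z" if z: "z \<in> cell T" for z
  proof -
    have "Cauchy (\<lambda>n. pd e2 (\<Phi> n) z)"
    proof (rule metric_CauchyI)
      fix e :: real assume e: "e > 0"
      have "(\<lambda>n. 4 * (1/2)^n) \<longlonglongrightarrow> (0::real)"
        using tendsto_mult[OF tendsto_const[of 4] LIMSEQ_realpow_zero[of "1/2::real"]] by simp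
      then obtain N where "4 * (1/2)^N < e"
        using order_tendstoD(2)[of _ 0 sequentially e] e unfolding eventually_sequentially by blast
      then have "dist (pd e2 (\<Phi> m) z) (pd e2 (\<Phi> n) z) < e" if "m \<ge> N" "n \<ge> N" for m n
        using pC[OF z, of N "m - N"] pC[OF z, of N "n - N"] that by (simp add: dist_real_def)
      then show "\<exists>N. \<forall>m\<ge>N. \<forall>n\<ge>N. dist (pd e2 (\<Phi> m) z) (pd e2 (\<Phi> n) z) < e" by blast
    qed
    then have "convergent (\<lambda>n. pd e2 (\<Phi> n) z)" by (simp add: Cauchy_convergent_iff)
    from convergent_subseq_convergent[OF this k] show ?thesis
      by (simp add: p_def o_def convergent_LIMSEQ_iff)
  qed
  have pb: "\<exists>C. \<forall>n. \<forall>z\<in>cell T. \<bar>pd e2 (\<Phi> (k n)) z\<bar> \<le> C"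
  proof -
    obtain B where B: "\<And>z. z \<in> cell T \<Longrightarrow> \<bar>pd e2 (\<Phi> 0) z\<bar> \<le> B"
      using trig_unif_bounded[OF trig_pd[OF tr(1)], of T e2 0] unfolding unif_bounded_def by blast
    have "\<bar>pd e2 (\<Phi> n) z\<bar> \<le> B + 2" if "z \<in> cell T" for n z
      using pC[OF that, of 0 n] B[OF that] by simp
    then show ?thesis by blast
  qed
  note meas = borel_measurable_lim_metric[OF trig_measurable]
  show thesis
  proof (rule that[of "\<lambda>n. \<Phi> (k n)" "\<lambda>n. \<Theta> (k n)" \<rho> \<sigma> p])
    show "torus_periodic \<rho>" "torus_periodic p"
      unfolding \<rho>_def[abs_def] p_def[abs_def] by (intro periodic_lim trig_periodic rho_trig trig_pd tr)+
    show "torus_periodic (\<sigma> \<kappa>)" for \<kappa>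
      unfolding \<sigma>_def[abs_def] by (intro periodic_lim trig_periodic sig_trig tr)
    show "\<rho> \<in> borel_measurable ?M"
      unfolding \<rho>_def[abs_def] by (intro meas rho_trig tr)
    show "p \<in> borel_measurable (spacetime_measure J)" for J
      unfolding p_def[abs_def] by (intro meas trig_pd tr)
    show "\<sigma> \<kappa> \<in> borel_measurable ?M" for \<kappa>
      unfolding \<sigma>_def[abs_def] by (intro meas sig_trig tr)
  qed (fact sub rl sl ml pl pb)+
qed

lemma bounded_integrable:
  fixes f :: "real spacetime_fun"
  assumes "f \<in> borel_measurable (spacetime_measure {a..c})" "AE z in spacetime_measure {a..c}. \<bar>f z\<bar> \<le> C"
  shows "integrable (spacetime_measure {a..c}) f"
  by (rule finite_measure.integrable_const_bound[OF measure_finite, where B=C]) (simp_all only: assms real_norm_def)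

text \<open>The velocity is recovered from its two coordinates and the pressure gradient from Darcy's law, so that only the linear
  identities of the approximations remain to be passed to the limit.\<close>

lemma weak_solution_exists:
  assumes T: "T > 0" and b: "0 < b" "b < 1"
  obtains \<rho> v where "ipm_weak_solution T (\<lambda>x. 0) \<rho> v"
    "(\<integral>z. \<rho> z * (v z $ 1 - v z $ 2) \<partial>spacetime_measure {0..T}) = b * measure (spacetime_measure {0..T}) (cell T)"
proof -
  let ?M = "spacetime_measure {0..T}"
  obtain \<rho> \<sigma> p \<Phi> \<Theta> where sub: "\<And>n. subsolution T b (\<Phi> n) (\<Theta> n)"
    and rl: "AE z in ?M. (\<lambda>n. rho (\<Phi> n) z) \<longlonglongrightarrow> \<rho> z"
    and sl: "\<And>\<kappa>. \<kappa> = 1 \<or> \<kappa> = -1 \<Longrightarrow> AE z in ?M. (\<lambda>n. sig \<kappa> (\<Phi> n) z) \<longlonglongrightarrow> \<sigma> \<kappa> z"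
    and ml: "\<And>\<kappa>. \<kappa> = 1 \<or> \<kappa> = -1 \<Longrightarrow> AE z in ?M. (\<lambda>n. mu b \<kappa> (\<Phi> n) (\<Theta> n) z) \<longlonglongrightarrow> \<rho> z * \<sigma> \<kappa> z"
    and pl: "\<And>z. z \<in> cell T \<Longrightarrow> (\<lambda>n. pd e2 (\<Phi> n) z) \<longlonglongrightarrow> p z"
    and pb: "\<exists>C. \<forall>n. \<forall>z\<in>cell T. \<bar>pd e2 (\<Phi> n) z\<bar> \<le> C"
    and per: "torus_periodic \<rho>" "\<And>\<kappa>. torus_periodic (\<sigma> \<kappa>)" "torus_periodic p"
    and meas: "\<rho> \<in> borel_measurable ?M" "\<And>\<kappa>. \<sigma> \<kappa> \<in> borel_measurable ?M" 
      "\<And>J. p \<in> borel_measurable (spacetime_measure J)"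
  proof (rule convex_integration_limit[OF T b], goal_cases)
    case (1 \<rho> \<sigma> p \<Phi> \<Theta>)
    show thesis by (rule 1(1)[OF 1(2-)])
  qed
  have tr: "\<Phi> n \<in> trig" "\<Theta> n \<in> trig" for n using subsolution_trig[OF sub] by auto
  have init: "\<Phi> n (x, 0) = 0" for n x using sub[of n] by (simp add: subsolution_def)
  obtain C where C: "\<And>n z. z \<in> cell T \<Longrightarrow> \<bar>pd e2 (\<Phi> n) z\<bar> \<le> C" using pb by blast
  have mub: "\<bar>mu b \<kappa> (\<Phi> n) (\<Theta> n) z\<bar> \<le> 8" if z: "z \<in> cell T" and \<kappa>: "\<kappa> = 1 \<or> \<kappa> = -1" for n z \<kappa>
  proof -
    have "\<bar>rho (\<Phi> n) z * sig \<kappa> (\<Phi> n) z\<bar> \<le> 4 * (3/2)"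
      unfolding abs_mult by (intro mult_mono subsolution_bounds[OF sub z] \<kappa>) auto
    moreover have "\<bar>defect b \<kappa> (\<Phi> n) (\<Theta> n) z\<bar> \<le> 2"
      using subsolution_bounds(1,2)[OF sub[of n] z \<kappa>] by simp
    ultimately show ?thesis by (simp add: defect_def abs_le_iff)
  qed
  note lr = trig_limit_integral[OF rho_trig[OF tr(1)] subsolution_bounds(4)[OF sub] rl meas(1)]
  note ls = trig_limit_integral[OF sig_trig[OF tr(1)] subsolution_bounds(3)[OF sub] sl meas(2)]
  note lm = trig_limit_integral[OF mu_trig[OF tr] mub ml borel_measurable_times[OF meas(1,2)]]
  have pl': "AE z in ?M. (\<lambda>n. pd e2 (\<Phi> n) z) \<longlonglongrightarrow> p z"
    using pl by (intro AE_I2) (auto simp: space_cell)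
  note lp = trig_limit_integral[OF trig_pd[OF tr(1)] C pl' meas(3)]
  have rb: "AE z in ?M. \<bar>\<rho> z\<bar> \<le> 4"
    using rl AE_space
  proof eventually_elim
    case (elim z)
    have "\<bar>rho (\<Phi> n) z\<bar> \<le> 4" for n using subsolution_bounds(4)[OF sub] elim(2) by (simp add: space_cell)
    then show ?case using LIMSEQ_le_const2[OF tendsto_rabs[OF elim(1)]] by blast
  qed
  have sb: "AE z in ?M. \<bar>\<sigma> \<kappa> z\<bar> \<le> 3/2" if \<kappa>: "\<kappa> = 1 \<or> \<kappa> = -1" for \<kappa>
    using sl[OF \<kappa>] AE_space
  proof eventually_elim
    case (elim z)
    have "\<bar>sig \<kappa> (\<Phi> n) z\<bar> \<le> 3/2" for n using subsolution_bounds(3)[OF sub _ \<kappa>] elim(2) by (simp add: space_cell)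
    then show ?case using LIMSEQ_le_const2[OF tendsto_rabs[OF elim(1)]] by blast
  qed
  define v1 where "v1 z = 1/2 * (\<sigma> 1 z - \<sigma> (-1) z)" for z
  define v2 where "v2 z = - 1/2 * (\<sigma> 1 z + \<sigma> (-1) z)" for z
  define v where "v z = v1 z *\<^sub>R axis 1 1 + v2 z *\<^sub>R (axis 2 1 :: real^2)" for z
  define g where "g z = (- v1 z) *\<^sub>R axis 1 1 + (- (v2 z + \<rho> z)) *\<^sub>R (axis 2 1 :: real^2)" for z
  have v: "v z $ 1 = v1 z" "v z $ 2 = v2 z" and g: "g z $ 1 = - v1 z" "g z $ 2 = - (v2 z + \<rho> z)" for z
    by (simp_all add: v_def g_def axis_def)
  have vm: "v1 \<in> borel_measurable ?M" "v2 \<in> borel_measurable ?M"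
    unfolding v1_def[abs_def] v2_def[abs_def] using meas(2) by measurable
  have vb: "AE z in ?M. \<bar>v1 z\<bar> \<le> 2 \<and> \<bar>v2 z\<bar> \<le> 2"
    using sb[of 1, simplified] sb[of "-1", simplified]
    by eventually_elim (auto simp: v1_def v2_def abs_le_iff)
  have ri: "integrable ?M \<rho>" by (rule bounded_integrable[OF meas(1) rb])
  have vi: "integrable ?M v1" "integrable ?M v2"
    by (rule bounded_integrable[OF vm(1), of 2], use vb in \<open>auto elim: eventually_mono\<close>)
       (rule bounded_integrable[OF vm(2), of 2], use vb in \<open>auto elim: eventually_mono\<close>)
  have vper: "torus_periodic v1" "torus_periodic v2"
    using per(2) by (simp_all add: torus_periodic_def v1_def v2_def)
  have "ipm_weak_solution T (\<lambda>x. 0) \<rho> v"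
    unfolding ipm_weak_solution_def
  proof (intro conjI exI[of _ p] exI[of _ g] allI impI)
    show "L_infinity T \<rho>"
      unfolding L_infinity_def using per(1) meas(1) rb by auto
    have "AE z in ?M. norm (v z) \<le> 4"
      using vb
    proof eventually_elim
      case (elim z)
      have "norm (v z) \<le> norm (v1 z *\<^sub>R (axis 1 1 :: real^2)) + norm (v2 z *\<^sub>R (axis 2 1 :: real^2))"
        unfolding v_def by (rule norm_triangle_ineq)
      then show ?case using elim by simp
    qed
    moreover have "v \<in> borel_measurable ?M" unfolding v_def[abs_def] using vm by measurable
    moreover have "torus_periodic v" using vper by (simp add: torus_periodic_def v_def)
    ultimately show "L_infinity T v" unfolding L_infinity_def by blast
  next
    show "weak_space_grad T p g"
      unfolding weak_space_grad_def
    proof (intro conjI allI impI)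
      show "torus_periodic p" by (rule per(3))
      show "torus_periodic g" using vper per(1) by (simp add: torus_periodic_def g_def)
      show "integrable ?M g"
        unfolding g_def[abs_def] using vi ri by (intro Bochner_Integration.integrable_add integrable_scaleR_left) auto
      fix a c :: real assume ac: "0 < a \<and> c < T"
      have pz: "\<bar>p z\<bar> \<le> C" if z: "z \<in> cell T" for z
        using LIMSEQ_le_const2[OF tendsto_rabs[OF pl[OF z]]] C[OF z] by blast
      show "integrable (spacetime_measure {a..c}) p"
      proof (rule bounded_integrable[OF meas(3)], rule AE_I2)
        fix z assume "z \<in> space (spacetime_measure {a..c})"
        then show "\<bar>p z\<bar> \<le> C" using ac by (intro pz) (auto simp: space_restrict_space)
      qed
    next
      fix \<psi> and i :: 2 assume "test_function {0<..<T} \<psi>"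
      note \<psi> = test_function_C1[OF this]
      have c: "continuous_on UNIV \<psi>" "continuous_on UNIV (pd d \<psi>)" for d
        by (intro C1_continuous C1_continuous_pd \<psi>)+
      note vel = velocity_identities(2,3)[OF tr(1) \<psi>, where T=T]
      have 1: "(\<integral>z. p z * pd e1 \<psi> z \<partial>?M) = 1/2 * ((\<integral>z. \<sigma> 1 z * \<psi> z \<partial>?M) - (\<integral>z. \<sigma> (-1) z * \<psi> z \<partial>?M))"
        by (rule LIMSEQ_unique[OF lp(1)[OF _ c(2)]], simp, unfold vel, intro tendsto_intros ls c, auto)
      have 2: "(\<integral>z. p z * pd e2 \<psi> z \<partial>?M) = (\<integral>z. \<rho> z * \<psi> z \<partial>?M) - 1/2 * ((\<integral>z. \<sigma> 1 z * \<psi> z \<partial>?M) + (\<integral>z. \<sigma> (-1) z * \<psi> z \<partial>?M))"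
        by (rule LIMSEQ_unique[OF lp(1)[OF _ c(2)]], simp, unfold vel, intro tendsto_intros ls lr c, auto)
      have i1: "integrable ?M (\<lambda>z. \<sigma> 1 z * \<psi> z)" "integrable ?M (\<lambda>z. \<sigma> (-1) z * \<psi> z)" "integrable ?M (\<lambda>z. \<rho> z * \<psi> z)"
        by (rule ls(2) lr(2); use c in auto)+
      have "i = 1 \<or> i = 2" using exhaust_2[of i] by blast
      then show "(\<integral>z. p z * (space_grad \<psi> z $ i) \<partial>?M) = - (\<integral>z. (g z $ i) * \<psi> z \<partial>?M)"
      proof
        assume i: "i = 1"
        have "- (\<integral>z. (g z $ i) * \<psi> z \<partial>?M) = - (\<integral>z. 1/2 * (\<sigma> (-1) z * \<psi> z - \<sigma> 1 z * \<psi> z) \<partial>?M)"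
          unfolding i g v1_def by (simp add: algebra_simps)
        also have "\<dots> = 1/2 * ((\<integral>z. \<sigma> 1 z * \<psi> z \<partial>?M) - (\<integral>z. \<sigma> (-1) z * \<psi> z \<partial>?M))"
          using i1 by (simp add: field_simps)
        finally show ?thesis unfolding space_grad_pd i 1 by simp
      next
        assume i: "i = 2"
        have "- (\<integral>z. (g z $ i) * \<psi> z \<partial>?M) = - (\<integral>z. 1/2 * (\<sigma> (-1) z * \<psi> z + \<sigma> 1 z * \<psi> z) - \<rho> z * \<psi> z \<partial>?M)"
          unfolding i g v2_def by (simp add: algebra_simps)
        also have "\<dots> = - (1/2 * ((\<integral>z. \<sigma> (-1) z * \<psi> z \<partial>?M) + (\<integral>z. \<sigma> 1 z * \<psi> z \<partial>?M)) - (\<integral>z. \<rho> z * \<psi> z \<partial>?M))"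
          using i1 by simp
        finally show ?thesis unfolding space_grad_pd i 2 by (simp add: add.commute)
      qed
    qed
  next
    fix \<phi> assume test: "test_function {0..<T} \<phi>"
    note \<phi> = test_function_C1[OF test]
    have end0: "\<phi> (x, T) = 0" for x using test_function_zero[OF test] T by simp
    have c: "continuous_on UNIV (pd d \<phi>)" for d by (intro C1_continuous_pd \<phi>)
    note id = transport_identity[OF tr(1) init tr(2) less_imp_le[OF T] \<phi> end0, where b=b]
    have lim: "(\<integral>z. \<rho> z * pd et \<phi> z \<partial>?M)
      + 1/2 * ((\<integral>z. \<rho> z * \<sigma> 1 z * pd e1 \<phi> z \<partial>?M) - (\<integral>z. \<rho> z * \<sigma> (-1) z * pd e1 \<phi> z \<partial>?M))
      - 1/2 * ((\<integral>z. \<rho> z * \<sigma> 1 z * pd e2 \<phi> z \<partial>?M) + (\<integral>z. \<rho> z * \<sigma> (-1) z * pd e2 \<phi> z \<partial>?M)) = 0"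
    proof (rule LIMSEQ_unique)
      show "(\<lambda>n. (\<integral>z. rho (\<Phi> n) z * pd et \<phi> z \<partial>?M)
        + 1/2 * ((\<integral>z. mu b 1 (\<Phi> n) (\<Theta> n) z * pd e1 \<phi> z \<partial>?M) - (\<integral>z. mu b (-1) (\<Phi> n) (\<Theta> n) z * pd e1 \<phi> z \<partial>?M))
        - 1/2 * ((\<integral>z. mu b 1 (\<Phi> n) (\<Theta> n) z * pd e2 \<phi> z \<partial>?M) + (\<integral>z. mu b (-1) (\<Phi> n) (\<Theta> n) z * pd e2 \<phi> z \<partial>?M))) \<longlonglongrightarrow>
        (\<integral>z. \<rho> z * pd et \<phi> z \<partial>?M)
        + 1/2 * ((\<integral>z. \<rho> z * \<sigma> 1 z * pd e1 \<phi> z \<partial>?M) - (\<integral>z. \<rho> z * \<sigma> (-1) z * pd e1 \<phi> z \<partial>?M))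
        - 1/2 * ((\<integral>z. \<rho> z * \<sigma> 1 z * pd e2 \<phi> z \<partial>?M) + (\<integral>z. \<rho> z * \<sigma> (-1) z * pd e2 \<phi> z \<partial>?M))"
        by (intro tendsto_intros lr(1) lm(1) c; simp)
    qed (unfold id, rule tendsto_const)
    have i: "integrable ?M (\<lambda>z. \<rho> z * pd et \<phi> z)" "integrable ?M (\<lambda>z. \<rho> z * \<sigma> 1 z * pd d \<phi> z)"
      "integrable ?M (\<lambda>z. \<rho> z * \<sigma> (-1) z * pd d \<phi> z)" for d
      by (intro lr(2) lm(2) c; simp)+
    \<comment> \<open>here \<open>m = \<rho> v\<close> is used: the limits of \<open>mu\<close> are the products \<open>\<rho> \<sigma>\<close>\<close>
    have "(\<integral>z. \<rho> z * (time_deriv \<phi> z + v z \<bullet> space_grad \<phi> z) \<partial>?M) =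
      (\<integral>z. \<rho> z * pd et \<phi> z + 1/2 * (\<rho> z * \<sigma> 1 z * pd e1 \<phi> z - \<rho> z * \<sigma> (-1) z * pd e1 \<phi> z)
        - 1/2 * (\<rho> z * \<sigma> 1 z * pd e2 \<phi> z + \<rho> z * \<sigma> (-1) z * pd e2 \<phi> z) \<partial>?M)"
      by (rule Bochner_Integration.integral_cong)
         (auto simp: time_deriv_pd inner_vec_def sum_2 space_grad_pd v v1_def v2_def field_simps)
    also have "\<dots> = (\<integral>z. \<rho> z * pd et \<phi> z \<partial>?M)
      + 1/2 * ((\<integral>z. \<rho> z * \<sigma> 1 z * pd e1 \<phi> z \<partial>?M) - (\<integral>z. \<rho> z * \<sigma> (-1) z * pd e1 \<phi> z \<partial>?M))
      - 1/2 * ((\<integral>z. \<rho> z * \<sigma> 1 z * pd e2 \<phi> z \<partial>?M) + (\<integral>z. \<rho> z * \<sigma> (-1) z * pd e2 \<phi> z \<partial>?M))"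
      using i by simp
    finally show "(\<integral>z. \<rho> z * (time_deriv \<phi> z + v z \<bullet> space_grad \<phi> z) \<partial>?M) + (\<integral>x. 0 * \<phi> (x, 0) \<partial>torus_measure) = 0"
      using lim by simp
  next
    fix \<phi> assume test: "test_function {0..<T} \<phi>"
    note \<phi> = test_function_C1[OF test]
    have c: "continuous_on UNIV (pd d \<phi>)" for d by (intro C1_continuous_pd \<phi>)
    note id = velocity_identities(1)[OF tr(1) \<phi>, where T=T]
    have lim: "1/2 * ((\<integral>z. \<sigma> 1 z * pd e1 \<phi> z \<partial>?M) - (\<integral>z. \<sigma> (-1) z * pd e1 \<phi> z \<partial>?M))
      - 1/2 * ((\<integral>z. \<sigma> 1 z * pd e2 \<phi> z \<partial>?M) + (\<integral>z. \<sigma> (-1) z * pd e2 \<phi> z \<partial>?M)) = 0"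
    proof (rule LIMSEQ_unique)
      show "(\<lambda>n. 1/2 * ((\<integral>z. sig 1 (\<Phi> n) z * pd e1 \<phi> z \<partial>?M) - (\<integral>z. sig (-1) (\<Phi> n) z * pd e1 \<phi> z \<partial>?M))
        - 1/2 * ((\<integral>z. sig 1 (\<Phi> n) z * pd e2 \<phi> z \<partial>?M) + (\<integral>z. sig (-1) (\<Phi> n) z * pd e2 \<phi> z \<partial>?M))) \<longlonglongrightarrow>
        1/2 * ((\<integral>z. \<sigma> 1 z * pd e1 \<phi> z \<partial>?M) - (\<integral>z. \<sigma> (-1) z * pd e1 \<phi> z \<partial>?M))
        - 1/2 * ((\<integral>z. \<sigma> 1 z * pd e2 \<phi> z \<partial>?M) + (\<integral>z. \<sigma> (-1) z * pd e2 \<phi> z \<partial>?M))"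
        by (intro tendsto_intros ls(1) c; simp)
    qed (unfold id, rule tendsto_const)
    have i: "integrable ?M (\<lambda>z. \<sigma> 1 z * pd d \<phi> z)" "integrable ?M (\<lambda>z. \<sigma> (-1) z * pd d \<phi> z)" for d
      by (intro ls(2) c; simp)+
    have "(\<integral>z. v z \<bullet> space_grad \<phi> z \<partial>?M) =
      (\<integral>z. 1/2 * (\<sigma> 1 z * pd e1 \<phi> z - \<sigma> (-1) z * pd e1 \<phi> z) - 1/2 * (\<sigma> 1 z * pd e2 \<phi> z + \<sigma> (-1) z * pd e2 \<phi> z) \<partial>?M)"
      by (rule Bochner_Integration.integral_cong)
         (auto simp: inner_vec_def sum_2 space_grad_pd v v1_def v2_def field_simps)
    also have "\<dots> = 1/2 * ((\<integral>z. \<sigma> 1 z * pd e1 \<phi> z \<partial>?M) - (\<integral>z. \<sigma> (-1) z * pd e1 \<phi> z \<partial>?M))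
      - 1/2 * ((\<integral>z. \<sigma> 1 z * pd e2 \<phi> z \<partial>?M) + (\<integral>z. \<sigma> (-1) z * pd e2 \<phi> z \<partial>?M))"
      using i by simp
    finally show "(\<integral>z. v z \<bullet> space_grad \<phi> z \<partial>?M) = 0" using lim by simp
  next
    fix l1 l2 :: "real spacetime_fun"
    have "v z + g z + vector [0, \<rho> z] = 0" for z
      by (simp add: vec_eq_iff forall_2 v g)
    then show "(\<integral>z. (v z + g z + vector [0, \<rho> z]) \<bullet> vector [l1 z, l2 z] \<partial>?M) = 0" by simp
  qed
  moreover have "(\<integral>z. \<rho> z * (v z $ 1 - v z $ 2) \<partial>?M) = b * measure ?M (cell T)"
  proof -
    have "(\<lambda>n. \<integral>z. mu b 1 (\<Phi> n) (\<Theta> n) z * 1 \<partial>?M) \<longlonglongrightarrow> (\<integral>z. \<rho> z * \<sigma> 1 z * 1 \<partial>?M)"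
      by (rule lm(1)) auto
    then have "b * measure ?M (cell T) = (\<integral>z. \<rho> z * \<sigma> 1 z \<partial>?M)"
      unfolding mult_1_right mu_mean[OF tr] by (simp add: LIMSEQ_const_iff)
    then show ?thesis by (simp add: v v1_def v2_def field_simps)
  qed
  ultimately show thesis by (rule that)
qed

text \<open>The integral of \<open>\<rho> (v\<^sub>1 - v\<^sub>2)\<close> depends only on the class of a solution and takes each value \<open>b V\<close> with \<open>0 < b < 1\<close>, where
  \<open>V\<close> is the positive measure of the space-time cell. It is 0 for the trivial solution.\<close>

theorem theorem5p2:
  fixes T :: real
  assumes "T > 0"
  shows "infinite ({(\<rho>, v). ipm_weak_solution T (\<lambda>x. 0) \<rho> v \<and>
                      ((\<rho>, v), (\<lambda>z. 0, \<lambda>z. 0)) \<notin> ae_equal T} // ae_equal T)"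
proof -
  let ?M = "spacetime_measure {0..T}"
  let ?S = "{(\<rho>, v). ipm_weak_solution T (\<lambda>x. 0) \<rho> v \<and> ((\<rho>, v), (\<lambda>z. 0, \<lambda>z. 0)) \<notin> ae_equal T}"
  define V where "V = measure ?M (cell T)"
  have V: "V > 0" unfolding V_def by (rule cell_measure_pos[OF assms])
  define flux where "flux = (\<lambda>(\<rho> :: real spacetime_fun, v :: (real^2) spacetime_fun). \<integral>z. \<rho> z * (v z $ 1 - v z $ 2) \<partial>?M)"
  have flux_eq: "flux s = flux s'"
    if ae: "(s, s') \<in> ae_equal T" and m: "fst s \<in> borel_measurable ?M" "snd s \<in> borel_measurable ?M"
      "fst s' \<in> borel_measurable ?M" "snd s' \<in> borel_measurable ?M" for s s'
  proof -
    have "AE z in ?M. fst s z = fst s' z \<and> snd s z = snd s' z" using ae by (simp add: ae_equal_def split_beta)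
    then have "AE z in ?M. fst s z * (snd s z $ 1 - snd s z $ 2) = fst s' z * (snd s' z $ 1 - snd s' z $ 2)"
      by eventually_elim simp
    moreover have "(\<lambda>z. f z * (w z $ 1 - w z $ 2)) \<in> borel_measurable ?M"
      if "f \<in> borel_measurable ?M" "w \<in> borel_measurable ?M" for f :: "real spacetime_fun" and w :: "(real^2) spacetime_fun"
    proof -
      have "w z $ i = w z \<bullet> axis i 1" for z i by (simp add: inner_axis)
      then show ?thesis using that by simp
    qed
    ultimately show ?thesis
      unfolding flux_def split_beta using m by (intro integral_cong_AE) auto
  qed
  have "\<exists>s. ipm_weak_solution T (\<lambda>x. 0) (fst s) (snd s) \<and> flux s = b * V" if "b \<in> {0<..<1}" for b
  proof -
    obtain \<rho> v where "ipm_weak_solution T (\<lambda>x. 0) \<rho> v"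
      "(\<integral>z. \<rho> z * (v z $ 1 - v z $ 2) \<partial>?M) = b * measure ?M (cell T)"
      using weak_solution_exists[OF assms, of b] \<open>b \<in> {0<..<1}\<close> by auto
    then show ?thesis by (intro exI[of _ "(\<rho>, v)"]) (simp add: flux_def V_def)
  qed
  then obtain sol where sol: "\<And>b. b \<in> {0<..<1} \<Longrightarrow> ipm_weak_solution T (\<lambda>x. 0) (fst (sol b)) (snd (sol b))"
    "\<And>b. b \<in> {0<..<1} \<Longrightarrow> flux (sol b) = b * V" by metis
  have zero: "flux (\<lambda>z. 0, \<lambda>z. 0) = 0" by (simp add: flux_def)
  have solm: "fst (sol b) \<in> borel_measurable ?M" "snd (sol b) \<in> borel_measurable ?M" if "b \<in> {0<..<1}" for b
    using sol(1)[OF that] by (auto simp: ipm_weak_solution_def L_infinity_def)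
  \<comment> \<open>a solution equal to 0 almost everywhere would have flux 0 instead of \<open>b V\<close>\<close>
  have inS: "sol b \<in> ?S" if b: "b \<in> {0<..<1}" for b
    using sol[OF b] flux_eq[of "sol b" "(\<lambda>z. 0, \<lambda>z. 0)"] zero V b solm[OF b] by (auto simp: split_beta)
  have inj: "inj_on (\<lambda>b. ae_equal T `` {sol b}) {0<..<1}"
  proof (rule inj_onI)
    fix b c :: real assume bc: "b \<in> {0<..<1}" "c \<in> {0<..<1}" "ae_equal T `` {sol b} = ae_equal T `` {sol c}"
    have "(sol b, sol c) \<in> ae_equal T"
      using eq_equiv_class[OF bc(3) equiv_ae_equal] by simp
    from flux_eq[OF this solm[OF bc(1)] solm[OF bc(2)]] show "b = c" using sol(2) bc V by simp
  qed
  have "infinite ((\<lambda>b. ae_equal T `` {sol b}) ` {0<..<1::real})"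
    using finite_imageD[OF _ inj] infinite_Ioo[of "0::real" 1] by auto
  moreover have "(\<lambda>b. ae_equal T `` {sol b}) ` {0<..<1} \<subseteq> ?S // ae_equal T"
    using inS by (intro image_subsetI quotientI) 
  ultimately show ?thesis using finite_subset by blast
qed

end
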